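(* Let $(\Omega,\mathcal A,\mathbb P)$ be a probability space, $\theta:\Omega\to\Omega$ a bijective bimeasurable transformation preserving $\mathbb P$, and $\mathcal F_0\subseteq\mathcal A$ a sub-$\sigma$-algebra with $\mathcal F_0\subseteq\theta^{-1}(\mathcal F_0)$. Let $Y_0$ be an $\mathcal F_0$-measurable real-valued random variable with distribution $P_{Y_0}$, let $Y_i=Y_0\circ\theta^i$ for $i\in\mathbb Z$, and $\mathbf Y=(Y_i)_{i\in\mathbb Z}$. Assume that $$\sum_{k\ge1}k^{1/\sqrt3-1/2}\,\phi_{2,\mathbf Y}^{1/2}(k)<\infty .$$ Let $f\in\mathrm{Mon}^c_2(M,P_{Y_0})$ for some $M>0$, let $X_i=f(Y_i)-\mathbb E(f(Y_i))$ and $S_n=\sum_{k=1}^nX_k$. Then $$\sum_{n\ge3}\frac1n\,\mathbb P\Big(\max_{1\le k\le n}|S_k|>3CM\sqrt{n\log\log n}\Big)<\infty,$$ where $C=16\sum_{k\ge0}\phi_{1,\mathbf Y}^{1/2}(k)$.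
   Context: Function class: for a probability measure $\mu$ on $\mathbb R$ and $M\in(0,\infty)$, $\mathrm{Mon}_2(M,\mu)$ is the set of functions $g:\mathbb R\to\mathbb R$ which are monotonic on some interval and null elsewhere and such that $\mu(|g|^2)\le M^2$. $\mathrm{Mon}^c_2(M,\mu)$ is the closure in $\mathbb L^1(\mu)$ of the set of functions of the form $\sum_{\ell=1}^La_\ell f_\ell$ with $L\ge1$, $\sum_{\ell=1}^L|a_\ell|\le1$ and $f_\ell\in\mathrm{Mon}_2(M,\mu)$. Mixing coefficients: for an integrable random variable $X$, write $X^{(0)}=X-\mathbb E(X)$. For a random variable $Y=(Y_1,\dots,Y_k)$ with values in $\mathbb R^k$ and a $\sigma$-algebra $\mathcal F$, let $$\phi(\mathcal F,Y)=\sup_{(x_1,\dots,x_k)\in\mathbb R^k}\Big\|\mathbb E\Big(\prod_{j=1}^k(\mathbf 1_{Y_j\le x_j})^{(0)}\,\Big|\,\mathcal F\Big)^{(0)}\Big\|_\infty ,$$ where the outer $^{(0)}$ means that the conditional expectation is centered by its expectation. For the sequence $\mathbf Y=(Y_i)_{i\in\mathbb Z}$ and integers $k\ge1$, $n\ge0$, let $$\phi_{k,\mathbf Y}(n)=\max_{1\le l\le k}\ \sup_{n\le i_1\le\dots\le i_l}\phi\big(\mathcal F_0,(Y_{i_1},\dots,Y_{i_l})\big).$$ *)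

theory Defs
  imports "HOL-Probability.Probability"
begin

(* The membership g \<in> Mon2 B \<mu> forces g to be Borel, so the Lebesgue integral below is not
   applied to a non-measurable function when \<mu> is a Borel measure. *)
definition Mon2 :: "real \<Rightarrow> real measure \<Rightarrow> (real \<Rightarrow> real) set" where
  "Mon2 B \<mu> = {g. (\<exists>I. is_interval I \<and> (mono_on I g \<or> antimono_on I g) \<and> (\<forall>x. x \<notin> I \<longrightarrow> g x = 0))
      \<and> (\<integral>\<^sup>+x. ennreal (\<bar>g x\<bar>\<^sup>2) \<partial>\<mu>) \<le> ennreal (B\<^sup>2)}"

definition Mon2_comb :: "real \<Rightarrow> real measure \<Rightarrow> (real \<Rightarrow> real) set" where
  "Mon2_comb B \<mu> = {h. \<exists>(L::nat) (a::nat \<Rightarrow> real) g. L \<ge> 1 \<and> (\<Sum>l=1..L. \<bar>a l\<bar>) \<le> 1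
      \<and> (\<forall>l\<in>{1..L}. g l \<in> Mon2 B \<mu>) \<and> h = (\<lambda>x. \<Sum>l=1..L. a l * g l x)}"

(* Elements of the L1-closure are represented by integrable Borel functions, not by classes. *)
definition Mon2c :: "real \<Rightarrow> real measure \<Rightarrow> (real \<Rightarrow> real) set" where
  "Mon2c B \<mu> = {f. integrable \<mu> f \<and>
      (\<forall>e>0. \<exists>h\<in>Mon2_comb B \<mu>. (\<integral>\<^sup>+x. ennreal \<bar>f x - h x\<bar> \<partial>\<mu>) < ennreal e)}"

definition centered :: "'a measure \<Rightarrow> ('a \<Rightarrow> real) \<Rightarrow> 'a \<Rightarrow> real" where
  "centered P X = (\<lambda>\<omega>. X \<omega> - integral\<^sup>L P X)"

definition Linf_norm :: "'a measure \<Rightarrow> ('a \<Rightarrow> real) \<Rightarrow> ennreal" where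
  "Linf_norm P X = esssup P (\<lambda>\<omega>. ennreal \<bar>X \<omega>\<bar>)"

(* The random vector has the coordinates Y 0, ..., Y (k - 1); only x 0, ..., x (k - 1) matter. *)
definition phi_mix :: "'a measure \<Rightarrow> 'a measure \<Rightarrow> nat \<Rightarrow> (nat \<Rightarrow> 'a \<Rightarrow> real) \<Rightarrow> ennreal" where
  "phi_mix P F k Y = (SUP x::nat \<Rightarrow> real. Linf_norm P (centered P (real_cond_exp P F
      (\<lambda>\<omega>. \<Prod>j<k. centered P (\<lambda>\<omega>'. indicat_real {..x j} (Y j \<omega>')) \<omega>))))"

(* The list "is" holds the indices n \<le> i_1 \<le> ... \<le> i_l. *)
definition phi_seq_ennreal ::
    "'a measure \<Rightarrow> 'a measure \<Rightarrow> (int \<Rightarrow> 'a \<Rightarrow> real) \<Rightarrow> nat \<Rightarrow> nat \<Rightarrow> ennreal" where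
  "phi_seq_ennreal P F Y k n = (MAX l\<in>{1..k}.
      SUP is\<in>{is :: int list. length is = l \<and> sorted is \<and> (\<forall>i\<in>set is. int n \<le> i)}.
        phi_mix P F l (\<lambda>j. Y (is ! j)))"

(* Nothing is lost in the conversion to real: the coefficients are at most 2, as shown below. *)
definition phi_seq ::
    "'a measure \<Rightarrow> 'a measure \<Rightarrow> (int \<Rightarrow> 'a \<Rightarrow> real) \<Rightarrow> nat \<Rightarrow> nat \<Rightarrow> real" where
  "phi_seq P F Y k n = enn2real (phi_seq_ennreal P F Y k n)"

definition int_iterate :: "'a set \<Rightarrow> ('a \<Rightarrow> 'a) \<Rightarrow> int \<Rightarrow> 'a \<Rightarrow> 'a" where
  "int_iterate \<Omega> \<theta> i =
     (if i \<ge> 0 then \<theta> ^^ nat i else the_inv_into \<Omega> \<theta> ^^ nat (- i))"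

definition bimeasurable_mpt :: "'a measure \<Rightarrow> ('a \<Rightarrow> 'a) \<Rightarrow> bool" where
  "bimeasurable_mpt P \<theta> \<longleftrightarrow> bij_betw \<theta> (space P) (space P)
     \<and> \<theta> \<in> measurable P P \<and> the_inv_into (space P) \<theta> \<in> measurable P P \<and> distr P P \<theta> = P"

lemma phi_mix_le_2:
  assumes "prob_space P" and sub: "subalgebra P F"
    and Y: "\<And>j. j < k \<Longrightarrow> Y j \<in> borel_measurable P"
  shows "phi_mix P F k Y \<le> 2"
proof -
  interpret prob_space P by fact
  interpret finite_measure_subalgebra P F by unfold_locales (rule sub)
  have "Linf_norm P (centered P (real_cond_exp P F
      (\<lambda>\<omega>. \<Prod>j<k. centered P (\<lambda>\<omega>'. indicat_real {..x j} (Y j \<omega>')) \<omega>))) \<le> 2" for x :: "nat \<Rightarrow> real"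
  proof -
    define I where "I = (\<lambda>j \<omega>. indicat_real {..x j} (Y j \<omega>))"
    define Z where "Z = (\<lambda>\<omega>. \<Prod>j<k. centered P (I j) \<omega>)"
    have mI: "I j \<in> borel_measurable P" if "j < k" for j
      unfolding I_def using Y[OF that] by measurable
    have mc: "centered P (I j) \<in> borel_measurable P" if "j < k" for j
      unfolding centered_def using mI[OF that] by measurable
    have mZ: "Z \<in> borel_measurable P"
      unfolding Z_def using mc by (intro borel_measurable_prod) auto
    have iI: "integrable P (I j)" if "j < k" for j
      by (rule integrable_const_bound[where B=1]) (use mI[OF that] in \<open>auto simp: I_def indicator_def\<close>)
    have c1: "\<bar>centered P (I j) \<omega>\<bar> \<le> 1" if "j < k" for j \<omega>
    proof -
      have "integral\<^sup>L P (I j) \<le> 1"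
        by (rule integral_le_const[OF iI[OF that]]) (auto simp: I_def indicator_def)
      moreover have "integral\<^sup>L P (I j) \<ge> 0"
        by (rule integral_nonneg_AE) (auto simp: I_def indicator_def)
      moreover have "0 \<le> I j \<omega>" "I j \<omega> \<le> 1" by (auto simp: I_def indicator_def)
      ultimately show ?thesis unfolding centered_def by linarith
    qed
    have Z1: "\<bar>Z \<omega>\<bar> \<le> 1" for \<omega>
      unfolding Z_def abs_prod using c1 by (intro prod_le_1) auto
    have iZ: "integrable P Z"
      by (rule integrable_const_bound[where B=1]) (use mZ Z1 in auto)
    let ?E = "real_cond_exp P F Z"
    have "AE \<omega> in P. ?E \<omega> \<le> 1"
      by (rule real_cond_exp_le_c[OF iZ]) (use Z1 in \<open>auto simp: abs_le_iff\<close>)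
    moreover have "AE \<omega> in P. ?E \<omega> \<ge> - 1"
      by (rule real_cond_exp_ge_c[OF iZ]) (use Z1 in \<open>auto simp: abs_le_iff minus_le_iff\<close>)
    moreover have "\<bar>integral\<^sup>L P ?E\<bar> \<le> 1"
    proof -
      have "integral\<^sup>L P Z \<le> 1"
        by (rule integral_le_const[OF iZ]) (use Z1 in \<open>auto simp: abs_le_iff\<close>)
      moreover have "integral\<^sup>L P Z \<ge> - 1"
        by (rule integral_ge_const[OF iZ]) (use Z1 in \<open>auto simp: abs_le_iff minus_le_iff\<close>)
      ultimately show ?thesis using real_cond_exp_int(2)[OF iZ] by simp
    qed
    ultimately have ae: "AE \<omega> in P. \<bar>centered P ?E \<omega>\<bar> \<le> 2"
      unfolding centered_def by (auto elim!: eventually_elim2)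
    have "Linf_norm P (centered P ?E) \<le> ennreal 2"
      unfolding Linf_norm_def
    proof (rule esssup_I)
      show "(\<lambda>\<omega>. ennreal \<bar>centered P ?E \<omega>\<bar>) \<in> borel_measurable P"
        unfolding centered_def by measurable
      show "AE \<omega> in P. ennreal \<bar>centered P ?E \<omega>\<bar> \<le> ennreal 2"
        using ae by eventually_elim (rule ennreal_leI)
    qed
    then show ?thesis by (simp add: Z_def I_def)
  qed
  then show ?thesis unfolding phi_mix_def by (intro SUP_least)
qed

lemma phi_seq_ennreal_le_2:
  assumes "prob_space P" "subalgebra P F" "k \<ge> 1" and "\<And>i. Y i \<in> borel_measurable P"
  shows "phi_seq_ennreal P F Y k n \<le> 2"
  unfolding phi_seq_ennreal_def using assms
  by (auto intro!: Max.boundedI SUP_least phi_mix_le_2)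

end

theory Submission
  imports Defs "HOL-Real_Asymp.Real_Asymp"
begin

text \<open>
  Write \<open>F_i = \<theta>^{-i} F_0\<close>. A function that is monotonic on an interval and null elsewhere has
  interval level sets, so the bounds on half-lines given by the mixing coefficients extend to it
  when it is bounded; cutting such a \<open>g\<close> at a level \<open>\<alpha>\<close> and optimising over \<open>\<alpha>\<close>
  gives \<open>\<bar>E(g(Y_k) | F_0) - E g(Y_k)\<bar>^2 \<le> 4 \<phi>_1(k) (E(g(Y_k)^2 | F_0) + E g(Y_k)^2)\<close>.

  Fix \<open>n\<close> and truncate each monotonic function at \<open>\<surd>n / ln n\<close> and at a small multiple of
  \<open>\<surd>(n ln ln n)\<close>. The part above the second level is handled by Markov's inequality. Below it, the
  martingale \<open>M_k = E(S_n | F_k)\<close> differs from \<open>S_k\<close> by a negligible bounded term. The middle part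
  is handled by the maximal inequality in \<open>L^2\<close>; the resulting series converges because the
  truncation levels differ by a power of \<open>ln n\<close> only. The lower part is handled by an exponential
  inequality, once the predictable quadratic variation is shown to concentrate: its covariances are
  telescoped into \<open>E((S_n - S_{k-1})^2 | F_{k-1})\<close>, whose fluctuations are bounded by
  \<open>\<Sum>_{i,j} min(\<phi>_2(i), \<phi>_1(j)) \<le> (\<Sum>_i \<phi>_2(i)^{1/2})^2\<close>. All bounds are uniform over
  convex combinations, so they pass to the closure in \<open>L^1\<close>.
\<close>

subsection \<open>Functions of bounded variation, by duality\<close>

text \<open>The constants come from the following budget. For a truncated combination the martingale
  differences have second moment at most 32 \<Psi>^2 M^2, where \<Psi> sums the square roots of
  \<phi>_1; with c = C M = 16 \<Psi> M this is c^2/8. Of the threshold 3 c sqrt(n ln ln n), the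
  share 2 goes to the lower martingale and 1/4 each to the middle martingale, the upper part, the
  gap between sums and martingales, and the L^1 approximation. Two obstacles shape the proof. A
  function in the closure has no monotonicity of its own, so only its approximants can be cut; an
  approximant may depend on how many terms of the series are summed, hence bounds on partial sums
  that do not see the combination. Moreover sup-norm bounds grow with n while only second moments
  are uniformly controlled: in the variance of the quadratic variation a single factor b^2 is
  affordable, and for b = sqrt n / ln n it becomes 1/(ln n)^2, which is summable against
  1/n.\<close>

text \<open>Excluding \<open>0\<close> makes this property stable under extension by \<open>0\<close> outside an interval and
  under truncation.\<close>

definition imono :: "(real \<Rightarrow> real) \<Rightarrow> bool" where
  "imono u \<longleftrightarrow> (\<forall>K. is_interval K \<longrightarrow> 0 \<notin> K \<longrightarrow> is_interval (u -` K))"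

lemma is_interval_real_iff:
  "is_interval (S :: real set) \<longleftrightarrow> (\<forall>a b x. a \<in> S \<longrightarrow> b \<in> S \<longrightarrow> a \<le> x \<longrightarrow> x \<le> b \<longrightarrow> x \<in> S)"
  unfolding is_interval_1 by metis

text \<open>Since 0 is not in \<open>K\<close>, points of the preimage lie in \<open>I\<close>; then
  so does every point between them, and monotonicity on \<open>I\<close> traps its value.\<close>

lemma imono_of_mono_on:
  assumes I: "is_interval I" and g: "mono_on I g \<or> antimono_on I g" and 0: "\<forall>x. x \<notin> I \<longrightarrow> g x = 0"
  shows "imono g"
  unfolding imono_def is_interval_real_iff
proof (intro allI impI)
  fix K a b x
  assume K: "\<forall>a b x. a \<in> K \<longrightarrow> b \<in> K \<longrightarrow> a \<le> x \<longrightarrow> x \<le> b \<longrightarrow> x \<in> K" "(0::real) \<notin> K"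
    and ab: "a \<in> g -` K" "b \<in> g -` K" "a \<le> x" "x \<le> b"
  have "g a \<noteq> 0" "g b \<noteq> 0" using ab K(2) by auto
  then have "a \<in> I" "b \<in> I" using 0 by blast+
  then have "x \<in> I" using I[unfolded is_interval_real_iff, rule_format, of a b x] ab(3,4) by simp
  from g show "x \<in> g -` K"
  proof
    assume "mono_on I g"
    then have "g a \<le> g x" "g x \<le> g b"
      using \<open>a \<in> I\<close> \<open>b \<in> I\<close> \<open>x \<in> I\<close> ab by (auto dest: monotone_onD)
    then show ?thesis using K(1)[rule_format, of "g a" "g b" "g x"] ab by simp
  next
    assume "antimono_on I g"
    then have "g x \<le> g a" "g b \<le> g x"
      using \<open>a \<in> I\<close> \<open>b \<in> I\<close> \<open>x \<in> I\<close> ab by (auto dest: monotone_onD)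
    then show ?thesis using K(1)[rule_format, of "g b" "g a" "g x"] ab by simp
  qed
qed

text \<open>The condition \<tau> 0 = 0 keeps 0 out of the preimage of \<open>K\<close> under \<tau>,
  so that the hypothesis on \<open>u\<close> applies to this preimage.\<close>

lemma imono_comp:
  assumes "imono \<tau>" "\<tau> 0 = 0" "imono u"
  shows "imono (\<lambda>x. \<tau> (u x))"
  unfolding imono_def
proof (intro allI impI)
  fix K :: "real set" assume K: "is_interval K" "0 \<notin> K"
  have "is_interval (\<tau> -` K)" "0 \<notin> \<tau> -` K"
    using assms K by (auto simp: imono_def)
  then have "is_interval (u -` (\<tau> -` K))"
    using assms by (auto simp: imono_def)
  then show "is_interval ((\<lambda>x. \<tau> (u x)) -` K)" by (simp add: vimage_def)
qed

lemma imono_mono: "mono u \<Longrightarrow> imono u"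
  by (rule imono_of_mono_on[of UNIV]) auto

text \<open>An interval avoiding 0 lies on one side of 0. Two of its points have the same sign, so
  the modulus of a point between them lies between their moduli.\<close>

lemma imono_trunc:
  assumes "0 \<le> s"
  shows "imono (\<lambda>x. if s < \<bar>x\<bar> \<and> \<bar>x\<bar> \<le> t then x else 0)"
  unfolding imono_def is_interval_real_iff
proof (intro allI impI)
  fix K :: "real set" and a b x
  assume K: "\<forall>a b x. a \<in> K \<longrightarrow> b \<in> K \<longrightarrow> a \<le> x \<longrightarrow> x \<le> b \<longrightarrow> x \<in> K" "0 \<notin> K"
    and ab: "a \<in> (\<lambda>x. if s < \<bar>x\<bar> \<and> \<bar>x\<bar> \<le> t then x else 0) -` K"
      "b \<in> (\<lambda>x. if s < \<bar>x\<bar> \<and> \<bar>x\<bar> \<le> t then x else 0) -` K" "a \<le> x" "x \<le> b"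
  have a: "a \<in> K" "s < \<bar>a\<bar>" "\<bar>a\<bar> \<le> t" and b: "b \<in> K" "s < \<bar>b\<bar>" "\<bar>b\<bar> \<le> t"
    using ab K(2) by (auto split: if_splits)
  have x: "x \<in> K" using K(1)[rule_format, of a b x] a b ab(3,4) by simp
  have "\<not> (a \<le> 0 \<and> 0 \<le> b)" using K(1)[rule_format, of a b 0] K(2) a b by auto
  then have "s < \<bar>x\<bar>" "\<bar>x\<bar> \<le> t" using a b ab(3,4) by linarith+
  then show "x \<in> (\<lambda>x. if s < \<bar>x\<bar> \<and> \<bar>x\<bar> \<le> t then x else 0) -` K" using x by simp
qed

lemma imono_uminus: "imono u \<Longrightarrow> imono (\<lambda>x. - u x)"
  by (rule imono_comp[of uminus])
    (simp_all add: imono_of_mono_on[of UNIV] monotone_on_def)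

lemma is_interval_borel: "is_interval (S::real set) \<Longrightarrow> S \<in> sets borel"
  by (rule real_interval_borel_measurable)

lemma imono_superlevel:
  assumes "imono u" "0 < t" shows "is_interval {x. t \<le> u x}"
proof -
  have "is_interval (u -` {t..})"
    by (rule assms(1)[unfolded imono_def, rule_format]) (use assms(2) in \<open>auto simp: is_interval_ci\<close>)
  then show ?thesis by (simp add: vimage_def)
qed

text \<open>Superlevel sets are known to be intervals only at positive levels, so the positive parts
  of \<open>u\<close> and of its negative are treated separately and subtracted.\<close>

lemma imono_borel:
  assumes "imono u" shows "u \<in> borel_measurable borel"
proof -
  have pos: "(\<lambda>x. max 0 (u x)) \<in> borel_measurable borel" if "imono u" for u
  proof (rule borel_measurableI_ge)
    fix t :: real
    show "{x \<in> space borel. t \<le> max 0 (u x)} \<in> sets borel"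
    proof (cases "0 < t")
      case True
      then have "{x \<in> space borel. t \<le> max 0 (u x)} = {x. t \<le> u x}" by auto
      then show ?thesis using is_interval_borel[OF imono_superlevel[OF that True]] by simp
    next
      case False
      then have "{x \<in> space borel. t \<le> max 0 (u x)} = UNIV" by auto
      then show ?thesis by simp
    qed
  qed
  have "(\<lambda>x. max 0 (u x) - max 0 (- u x)) \<in> borel_measurable borel"
    by (intro borel_measurable_diff pos assms imono_uminus)
  also have "(\<lambda>x. max 0 (u x) - max 0 (- u x)) = u" by auto
  finally show ?thesis .
qed

text \<open>Total variation at most \<open>c\<close>, in a dual form that is linear in \<open>u\<close>: bounds for half-lines
  transfer to \<open>u\<close>.\<close>

definition bv :: "'a measure \<Rightarrow> real \<Rightarrow> (real \<Rightarrow> real) \<Rightarrow> bool" where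
  "bv P c u \<longleftrightarrow> u \<in> borel_measurable borel \<and> (\<exists>B. \<forall>x. \<bar>u x\<bar> \<le> B) \<and>
     (\<forall>Y \<xi> \<kappa>. Y \<in> borel_measurable P \<longrightarrow> integrable P \<xi> \<longrightarrow>
        (\<forall>x. \<bar>LINT w|P. indicat_real {..x} (Y w) * \<xi> w\<bar> \<le> \<kappa>) \<longrightarrow>
        \<bar>LINT w|P. u (Y w) * \<xi> w\<bar> \<le> c * \<kappa>)"

lemma real_down_set_cases:
  fixes S :: "real set"
  assumes down: "\<And>x y. y \<in> S \<Longrightarrow> x \<le> y \<Longrightarrow> x \<in> S"
  shows "S = {} \<or> S = UNIV \<or> (\<exists>x. S = {..x}) \<or> (\<exists>x. S = {..<x})"
proof (cases "S = {} \<or> S = UNIV")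
  case False
  then obtain a where "a \<notin> S" by blast
  then have "y \<le> a" if "y \<in> S" for y using down[OF that, of a] by linarith
  then have bdd: "bdd_above S" by (auto simp: bdd_above_def)
  have "y \<in> S" if "y < Sup S" for y
    using less_cSup_iff[of S y] bdd that down[of _ y] False by force
  moreover have "y \<le> Sup S" if "y \<in> S" for y using that bdd by (rule cSup_upper)
  ultimately have "S = {..Sup S} \<or> S = {..<Sup S}"
    by (cases "Sup S \<in> S") (force simp: less_le)+
  then show ?thesis by blast
qed blast

section \<open>Transfer of half-line bounds to intervals and to functions with interval superlevel
  sets\<close>

context
  fixes P :: "'a measure" and Y :: "'a \<Rightarrow> real" and \<xi> :: "'a \<Rightarrow> real" and \<kappa> :: real
  assumes Y [measurable]: "Y \<in> borel_measurable P" and \<xi> [measurable]: "integrable P \<xi>"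
    and \<kappa>: "\<And>x. \<bar>LINT w|P. indicat_real {..x} (Y w) * \<xi> w\<bar> \<le> \<kappa>"
begin

lemma indicator_mult_integrable [intro, simp]:
  "S \<in> sets borel \<Longrightarrow> integrable P (\<lambda>w. indicat_real S (Y w) * \<xi> w)"
  by (rule Bochner_Integration.integrable_bound[OF \<xi>]) (auto simp: indicator_def)

text \<open>Dominated convergence with majorant |\<xi>|. It reaches the whole line and open
  half-lines from closed half-lines without enlarging \<kappa>.\<close>

lemma indicator_seq_bound:
  assumes D: "\<And>n::nat. \<bar>LINT w|P. indicat_real (D n) (Y w) * \<xi> w\<bar> \<le> \<kappa>"
    and Dm: "\<And>n. D n \<in> sets borel" and S: "S \<in> sets borel"
    and lim: "\<And>y. (\<lambda>n. indicat_real (D n) y) \<longlonglongrightarrow> indicat_real S y"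
  shows "\<bar>LINT w|P. indicat_real S (Y w) * \<xi> w\<bar> \<le> \<kappa>"
proof -
  have "(\<lambda>n. LINT w|P. indicat_real (D n) (Y w) * \<xi> w) \<longlonglongrightarrow> (LINT w|P. indicat_real S (Y w) * \<xi> w)"
    by (rule integral_dominated_convergence[where w="\<lambda>w. \<bar>\<xi> w\<bar>"])
      (use Dm S \<xi> in \<open>auto intro!: tendsto_mult lim AE_I2 mult_left_le_one_le simp: abs_mult indicator_le_1\<close>)
  then show ?thesis using D by (intro LIMSEQ_le_const2[OF tendsto_rabs]) auto
qed

lemma down_set_bound:
  assumes S: "\<And>x y. y \<in> S \<Longrightarrow> x \<le> y \<Longrightarrow> x \<in> S"
  shows "\<bar>LINT w|P. indicat_real S (Y w) * \<xi> w\<bar> \<le> \<kappa>"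
proof -
  consider "S = {}" | "S = UNIV" | x where "S = {..x}" | x where "S = {..<x}"
    using real_down_set_cases[of S] S by blast
  then show ?thesis
  proof cases
    case 1 have "0 \<le> \<kappa>" using \<kappa>[of 0] by linarith
    then show ?thesis using 1 by simp
  next
    case 2
    show ?thesis
    proof (rule indicator_seq_bound[of "\<lambda>n. {..real n}"])
      fix y
      have "eventually (\<lambda>n. y \<le> real n) sequentially"
        using eventually_ge_at_top[of "nat \<lceil>y\<rceil>"] by eventually_elim linarith
      then have "eventually (\<lambda>n. indicat_real S y = indicat_real {..real n} y) sequentially"
        by eventually_elim (simp add: 2)
      then show "(\<lambda>n. indicat_real {..real n} y) \<longlonglongrightarrow> indicat_real S y"
        by (rule Lim_transform_eventually[OF tendsto_const])
    qed (use \<kappa> 2 in auto)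
  next
    case (3 x) then show ?thesis using \<kappa> by simp
  next
    case (4 x)
    show ?thesis
    proof (rule indicator_seq_bound[of "\<lambda>n. {..x - inverse (real (Suc n))}"])
      fix y
      have "eventually (\<lambda>n. (y < x) = (y \<le> x - inverse (real (Suc n)))) sequentially"
      proof (cases "y < x")
        case True
        then have "eventually (\<lambda>n. inverse (real (Suc n)) < x - y) sequentially"
          using order_tendstoD(2)[OF LIMSEQ_inverse_real_of_nat, of "x - y"] by simp
        then show ?thesis by eventually_elim (use True in linarith)
      next
        case False
        have "\<not> y \<le> x - inverse (real (Suc n))" for n
          using False positive_imp_inverse_positive[of "real (Suc n)"] by linarith
        then show ?thesis using False by simp
      qed
      then have "eventually (\<lambda>n. indicat_real S y = indicat_real {..x - inverse (real (Suc n))} y) sequentially"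
        by eventually_elim (simp add: 4 indicator_def)
      then show "(\<lambda>n. indicat_real {..x - inverse (real (Suc n))} y) \<longlonglongrightarrow> indicat_real S y"
        by (rule Lim_transform_eventually[OF tendsto_const])
    qed (use \<kappa> 4 in auto)
  qed
qed

text \<open>An interval is the difference of its downward closure \<open>D\<close> and of
  \<open>D - J\<close>, which is again closed downwards; each of the two costs one \<kappa>.\<close>

lemma interval_bound:
  assumes J: "is_interval J"
  shows "\<bar>LINT w|P. indicat_real J (Y w) * \<xi> w\<bar> \<le> 2 * \<kappa>"
proof -
  define D where "D = {x. \<exists>y\<in>J. x \<le> y}"
  have D: "x \<in> D" if "y \<in> D" "x \<le> y" for x y using that order_trans unfolding D_def by blast
  have DJ: "x \<in> D - J" if "y \<in> D - J" "x \<le> y" for x y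
  proof -
    obtain z where "z \<in> J" "y \<le> z" using \<open>y \<in> D - J\<close> by (auto simp: D_def)
    then have "x \<notin> J"
      using J[unfolded is_interval_real_iff, rule_format, of x z y] that by auto
    then show ?thesis using D[of y x] that by blast
  qed
  have "is_interval D" unfolding is_interval_real_iff using D by blast
  then have m: "D \<in> sets borel" "J \<in> sets borel" using J by (auto intro: is_interval_borel)
  have "J \<subseteq> D" by (auto simp: D_def)
  then have "indicat_real J y = indicat_real D y - indicat_real (D - J) y" for y
    by (auto simp: indicator_def)
  then have "(LINT w|P. indicat_real J (Y w) * \<xi> w) =
    (LINT w|P. indicat_real D (Y w) * \<xi> w) - (LINT w|P. indicat_real (D - J) (Y w) * \<xi> w)"
    using m by (simp add: left_diff_distrib)
  moreover have "\<bar>LINT w|P. indicat_real D (Y w) * \<xi> w\<bar> \<le> \<kappa>"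
    by (rule down_set_bound) (rule D)
  moreover have "\<bar>LINT w|P. indicat_real (D - J) (Y w) * \<xi> w\<bar> \<le> \<kappa>"
    by (rule down_set_bound) (rule DJ)
  ultimately show ?thesis by linarith
qed

text \<open>A Riemann sum for the layer-cake formula: \<open>v N\<close> adds a/N for each of N
  equally spaced levels not exceeding \<open>g\<close>. Every superlevel interval costs 2 \<kappa>,
  hence 2 a \<kappa> for each \<open>N\<close>, and the uniform error a/N disappears as N grows
  because \<xi> is integrable.\<close>

lemma superlevel_bound:
  assumes g: "\<And>x. 0 \<le> g x" "\<And>x. g x \<le> a" and lev: "\<And>t. 0 < t \<Longrightarrow> is_interval {x. t \<le> g x}"
    and a: "0 < a" and wm [measurable]: "g \<in> borel_measurable borel"
  shows "\<bar>LINT w|P. g (Y w) * \<xi> w\<bar> \<le> 2 * a * \<kappa>"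
proof -
  define v where "v = (\<lambda>(N::nat) x. \<Sum>i=1..N. (a / N) * indicat_real {x. real i * a / N \<le> g x} x)"
  \<comment> \<open>Counting the levels rounds \<open>g\<close> down to a multiple of a/N, which is
    the source of the uniform error in \<open>near\<close>.\<close>
  have vf: "v N x = a / N * of_int \<lfloor>g x * N / a\<rfloor>" if N: "N \<ge> 1" for N :: nat and x
  proof -
    have "{i\<in>{1..N}. real i * a / N \<le> g x} = {1..nat \<lfloor>g x * N / a\<rfloor>}"
    proof -
      have "real i * a / N \<le> g x \<longleftrightarrow> i \<le> nat \<lfloor>g x * N / a\<rfloor>" if "i \<ge> 1" for i
      proof -
        have "real i * a / N \<le> g x \<longleftrightarrow> real i \<le> g x * N / a"
          using a N by (simp add: field_simps)
        also have "\<dots> \<longleftrightarrow> i \<le> nat \<lfloor>g x * N / a\<rfloor>" using g(1)[of x] a N that by (simp add: le_nat_iff le_floor_iff)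
        finally show ?thesis .
      qed
      moreover have "nat \<lfloor>g x * N / a\<rfloor> \<le> N"
      proof -
        have "g x * N / a \<le> N" using g(2)[of x] a N by (simp add: field_simps)
        then show ?thesis by linarith
      qed
      ultimately show ?thesis by auto
    qed
    then have "card {i\<in>{1..N}. real i * a / N \<le> g x} = nat \<lfloor>g x * N / a\<rfloor>" by simp
    moreover have "v N x = a / N * card {i\<in>{1..N}. real i * a / N \<le> g x}"
      unfolding v_def sum_distrib_left[symmetric]
      by (simp add: indicator_def sum.If_cases Int_def conj_commute)
    ultimately show ?thesis using g(1)[of x] a by simp
  qed
  have near: "\<bar>g x - v N x\<bar> \<le> a / N" if N: "N \<ge> 1" for N :: nat and x
  proof -
    define z where "z = g x * N / a"
    have z: "\<bar>z - of_int \<lfloor>z\<rfloor>\<bar> \<le> 1" by linarith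
    have "g x - v N x = a / N * (z - of_int \<lfloor>z\<rfloor>)"
      using a N by (simp add: vf[OF N] z_def field_simps)
    then have "\<bar>g x - v N x\<bar> = a / N * \<bar>z - of_int \<lfloor>z\<rfloor>\<bar>" using a by (simp add: abs_mult)
    also have "\<dots> \<le> a / N * 1" using z a by (intro mult_left_mono) auto
    finally show ?thesis by simp
  qed
  have lm: "{x. real i * a / real N \<le> g x} \<in> sets borel" for i N by measurable
  have vm [measurable]: "v N \<in> borel_measurable borel" for N
    unfolding v_def using lm by measurable
  have wI: "integrable P (\<lambda>w. g (Y w) * \<xi> w)"
    by (rule Bochner_Integration.integrable_bound[of _ "\<lambda>w. a * \<xi> w"])
       (use g a \<xi> in \<open>auto simp: abs_mult intro!: mult_right_mono\<close>)
  have vb: "\<bar>LINT w|P. v N (Y w) * \<xi> w\<bar> \<le> 2 * a * \<kappa>" if N: "N \<ge> 1" for N :: nat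
  proof -
    have "(LINT w|P. v N (Y w) * \<xi> w) =
      (\<Sum>i=1..N. a / N * (LINT w|P. indicat_real {x. real i * a / N \<le> g x} (Y w) * \<xi> w))"
      unfolding v_def sum_distrib_right using lm by (simp add: mult.assoc)
    also have "\<bar>\<dots>\<bar> \<le> (\<Sum>i=1..N. a / N * (2 * \<kappa>))"
    proof (rule order_trans[OF sum_abs], rule sum_mono)
      fix i assume "i \<in> {1..N}"
      then have "0 < real i * a / N" using a N by simp
      then have "\<bar>LINT w|P. indicat_real {x. real i * a / N \<le> g x} (Y w) * \<xi> w\<bar> \<le> 2 * \<kappa>"
        by (intro interval_bound lev)
      then show "\<bar>a / N * (LINT w|P. indicat_real {x. real i * a / N \<le> g x} (Y w) * \<xi> w)\<bar> \<le> a / N * (2 * \<kappa>)"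
        using a by (simp only: abs_mult) (intro mult_mono, auto)
    qed
    finally show ?thesis using N by simp
  qed
  have vI: "integrable P (\<lambda>w. v N (Y w) * \<xi> w)" for N
    unfolding v_def sum_distrib_right using lm by (auto simp: mult.assoc)
  have "\<bar>LINT w|P. g (Y w) * \<xi> w\<bar> \<le> 2 * a * \<kappa> + a / N * (LINT w|P. \<bar>\<xi> w\<bar>)" if N: "N \<ge> 1" for N :: nat
  proof -
    have "\<bar>(LINT w|P. g (Y w) * \<xi> w) - (LINT w|P. v N (Y w) * \<xi> w)\<bar> = \<bar>LINT w|P. (g (Y w) - v N (Y w)) * \<xi> w\<bar>"
      using wI vI by (simp add: left_diff_distrib)
    also have "\<dots> \<le> (LINT w|P. \<bar>(g (Y w) - v N (Y w)) * \<xi> w\<bar>)"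
      by (rule integral_abs_bound)
    also have "\<dots> \<le> (LINT w|P. a / N * \<bar>\<xi> w\<bar>)"
    proof (intro integral_mono)
      show "integrable P (\<lambda>w. \<bar>(g (Y w) - v N (Y w)) * \<xi> w\<bar>)"
        using wI vI by (simp add: left_diff_distrib)
      show "\<bar>(g (Y w) - v N (Y w)) * \<xi> w\<bar> \<le> a / N * \<bar>\<xi> w\<bar>" for w
        unfolding abs_mult using near[OF N] by (intro mult_right_mono) auto
    qed (use \<xi> in simp)
    also have "\<dots> = a / N * (LINT w|P. \<bar>\<xi> w\<bar>)" by simp
    finally show ?thesis using vb[OF N] by linarith
  qed
  moreover have "(\<lambda>N. 2 * a * \<kappa> + a / real N * (LINT w|P. \<bar>\<xi> w\<bar>)) \<longlonglongrightarrow> 2 * a * \<kappa> + 0 * (LINT w|P. \<bar>\<xi> w\<bar>)"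
    by (intro tendsto_intros lim_const_over_n)
  ultimately show ?thesis
    by (intro LIMSEQ_le_const[of _ "2 * a * \<kappa>"]) (auto intro!: exI[of _ 1])
qed

end

text \<open>The positive and the negative part of \<open>u\<close> cost 2 a \<kappa> each. The case
  a = 0 is separate because the levels in \<open>superlevel_bound\<close> must be positive.\<close>

lemma bv_imono:
  assumes u: "imono u" "\<And>x. \<bar>u x\<bar> \<le> a"
  shows "bv P (4 * a) u"
proof (cases "a = 0")
  case True
  then have "u = (\<lambda>x. 0)" using u(2) by fastforce
  then show ?thesis unfolding bv_def using True by auto
next
  case False
  then have a: "0 < a" using u(2)[of 0] by linarith
  have um [measurable]: "u \<in> borel_measurable borel" by (rule imono_borel[OF u(1)])
  have pos: "\<bar>LINT w|P. max 0 (u (Y w)) * \<xi> w\<bar> \<le> 2 * a * \<kappa>"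
    if "imono u" "\<And>x. \<bar>u x\<bar> \<le> a" and Y: "Y \<in> borel_measurable P" "integrable P \<xi>"
      "\<forall>x. \<bar>LINT w|P. indicat_real {..x} (Y w) * \<xi> w\<bar> \<le> \<kappa>" for Y \<xi> \<kappa> and u :: "real \<Rightarrow> real"
  proof (rule superlevel_bound[OF Y(1,2) Y(3)[rule_format], where g="\<lambda>x. max 0 (u x)"])
    have [measurable]: "u \<in> borel_measurable borel" by (rule imono_borel[OF that(1)])
    show "(\<lambda>x. max 0 (u x)) \<in> borel_measurable borel" by measurable
    show "max 0 (u x) \<le> a" for x using that(2)[of x] a by auto
    fix t :: real assume "0 < t"
    then have "{x. t \<le> max 0 (u x)} = {x. t \<le> u x}" by auto
    then show "is_interval {x. t \<le> max 0 (u x)}" using imono_superlevel[OF that(1) \<open>0 < t\<close>] by simp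
  qed (use a in auto)
  show ?thesis unfolding bv_def
  proof (intro conjI allI impI um exI)
    show "\<bar>u x\<bar> \<le> a" for x by (rule u)
    fix Y \<xi> :: "'a \<Rightarrow> real" and \<kappa> assume Y [measurable]: "Y \<in> borel_measurable P" and \<xi> [measurable]: "integrable P \<xi>"
      and *: "\<forall>x. \<bar>LINT w|P. indicat_real {..x} (Y w) * \<xi> w\<bar> \<le> \<kappa>"
    have I: "integrable P (\<lambda>w. max 0 (v (Y w)) * \<xi> w)"
      if v: "v \<in> borel_measurable borel" "\<And>x. \<bar>v x\<bar> \<le> a" for v
    proof (rule Bochner_Integration.integrable_bound[of _ "\<lambda>w. a * \<xi> w"])
      have "norm (max 0 (v (Y w)) * \<xi> w) \<le> norm (a * \<xi> w)" for w
        using v(2)[of "Y w"] by (simp only: abs_mult real_norm_def) (intro mult_right_mono, auto)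
      then show "AE w in P. norm (max 0 (v (Y w)) * \<xi> w) \<le> norm (a * \<xi> w)" by simp
    qed (use \<xi> v(1) in \<open>auto intro!: borel_measurable_times borel_measurable_max intro: measurable_compose[OF Y]\<close>)
    have I: "integrable P (\<lambda>w. max 0 (u (Y w)) * \<xi> w)" "integrable P (\<lambda>w. max 0 (- u (Y w)) * \<xi> w)"
      using I[of u] I[of "\<lambda>x. - u x"] um u(2) by simp_all
    have "u y * z = max 0 (u y) * z - max 0 (- u y) * z" for y z by (simp add: max_def)
    then have "(LINT w|P. u (Y w) * \<xi> w) =
      (LINT w|P. max 0 (u (Y w)) * \<xi> w) - (LINT w|P. max 0 (- u (Y w)) * \<xi> w)"
      using I by simp
    then show "\<bar>LINT w|P. u (Y w) * \<xi> w\<bar> \<le> 4 * a * \<kappa>"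
      using pos[OF u(1) u(2) Y \<xi> *] pos[OF imono_uminus[OF u(1)] _ Y \<xi> *] u(2) by simp
  qed
qed

lemma bv_sum:
  fixes P :: "'a measure"
  assumes "finite L" and u: "\<And>l. l \<in> L \<Longrightarrow> bv P c (u l)" and A: "(\<Sum>l\<in>L. \<bar>a l\<bar>) \<le> 1" and c: "0 \<le> c"
  shows "bv P c (\<lambda>x. \<Sum>l\<in>L. a l * u l x)"
  unfolding bv_def
proof (intro conjI allI impI)
  have [measurable]: "u l \<in> borel_measurable borel" if "l \<in> L" for l using u[OF that] by (simp add: bv_def)
  show "(\<lambda>x. \<Sum>l\<in>L. a l * u l x) \<in> borel_measurable borel" by measurable
  have "\<forall>l\<in>L. \<exists>B. \<forall>x. \<bar>u l x\<bar> \<le> B" using u by (auto simp: bv_def)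
  then obtain B where B: "\<And>l x. l \<in> L \<Longrightarrow> \<bar>u l x\<bar> \<le> B l" by metis
  have "\<bar>\<Sum>l\<in>L. a l * u l x\<bar> \<le> (\<Sum>l\<in>L. \<bar>a l\<bar> * B l)" for x
    by (rule order_trans[OF sum_abs], rule sum_mono) (auto simp: abs_mult intro!: mult_left_mono B)
  then show "\<exists>B. \<forall>x. \<bar>\<Sum>l\<in>L. a l * u l x\<bar> \<le> B" by blast
  fix Y \<xi> :: "'a \<Rightarrow> real" and \<kappa> assume Y [measurable]: "Y \<in> borel_measurable P" and \<xi> [measurable]: "integrable P \<xi>"
    and *: "\<forall>x. \<bar>LINT w|P. indicat_real {..x} (Y w) * \<xi> w\<bar> \<le> \<kappa>"
  have k: "0 \<le> \<kappa>" using *[rule_format, of 0] by linarith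
  have I: "integrable P (\<lambda>w. u l (Y w) * \<xi> w)" if "l \<in> L" for l
    by (rule Bochner_Integration.integrable_bound[of _ "\<lambda>w. B l * \<xi> w"])
       (use that B \<xi> in \<open>auto simp: abs_mult intro!: AE_I2 mult_right_mono order_trans[OF B abs_ge_self]\<close>)
  have "(LINT w|P. (\<Sum>l\<in>L. a l * u l (Y w)) * \<xi> w) = (\<Sum>l\<in>L. a l * (LINT w|P. u l (Y w) * \<xi> w))"
    unfolding sum_distrib_right using I by (simp add: mult.assoc)
  also have "\<bar>\<dots>\<bar> \<le> (\<Sum>l\<in>L. \<bar>a l\<bar> * (c * \<kappa>))"
    by (rule order_trans[OF sum_abs], rule sum_mono)
      (use u Y \<xi> * in \<open>auto simp: abs_mult bv_def intro!: mult_left_mono\<close>)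
  also have "\<dots> \<le> 1 * (c * \<kappa>)"
    unfolding sum_distrib_right[symmetric] using A k c by (intro mult_right_mono) auto
  finally show "\<bar>LINT w|P. (\<Sum>l\<in>L. a l * u l (Y w)) * \<xi> w\<bar> \<le> c * \<kappa>" by simp
qed

subsection \<open>Real sums\<close>

text \<open>With u = ln N and v = ln (N + 1) one has 1/(N + 1) <= v - u and (v - u)/v^2 <= 1/u -
  1/v, so the sum telescopes.\<close>

lemma sum_inverse_ln_sq_le:
  "2 \<le> N \<Longrightarrow> (\<Sum>n=3..N. 1 / (real n * (ln (real n))\<^sup>2)) \<le> 1 / ln 2 - 1 / ln (real N)"
proof (induction N rule: dec_induct)
  case (step N)
  have N: "1 < real N" using step by simp
  define u v where "u = ln (real N)" and "v = ln (real (Suc N))"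
  have u: "0 < u" using N by (simp add: u_def)
  have uv: "u < v" using N by (simp add: u_def v_def)
  have "1 / real (Suc N) \<le> v - u"
  proof -
    have "ln (real N / real (Suc N)) \<le> real N / real (Suc N) - 1" by (rule ln_le_minus_one) (use N in auto)
    moreover have "ln (real N / real (Suc N)) = u - v" using N by (simp add: ln_div u_def v_def)
    moreover have "real N / real (Suc N) - 1 = - (1 / real (Suc N))" by (simp add: field_simps)
    ultimately show ?thesis by linarith
  qed
  then have "1 / (real (Suc N) * v\<^sup>2) \<le> (v - u) / v\<^sup>2"
    using u uv by (simp add: divide_right_mono flip: divide_divide_eq_left)
  also have "\<dots> \<le> (v - u) / (u * v)"
    using u uv by (intro divide_left_mono) (auto simp: power2_eq_square)
  also have "\<dots> = 1 / u - 1 / v" using u uv by (simp add: field_simps)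
  finally show ?case using step by (simp add: u_def v_def)
qed simp

lemma sum_inverse_le_ln:
  assumes "1 \<le> m" "m \<le> N"
  shows "(\<Sum>n=m..N. 1 / real n) \<le> 1 + ln (real N / real m)"
  using assms(2)
proof (induction N rule: dec_induct)
  case base then show ?case using assms by simp
next
  case (step N)
  have N: "1 \<le> real N" using step assms by simp
  have "1 / real (Suc N) \<le> ln (real (Suc N) / real m) - ln (real N / real m)"
  proof -
    have "ln (real N / real (Suc N)) \<le> real N / real (Suc N) - 1" by (rule ln_le_minus_one) (use N in auto)
    moreover have "ln (real N / real (Suc N)) = ln (real N / real m) - ln (real (Suc N) / real m)"
      using N assms by (simp add: ln_div)
    moreover have "real N / real (Suc N) - 1 = - (1 / real (Suc N))" by (simp add: field_simps)
    ultimately show ?thesis by linarith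
  qed
  then show ?case using step by simp
qed

lemma sum_inverse_sqrt_le: "(\<Sum>n=1..N. 1 / sqrt (real n)) \<le> 2 * sqrt (real N)"
proof (induction N)
  case (Suc N)
  define u v where "u = sqrt (real N)" and "v = sqrt (real (Suc N))"
  have uv: "0 \<le> u" "u \<le> v" "0 < v" "v\<^sup>2 = u\<^sup>2 + 1" by (auto simp: u_def v_def)
  have "2 * u * v \<le> u\<^sup>2 + v\<^sup>2" using zero_le_power2[of "u - v"] by (simp add: power2_eq_square algebra_simps)
  then have "1 + 2 * u * v \<le> 2 * v\<^sup>2" using uv by linarith
  then have "1 \<le> (2 * v - 2 * u) * v" by (simp add: power2_eq_square algebra_simps)
  then have "1 / v \<le> 2 * v - 2 * u" using uv by (simp add: divide_le_eq)
  then show ?case using Suc by (simp add: u_def v_def)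
qed simp

text \<open>The bound exp x <= 1 + x + x^2 at x = 1 gives only e <= 3. At x = 1/4, raised to the
  fourth power, it gives e <= (21/16)^4 < 3. This makes ln ln n positive from n = 3 on.\<close>

lemma ln_3_gt_1: "1 < ln (3::real)"
proof -
  have "exp (1/4 :: real) \<le> 1 + 1/4 + (1/4)\<^sup>2" by (rule exp_bound) auto
  then have "exp (1/4 :: real) ^ 4 \<le> (1 + 1/4 + (1/4)\<^sup>2) ^ 4" by (rule power_mono) simp
  moreover have "exp (1/4 :: real) ^ 4 = exp 1" using exp_of_nat_mult[of 4 "1/4::real"] by simp
  ultimately have "exp 1 < (3::real)" by (simp add: power_divide power2_eq_square)
  then show ?thesis using ln_less_cancel_iff[of "exp 1" 3] by simp
qed

abbreviation LL :: "nat \<Rightarrow> real" where "LL n \<equiv> ln (ln (real n))"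

lemma ln_gt_1: "3 \<le> n \<Longrightarrow> 1 < ln (real n)"
  using ln_3_gt_1 ln_le_cancel_iff[of 3 "real n"] by (simp del: ln_le_cancel_iff)

lemma LL_pos: "3 \<le> n \<Longrightarrow> 0 < LL n" using ln_gt_1[of n] by simp

lemma LL_mono: "3 \<le> m \<Longrightarrow> m \<le> n \<Longrightarrow> LL m \<le> LL n"
  using ln_gt_1[of m] ln_gt_1[of n] by simp

text \<open>A pointwise estimate for y = |g(Y_0)|, later multiplied by \<open>y\<close> and
  integrated: it turns the Markov bounds for the upper part into a multiple of E g(Y_0)^2. The
  condition forces n <= y^2/(\<eta>^2 \<kappa>), and the sum of 1/sqrt n up to \<open>m\<close> is
  at most 2 sqrt m.\<close>

lemma sum_inverse_tail_le:
  fixes \<eta> :: real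
  assumes \<eta>: "0 < \<eta>"
  shows "\<exists>K\<ge>0. \<forall>N y. 0 \<le> y \<longrightarrow>
    (\<Sum>n=3..N. if \<eta> * sqrt (real n * LL n) < y then 1 / sqrt (real n * LL n) else 0) \<le> K * y"
proof -
  define \<kappa> where "\<kappa> = LL 3"
  have \<kappa>: "0 < \<kappa>" unfolding \<kappa>_def by (rule LL_pos) simp
  have r: "sqrt \<kappa> * sqrt (real n) \<le> sqrt (real n * LL n)" if "3 \<le> n" for n
    using LL_mono[of 3 n] that unfolding \<kappa>_def
    by (simp add: mult.commute mult_left_mono flip: real_sqrt_mult)
  have "(\<Sum>n=3..N. if \<eta> * sqrt (real n * LL n) < y then 1 / sqrt (real n * LL n) else 0) \<le> 2 / (\<eta> * \<kappa>) * y"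
    if y: "0 \<le> y" for N y
  proof -
    define m where "m = nat \<lfloor>y\<^sup>2 / (\<eta>\<^sup>2 * \<kappa>)\<rfloor>"
    have mm: "real m \<le> y\<^sup>2 / (\<eta>\<^sup>2 * \<kappa>)" using \<kappa> by (simp add: m_def)
    have in_m: "n \<le> m" if n: "3 \<le> n" "\<eta> * sqrt (real n * LL n) < y" for n
    proof -
      have "\<eta> * (sqrt \<kappa> * sqrt (real n)) \<le> y" using mult_left_mono[OF r[OF n(1)], of \<eta>] \<eta> n(2) by linarith
      then have "(\<eta> * (sqrt \<kappa> * sqrt (real n)))\<^sup>2 \<le> y\<^sup>2" by (rule power_mono) (use \<eta> \<kappa> in auto)
      then have "real n \<le> y\<^sup>2 / (\<eta>\<^sup>2 * \<kappa>)" using \<eta> \<kappa> by (simp add: power_mult_distrib field_simps)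
      then show ?thesis by (simp add: m_def le_nat_iff le_floor_iff)
    qed
    have "(\<Sum>n=3..N. if \<eta> * sqrt (real n * LL n) < y then 1 / sqrt (real n * LL n) else 0) =
      (\<Sum>n\<in>{n\<in>{3..N}. \<eta> * sqrt (real n * LL n) < y}. 1 / sqrt (real n * LL n))"
      by (rule sum.inter_filter[symmetric]) simp
    also have "\<dots> \<le> (\<Sum>n\<in>{n\<in>{3..N}. \<eta> * sqrt (real n * LL n) < y}. 1 / sqrt \<kappa> * (1 / sqrt (real n)))"
    proof (rule sum_mono)
      fix n assume "n \<in> {n\<in>{3..N}. \<eta> * sqrt (real n * LL n) < y}"
      then have n: "3 \<le> n" by simp
      have "1 / sqrt (real n * LL n) \<le> 1 / (sqrt \<kappa> * sqrt (real n))"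
        using r[OF n] \<kappa> n LL_pos[OF n] by (intro divide_left_mono mult_pos_pos) (simp_all del: ln_gt_zero_iff)
      then show "1 / sqrt (real n * LL n) \<le> 1 / sqrt \<kappa> * (1 / sqrt (real n))" by simp
    qed
    also have "\<dots> \<le> (\<Sum>n=1..m. 1 / sqrt \<kappa> * (1 / sqrt (real n)))"
      by (rule sum_mono2) (use in_m \<kappa> in auto)
    also have "\<dots> = 1 / sqrt \<kappa> * (\<Sum>n=1..m. 1 / sqrt (real n))" by (simp add: sum_distrib_left)
    also have "\<dots> \<le> 1 / sqrt \<kappa> * (2 * sqrt (real m))"
      by (intro mult_left_mono sum_inverse_sqrt_le) (use \<kappa> in auto)
    also have "\<dots> \<le> 1 / sqrt \<kappa> * (2 * sqrt (y\<^sup>2 / (\<eta>\<^sup>2 * \<kappa>)))"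
      using mm \<kappa> by (intro mult_left_mono) auto
    also have "\<dots> = 2 / (\<eta> * \<kappa>) * y"
      using y \<eta> \<kappa> by (simp add: real_sqrt_divide real_sqrt_mult)
    finally show ?thesis .
  qed
  then show ?thesis using \<eta> \<kappa> by (intro exI[of _ "2 / (\<eta> * \<kappa>)"]) auto
qed

lemma ln_sq_le_sqrt: "1 \<le> x \<Longrightarrow> (ln x)\<^sup>2 \<le> 16 * sqrt x" for x :: real
proof -
  assume x: "1 \<le> x"
  have "ln (sqrt (sqrt x)) \<le> sqrt (sqrt x)" using ln_le_minus_one[of "sqrt (sqrt x)"] x by simp
  then have "ln x \<le> 4 * sqrt (sqrt x)" using x by (simp add: ln_sqrt)
  then have "(ln x)\<^sup>2 \<le> (4 * sqrt (sqrt x))\<^sup>2" using x by (intro power_mono) auto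
  then show ?thesis using x by (simp add: power_mult_distrib)
qed

text \<open>The indices between the two truncation levels form a range from \<open>m\<close> to at most
  \<open>m (ln m)^3\<close> up to a constant, over which the harmonic sum is of order \<open>ln (ln m)\<close>.\<close>

lemma sum_inverse_middle_le:
  fixes \<eta> :: real
  assumes \<eta>: "0 < \<eta>"
  shows "\<exists>K\<ge>0. \<forall>N y.
    (\<Sum>n=3..N. if sqrt (real n) / ln (real n) < y \<and> y \<le> \<eta> * sqrt (real n * LL n) then 1 / (real n * LL n) else 0) \<le> K"
proof -
  \<comment> \<open>\<open>c\<close> absorbs the constant of a crude bound ln u <= (4 + c) ln m, and
    \<open>K0\<close> that of the refined bound u <= K0 m (ln m)^3 drawn from it. The maxima with 1
    make \<open>ln K0\<close> nonnegative and allow \<open>c\<close> to be multiplied by ln m >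
    1.\<close>
  define c where "c = max 1 (ln ((16 * \<eta>\<^sup>2)\<^sup>2))"
  define K0 where "K0 = max 1 (\<eta>\<^sup>2 * (4 + c)\<^sup>2)"
  define \<kappa> where "\<kappa> = LL 3"
  have \<kappa>: "0 < \<kappa>" unfolding \<kappa>_def by (rule LL_pos) simp
  have c: "1 \<le> c" and K0: "1 \<le> K0" by (auto simp: c_def K0_def)
  let ?K = "3 + (1 + ln K0) / \<kappa>"
  have "(\<Sum>n=3..N. if sqrt (real n) / ln (real n) < y \<and> y \<le> \<eta> * sqrt (real n * LL n) then 1 / (real n * LL n) else 0) \<le> ?K" for N y
  proof -
    define A where "A = {n\<in>{3..N}. sqrt (real n) / ln (real n) < y \<and> y \<le> \<eta> * sqrt (real n * LL n)}"
    have e: "(\<Sum>n=3..N. if sqrt (real n) / ln (real n) < y \<and> y \<le> \<eta> * sqrt (real n * LL n) then 1 / (real n * LL n) else 0)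
      = (\<Sum>n\<in>A. 1 / (real n * LL n))"
      unfolding A_def by (rule sum.inter_filter[symmetric]) simp
    show ?thesis
    proof (cases "A = {}")
      case True then show ?thesis unfolding e using K0 \<kappa> by simp
    next
      case False
      have fA: "finite A" by (simp add: A_def)
      define m u where "m = Min A" and "u = Max A"
      have mA: "m \<in> A" and uA: "u \<in> A" using Min_in[OF fA False] Max_in[OF fA False] by (auto simp: m_def u_def)
      have AA: "A \<subseteq> {m..u}" using fA by (auto simp: m_def u_def)
      have m3: "3 \<le> m" and u3: "3 \<le> u" and mu: "m \<le> u" using mA uA AA by (auto simp: A_def)
      have lm: "1 < ln (real m)" and lu: "1 < ln (real u)" using ln_gt_1 m3 u3 by auto
      have "LL m \<le> ln (real m)" by (rule ln_bound) (use lm in simp)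
      then have LLm: "0 < LL m" "LL m \<le> ln (real m)" "\<kappa> \<le> LL m"
        using LL_pos[OF m3] LL_mono[of 3 m] m3 unfolding \<kappa>_def by blast+
      \<comment> \<open>The lower condition at \<open>u\<close> and the upper condition at
        \<open>m\<close> concern the same \<open>y\<close>, which is thereby eliminated.\<close>
      have "sqrt (real u) < \<eta> * sqrt (real m * LL m) * ln (real u)"
      proof -
        have "sqrt (real u) < y * ln (real u)" using uA lu by (simp add: A_def divide_less_eq)
        also have "\<dots> \<le> \<eta> * sqrt (real m * LL m) * ln (real u)"
          using mA lu by (intro mult_right_mono) (auto simp: A_def)
        finally show ?thesis .
      qed
      then have "(sqrt (real u))\<^sup>2 \<le> (\<eta> * sqrt (real m * LL m) * ln (real u))\<^sup>2" by (intro power_mono) auto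
      moreover have "(sqrt (real m * LL m))\<^sup>2 = real m * LL m"
        using LLm(1) by (intro real_sqrt_pow2 mult_nonneg_nonneg) linarith+
      ultimately have 1: "real u \<le> \<eta>\<^sup>2 * (real m * LL m) * (ln (real u))\<^sup>2"
        by (simp only: power_mult_distrib) simp
      have mm: "real m * LL m \<le> real m * real m"
      proof (rule mult_left_mono)
        have "ln (real m) \<le> real m" by (rule ln_bound) (use m3 in simp)
        then show "LL m \<le> real m" using LLm(2) by simp
      qed simp
      \<comment> \<open>A bootstrap: crude estimates of the logarithms bound \<open>u\<close> by a
        multiple of m^4, so ln u is at most a multiple of ln m; inserted into the inequality
        \<open>1\<close>, this gives the third power of ln m.\<close>
      have "(ln (real u))\<^sup>2 \<le> 16 * sqrt (real u)" by (rule ln_sq_le_sqrt) (use u3 in simp)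
      from mult_mono[OF mult_left_mono[OF mm, of "\<eta>\<^sup>2"] this]
      have "real u \<le> \<eta>\<^sup>2 * (real m * real m) * (16 * sqrt (real u))" using 1 by simp
      then have "sqrt (real u) * sqrt (real u) \<le> (16 * \<eta>\<^sup>2 * (real m)\<^sup>2) * sqrt (real u)"
        by (simp add: power2_eq_square mult_ac)
      then have "sqrt (real u) \<le> 16 * \<eta>\<^sup>2 * (real m)\<^sup>2" by (rule mult_right_le_imp_le) (use u3 in simp)
      then have "(sqrt (real u))\<^sup>2 \<le> (16 * \<eta>\<^sup>2 * (real m)\<^sup>2)\<^sup>2" by (intro power_mono) auto
      then have u4: "real u \<le> (16 * \<eta>\<^sup>2)\<^sup>2 * (real m) ^ 4" by (simp add: power_mult_distrib flip: power_mult)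
      have "ln (real u) \<le> ln ((16 * \<eta>\<^sup>2)\<^sup>2 * (real m) ^ 4)" using u4 u3 by (subst ln_le_cancel_iff) auto
      also have "\<dots> = ln ((16 * \<eta>\<^sup>2)\<^sup>2) + 4 * ln (real m)" using m3 \<eta> by (subst ln_mult) (auto simp: ln_realpow)
      also have "\<dots> \<le> c * 1 + 4 * ln (real m)" by (simp add: c_def)
      also have "\<dots> \<le> c * ln (real m) + 4 * ln (real m)" using c lm by (intro add_mono mult_left_mono) auto
      finally have 2: "ln (real u) \<le> (4 + c) * ln (real m)" by (simp add: algebra_simps)
      have "(ln (real u))\<^sup>2 \<le> ((4 + c) * ln (real m))\<^sup>2" using 2 lu by (intro power_mono) auto
      then have "\<eta>\<^sup>2 * (real m * LL m) * (ln (real u))\<^sup>2 \<le> \<eta>\<^sup>2 * (real m * ln (real m)) * ((4 + c) * ln (real m))\<^sup>2"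
        using LLm lm by (intro mult_mono mult_left_mono) auto
      then have "real u \<le> (\<eta>\<^sup>2 * (4 + c)\<^sup>2) * (real m * ln (real m) ^ 3)"
        using 1 by (simp add: power_mult_distrib power2_eq_square power3_eq_cube mult_ac)
      also have "\<dots> \<le> K0 * (real m * ln (real m) ^ 3)" using lm by (intro mult_right_mono) (auto simp: K0_def)
      finally have "real u / real m \<le> K0 * ln (real m) ^ 3" using m3 by (simp add: divide_le_eq mult_ac)
      then have "ln (real u / real m) \<le> ln (K0 * ln (real m) ^ 3)"
        using m3 u3 K0 lm by (subst ln_le_cancel_iff) auto
      also have "\<dots> = ln K0 + 3 * LL m" using K0 lm by (subst ln_mult) (auto simp: ln_realpow)
      finally have 3: "ln (real u / real m) \<le> ln K0 + 3 * LL m" .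
      define a where "a = LL m"
      have a: "0 < a" "\<kappa> \<le> a" using LLm unfolding a_def by blast+
      \<comment> \<open>On this range LL n is at least LL m. Dividing by LL m turns the term 3 LL m
        of the harmonic sum into 3, and what remains is largest for m = 3, so \<open>y\<close> no
        longer matters.\<close>
      have "(\<Sum>n\<in>A. 1 / (real n * LL n)) \<le> (\<Sum>n\<in>A. 1 / a * (1 / real n))"
      proof (rule sum_mono)
        fix n assume n: "n \<in> A"
        then have "a \<le> LL n" "3 \<le> n" using AA m3 LL_mono[of m n] by (auto simp: A_def a_def)
        then have "1 / LL n \<le> 1 / a" using a by (intro divide_left_mono mult_pos_pos) linarith+
        then have "1 / LL n * (1 / real n) \<le> 1 / a * (1 / real n)" by (rule mult_right_mono) simp
        then show "1 / (real n * LL n) \<le> 1 / a * (1 / real n)" by (simp add: mult.commute)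
      qed
      also have "\<dots> \<le> (\<Sum>n=m..u. 1 / a * (1 / real n))" by (rule sum_mono2[OF _ AA]) (use a in auto)
      also have "\<dots> = 1 / a * (\<Sum>n=m..u. 1 / real n)" by (simp add: sum_distrib_left)
      also have "\<dots> \<le> 1 / a * (1 + (ln K0 + 3 * a))"
        using sum_inverse_le_ln[of m u] 3[folded a_def] m3 mu a by (intro mult_left_mono) auto
      also have "\<dots> = 3 + (1 + ln K0) / a" using a by (simp add: field_simps)
      also have "\<dots> \<le> 3 + (1 + ln K0) / \<kappa>" using a \<kappa> K0 by (intro add_left_mono divide_left_mono mult_pos_pos) (linarith | simp)+
      finally show ?thesis unfolding e .
    qed
  qed
  then show ?thesis using K0 \<kappa> by (intro exI[of _ ?K]) auto
qed

lemma truncation_eventually: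
  fixes c d :: real
  assumes "0 < d"
  shows "\<forall>\<^sub>F n in sequentially. 3 \<le> n \<and> c * sqrt (ln (ln (real n))) \<le> ln (real n) \<and>
    sqrt (real n) / ln (real n) \<le> d * sqrt (real n * ln (ln (real n)))"
proof -
  have 1: "\<forall>\<^sub>F n in sequentially. c * sqrt (ln (ln (real n))) \<le> ln (real n)"
    by real_asymp
  have 2: "\<forall>\<^sub>F n in sequentially. sqrt (real n) / ln (real n) \<le> d * sqrt (real n * ln (ln (real n)))"
    using assms by real_asymp
  show ?thesis using 1 2 eventually_ge_at_top[of 3] by eventually_elim auto
qed

subsection \<open>Essentially bounded variables and conditional expectations\<close>

text \<open>Conditional expectations inherit bounds only almost everywhere, so the bound is taken
  under \<open>P\<close>, while measurability is recorded with respect to a possibly smaller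
  \<sigma>-algebra \<open>N\<close>. Stability under algebraic operations and \<open>exp\<close>
  then settles all questions of integrability.\<close>

definition ess_bdd :: "'a measure \<Rightarrow> 'a measure \<Rightarrow> ('a \<Rightarrow> real) \<Rightarrow> bool" where
  "ess_bdd P N X \<longleftrightarrow> X \<in> borel_measurable N \<and> (\<exists>B. AE w in P. \<bar>X w\<bar> \<le> B)"

lemma ess_bddI: "X \<in> borel_measurable N \<Longrightarrow> AE w in P. \<bar>X w\<bar> \<le> B \<Longrightarrow> ess_bdd P N X"
  by (auto simp: ess_bdd_def)

lemma ess_bdd_measurable: "ess_bdd P N X \<Longrightarrow> X \<in> borel_measurable N"
  by (simp add: ess_bdd_def)

lemma ess_bdd_comp2:
  assumes X: "ess_bdd P N X" and Y: "ess_bdd P N Y"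
    and f: "(\<lambda>w. f (X w) (Y w)) \<in> borel_measurable N"
    and b: "\<And>A B. \<exists>C. \<forall>x y. \<bar>x\<bar> \<le> A \<longrightarrow> \<bar>y\<bar> \<le> B \<longrightarrow> \<bar>f x y\<bar> \<le> C"
  shows "ess_bdd P N (\<lambda>w. f (X w) (Y w))"
proof -
  obtain A B where "AE w in P. \<bar>X w\<bar> \<le> A" "AE w in P. \<bar>Y w\<bar> \<le> B"
    using X Y by (auto simp: ess_bdd_def)
  moreover obtain C where "\<forall>x y. \<bar>x\<bar> \<le> A \<longrightarrow> \<bar>y\<bar> \<le> B \<longrightarrow> \<bar>f x y\<bar> \<le> C" using b by blast
  ultimately have "AE w in P. \<bar>f (X w) (Y w)\<bar> \<le> C" by (auto elim: eventually_elim2)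
  then show ?thesis using f by (rule ess_bddI[rotated])
qed

lemma ess_bdd_const [intro]: "ess_bdd P N (\<lambda>_. c)"
  by (rule ess_bddI[where B="\<bar>c\<bar>"]) auto

lemma ess_bdd_add [intro]: "ess_bdd P N X \<Longrightarrow> ess_bdd P N Y \<Longrightarrow> ess_bdd P N (\<lambda>w. X w + Y w)"
proof (rule ess_bdd_comp2[where f="(+)" and X=X and Y=Y])
  fix A B :: real
  show "\<exists>C. \<forall>x y. \<bar>x\<bar> \<le> A \<longrightarrow> \<bar>y\<bar> \<le> B \<longrightarrow> \<bar>x + y\<bar> \<le> C"
    by (rule exI[of _ "A + B"]) auto
qed (use ess_bdd_measurable in \<open>auto intro!: borel_measurable_add\<close>)

lemma ess_bdd_mult [intro]: "ess_bdd P N X \<Longrightarrow> ess_bdd P N Y \<Longrightarrow> ess_bdd P N (\<lambda>w. X w * Y w)"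
proof (rule ess_bdd_comp2[where f="(*)" and X=X and Y=Y])
  fix A B :: real
  show "\<exists>C. \<forall>x y. \<bar>x\<bar> \<le> A \<longrightarrow> \<bar>y\<bar> \<le> B \<longrightarrow> \<bar>x * y\<bar> \<le> C"
    by (rule exI[of _ "A * B"]) (auto simp: abs_mult intro!: mult_mono order_trans[OF abs_ge_zero])
qed (use ess_bdd_measurable in \<open>auto intro!: borel_measurable_times\<close>)

lemma ess_bdd_uminus [intro]: "ess_bdd P N X \<Longrightarrow> ess_bdd P N (\<lambda>w. - X w)"
  using ess_bdd_mult[OF ess_bdd_const[of P N "-1"]] by simp

lemma ess_bdd_diff [intro]: "ess_bdd P N X \<Longrightarrow> ess_bdd P N Y \<Longrightarrow> ess_bdd P N (\<lambda>w. X w - Y w)"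
  using ess_bdd_add[OF _ ess_bdd_uminus, of P N X Y] by simp

lemma ess_bdd_power2 [intro]: "ess_bdd P N X \<Longrightarrow> ess_bdd P N (\<lambda>w. (X w)\<^sup>2)"
  using ess_bdd_mult[of P N X X] by (simp add: power2_eq_square)

lemma ess_bdd_sum [intro]: "(\<And>i. i \<in> I \<Longrightarrow> ess_bdd P N (X i)) \<Longrightarrow> ess_bdd P N (\<lambda>w. \<Sum>i\<in>I. X i w)"
  by (induction I rule: infinite_finite_induct) auto

lemma ess_bdd_exp [intro]: "ess_bdd P N X \<Longrightarrow> ess_bdd P N (\<lambda>w. exp (X w))"
proof (rule ess_bdd_comp2[where f="\<lambda>x y. exp x" and X=X and Y=X])
  fix A B :: real
  show "\<exists>C. \<forall>x y. \<bar>x\<bar> \<le> A \<longrightarrow> \<bar>y\<bar> \<le> B \<longrightarrow> \<bar>exp x\<bar> \<le> C"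
    by (rule exI[of _ "exp A"]) auto
qed (auto dest: ess_bdd_measurable)

lemma ess_bdd_indicator [intro]: "A \<in> sets N \<Longrightarrow> ess_bdd P N (indicat_real A)"
  by (rule ess_bddI[where B=1]) (auto simp: indicator_def)

lemmas ess_bdd_intros = ess_bdd_const ess_bdd_add ess_bdd_mult ess_bdd_diff ess_bdd_power2 ess_bdd_sum
  ess_bdd_exp ess_bdd_uminus ess_bdd_indicator

locale filtered_prob = prob_space P for P :: "'a measure" +
  fixes F :: "nat \<Rightarrow> 'a measure"
  assumes sub: "subalgebra P (F i)" and filt: "i \<le> j \<Longrightarrow> sets (F i) \<subseteq> sets (F j)"
begin

abbreviation CE :: "nat \<Rightarrow> ('a \<Rightarrow> real) \<Rightarrow> 'a \<Rightarrow> real" where "CE k \<equiv> real_cond_exp P (F k)"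

lemma sfs: "sigma_finite_subalgebra P (F k)"
proof -
  interpret finite_measure_subalgebra P "F k" by unfold_locales (rule sub)
  show ?thesis by (rule sigma_finite_subalgebra_axioms)
qed

lemma space_F [simp]: "space (F k) = space P" using sub[of k] by (simp add: subalgebra_def)

lemma sets_F: "A \<in> sets (F k) \<Longrightarrow> A \<in> sets P" using sub[of k] by (auto simp: subalgebra_def)

lemma subalg_mono: "i \<le> j \<Longrightarrow> subalgebra (F j) (F i)"
  using filt[of i j] by (auto simp: subalgebra_def)

lemma ess_bdd_mono: "ess_bdd P (F i) X \<Longrightarrow> i \<le> j \<Longrightarrow> ess_bdd P (F j) X"
  using measurable_from_subalg[OF subalg_mono] by (auto simp: ess_bdd_def)

lemma ess_bdd_F: "ess_bdd P (F i) X \<Longrightarrow> ess_bdd P P X"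
  using measurable_from_subalg[OF sub] by (auto simp: ess_bdd_def)

lemma ess_bdd_int: "ess_bdd P P X \<Longrightarrow> integrable P X"
  unfolding ess_bdd_def by (force intro: integrable_const_bound)

lemma CE_le: "ess_bdd P P X \<Longrightarrow> AE w in P. X w \<le> c \<Longrightarrow> AE w in P. CE k X w \<le> c"
  using sigma_finite_subalgebra.real_cond_exp_le_c[OF sfs ess_bdd_int] .

lemma CE_ge: "ess_bdd P P X \<Longrightarrow> AE w in P. c \<le> X w \<Longrightarrow> AE w in P. c \<le> CE k X w"
  using sigma_finite_subalgebra.real_cond_exp_ge_c[OF sfs ess_bdd_int] .

lemma CE_bound:
  assumes "ess_bdd P P X" "AE w in P. \<bar>X w\<bar> \<le> c"
  shows "AE w in P. \<bar>CE k X w\<bar> \<le> c"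
proof -
  have "AE w in P. CE k X w \<le> c" by (rule CE_le[OF assms(1)]) (use assms(2) in auto)
  moreover have "AE w in P. -c \<le> CE k X w" by (rule CE_ge[OF assms(1)]) (use assms(2) in auto)
  ultimately show ?thesis by eventually_elim auto
qed

lemma ess_bdd_CE: "ess_bdd P P X \<Longrightarrow> ess_bdd P (F k) (CE k X)"
  using CE_bound[of X _ k] by (auto simp: ess_bdd_def)

lemma ess_bdd_CE' [intro]: "ess_bdd P P X \<Longrightarrow> ess_bdd P P (CE k X)"
  by (rule ess_bdd_F[OF ess_bdd_CE])

lemma CE_integral: "ess_bdd P P X \<Longrightarrow> (expectation (CE k X)) = (LINT w|P. X w)"
  using sigma_finite_subalgebra.real_cond_exp_int(2)[OF sfs ess_bdd_int] .

lemma CE_integral_mult: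
  assumes "ess_bdd P (F k) Z" "ess_bdd P P X"
  shows "(LINT w|P. Z w * CE k X w) = (LINT w|P. Z w * X w)"
  by (rule sigma_finite_subalgebra.real_cond_exp_intg(2)[OF sfs])
    (use assms ess_bdd_F in \<open>auto intro!: ess_bdd_int dest: ess_bdd_measurable\<close>)

lemma CE_self: "ess_bdd P (F k) X \<Longrightarrow> AE w in P. CE k X w = X w"
  using sigma_finite_subalgebra.real_cond_exp_F_meas[OF sfs ess_bdd_int[OF ess_bdd_F] ess_bdd_measurable] .

lemma CE_mult:
  "ess_bdd P (F k) Z \<Longrightarrow> ess_bdd P P X \<Longrightarrow> AE w in P. CE k (\<lambda>w. Z w * X w) w = Z w * CE k X w"
  by (rule sigma_finite_subalgebra.real_cond_exp_mult[OF sfs])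
    (use ess_bdd_F in \<open>auto intro!: ess_bdd_int dest: ess_bdd_measurable\<close>)

lemma CE_tower:
  assumes "k \<le> j" "ess_bdd P P X" shows "AE w in P. CE k (CE j X) w = CE k X w"
  by (rule sigma_finite_subalgebra.real_cond_exp_nested_subalg[OF sfs sub subalg_mono ess_bdd_int])
    (use assms in auto)

lemma CE_add: "ess_bdd P P X \<Longrightarrow> ess_bdd P P Y \<Longrightarrow>
    AE w in P. CE k (\<lambda>w. X w + Y w) w = CE k X w + CE k Y w"
  by (rule sigma_finite_subalgebra.real_cond_exp_add[OF sfs ess_bdd_int ess_bdd_int])

lemma CE_diff: "ess_bdd P P X \<Longrightarrow> ess_bdd P P Y \<Longrightarrow>
    AE w in P. CE k (\<lambda>w. X w - Y w) w = CE k X w - CE k Y w"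
  by (rule sigma_finite_subalgebra.real_cond_exp_diff[OF sfs ess_bdd_int ess_bdd_int])

lemma CE_sum:
  assumes "finite I" "\<And>i. i \<in> I \<Longrightarrow> ess_bdd P P (X i)"
  shows "AE w in P. CE k (\<lambda>w. \<Sum>i\<in>I. X i w) w = (\<Sum>i\<in>I. CE k (X i) w)"
  using assms
proof (induction I)
  case empty
  then show ?case using CE_self[OF ess_bdd_const[of P "F k" 0]] by simp
next
  case (insert x I)
  have "AE w in P. CE k (\<lambda>w. X x w + (\<Sum>i\<in>I. X i w)) w = CE k (X x) w + CE k (\<lambda>w. \<Sum>i\<in>I. X i w) w"
    by (rule CE_add) (use insert in auto)
  moreover have "AE w in P. CE k (\<lambda>w. \<Sum>i\<in>I. X i w) w = (\<Sum>i\<in>I. CE k (X i) w)" using insert by auto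
  ultimately show ?case by eventually_elim (use insert in simp)
qed

lemma CE_square:
  assumes "ess_bdd P P X" shows "AE w in P. (CE k X w)\<^sup>2 \<le> CE k (\<lambda>w. (X w)\<^sup>2) w"
  by (rule sigma_finite_subalgebra.real_cond_exp_jensens_inequality(2)[OF sfs, of X UNIV])
    (use assms convex_power2 in \<open>auto intro!: ess_bdd_int\<close>)

text \<open>Test on the event that the conditional expectation exceeds \<open>c\<close>: there the
  excess is positive, yet its integral is at most 0, so the event is null. This converts covariance
  bounds on events into almost sure bounds.\<close>

lemma CE_le_of_sets:
  assumes X: "ess_bdd P P X" and A: "\<And>A. A \<in> sets (F k) \<Longrightarrow> (LINT w|P. indicat_real A w * X w) \<le> c * prob A"
  shows "AE w in P. CE k X w \<le> c"
proof -
  define A where "A = {w \<in> space (F k). c < CE k X w}"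
  have A': "A \<in> sets (F k)" unfolding A_def by measurable
  have AP: "A \<in> sets P" using A' by (rule sets_F)
  have eb: "ess_bdd P (F k) (indicat_real A)" using A' by auto
  have bb: "ess_bdd P P (\<lambda>w. indicat_real A w * (CE k X w - c))"
    by (intro ess_bdd_intros ess_bdd_CE' X AP)
  have "(LINT w|P. indicat_real A w * (CE k X w - c)) = (LINT w|P. indicat_real A w * CE k X w) - c * prob A"
    unfolding right_diff_distrib using AP
    by (subst Bochner_Integration.integral_diff)
      (auto intro!: ess_bdd_int ess_bdd_mult ess_bdd_F[OF eb] ess_bdd_CE' X)
  also have "\<dots> \<le> 0" using A[OF A'] CE_integral_mult[OF eb X] by simp
  finally have "(LINT w|P. indicat_real A w * (CE k X w - c)) \<le> 0" .
  moreover have nn: "0 \<le> indicat_real A w * (CE k X w - c)" for w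
    by (auto simp: A_def indicator_def)
  ultimately have "(LINT w|P. indicat_real A w * (CE k X w - c)) = 0"
    by (intro antisym integral_nonneg_AE) auto
  then have "AE w in P. indicat_real A w * (CE k X w - c) = 0"
    using nn by (subst (asm) integral_nonneg_eq_0_iff_AE[OF ess_bdd_int[OF bb]]) auto
  then show ?thesis
    using AE_space by eventually_elim (auto simp: A_def indicator_def split: if_splits)
qed

lemma CE_abs_le_of_sets:
  assumes X: "ess_bdd P P X"
    and A: "\<And>A. A \<in> sets (F k) \<Longrightarrow> \<bar>LINT w|P. indicat_real A w * X w\<bar> \<le> c * prob A"
  shows "AE w in P. \<bar>CE k X w\<bar> \<le> c"
proof -
  have 1: "AE w in P. CE k X w \<le> c" by (rule CE_le_of_sets[OF X]) (use A in \<open>auto simp: abs_le_iff\<close>)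
  have "AE w in P. CE k (\<lambda>w. - X w) w \<le> c"
    by (rule CE_le_of_sets) (use X A in \<open>auto simp: abs_le_iff\<close>)
  moreover have "AE w in P. CE k (\<lambda>w. (-1) * X w) w = (-1) * CE k X w"
    by (rule CE_mult) (use X in auto)
  ultimately have "AE w in P. - CE k X w \<le> c" by (auto elim: eventually_elim2)
  with 1 show ?thesis by eventually_elim auto
qed

text \<open>Doob's inequality for nonnegative supermartingales, the supermartingale property being
  stated through integrals over events so that no conditional expectation of \<open>N\<close> is
  involved.\<close>

lemma maximal_ineq:
  assumes N: "\<And>k. k \<le> n \<Longrightarrow> ess_bdd P (F k) (N k)" and pos: "\<And>k. k \<le> n \<Longrightarrow> AE w in P. 0 \<le> N k w"
    and step: "\<And>k A. k < n \<Longrightarrow> A \<in> sets (F k) \<Longrightarrow>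
      (LINT w|P. indicat_real A w * N (Suc k) w) \<le> (LINT w|P. indicat_real A w * N k w)"
    and x: "0 < x"
  shows "x * \<P>(w in P. \<exists>k\<le>n. x \<le> N k w) \<le> expectation (N 0)"
proof -
  define U where "U k = {w \<in> space P. \<exists>i\<le>k. x \<le> N i w}" for k
  define V where "V k = {w \<in> space P. x \<le> N k w}" for k
  have V: "V k \<in> sets (F k)" if "k \<le> n" for k
  proof -
    have [measurable]: "N k \<in> borel_measurable (F k)" by (rule N[OF that, THEN ess_bdd_measurable])
    have "{w \<in> space (F k). x \<le> N k w} \<in> sets (F k)" by measurable
    then show ?thesis by (simp add: V_def)
  qed
  have U0: "U 0 = V 0" by (auto simp: U_def V_def)
  have US: "U (Suc k) = U k \<union> V (Suc k)" for k by (auto simp: U_def V_def le_Suc_eq)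
  have U: "k \<le> n \<Longrightarrow> U k \<in> sets (F k)" for k
  proof (induction k)
    case (Suc k) then show ?case using V[of "Suc k"] filt[of k "Suc k"] by (auto simp: US)
  qed (use V U0 in auto)
  have markov: "x * prob D \<le> (LINT w|P. indicat_real D w * N k w)"
    if D: "D \<in> sets P" "D \<subseteq> V k" and k: "k \<le> n" for D k
  proof -
    have "x * prob D = (LINT w|P. indicat_real D w * x)" using D by simp
    also have "\<dots> \<le> (LINT w|P. indicat_real D w * N k w)"
    proof (rule integral_mono_AE)
      show "AE w in P. indicat_real D w * x \<le> indicat_real D w * N k w"
        using D by (auto simp: indicator_def V_def)
    qed (use D N[OF k, THEN ess_bdd_F] in \<open>auto intro!: ess_bdd_int\<close>)
    finally show ?thesis .
  qed
  \<comment> \<open>The quantity that stays below the initial mean: at the first passage above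
    \<open>x\<close>, the mass of the process on the new event \<open>D\<close> is exchanged for
    \<open>x * prob D\<close>; elsewhere the process goes on.\<close>
  have "k \<le> n \<Longrightarrow> x * prob (U k) + (LINT w|P. indicat_real (space P - U k) w * N k w) \<le> expectation (N 0)" for k
  proof (induction k)
    case 0
    have s: "U 0 \<in> sets P" using U[of 0] sets_F by simp
    have b: "ess_bdd P P (N 0)" using N[of 0] ess_bdd_F by auto
    have "x * prob (U 0) \<le> (LINT w|P. indicat_real (U 0) w * N 0 w)"
      by (rule markov) (use s U0 in auto)
    moreover have "expectation (N 0) = (LINT w|P. indicat_real (U 0) w * N 0 w + indicat_real (space P - U 0) w * N 0 w)"
      by (rule Bochner_Integration.integral_cong) (auto simp: indicator_def)
    moreover have "\<dots> = (LINT w|P. indicat_real (U 0) w * N 0 w) + (LINT w|P. indicat_real (space P - U 0) w * N 0 w)"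
      by (rule Bochner_Integration.integral_add) (use s b in \<open>auto intro!: ess_bdd_int\<close>)
    ultimately show ?case by linarith
  next
    case (Suc k)
    define D where "D = V (Suc k) - U k"
    have s: "U k \<in> sets P" "U (Suc k) \<in> sets P" using U[of k] U[of "Suc k"] sets_F Suc by auto
    have D: "D \<in> sets P" using V[of "Suc k"] sets_F[of _ "Suc k"] s Suc unfolding D_def by auto
    have b: "ess_bdd P P (N (Suc k))" using N[of "Suc k"] ess_bdd_F Suc by auto
    have "prob (U (Suc k)) = prob (U k \<union> D)" by (simp add: US D_def)
    also have "\<dots> = prob (U k) + prob D"
      by (rule finite_measure_Union) (use s D in \<open>auto simp: D_def\<close>)
    finally have 1: "prob (U (Suc k)) = prob (U k) + prob D" .
    have 2: "x * prob D \<le> (LINT w|P. indicat_real D w * N (Suc k) w)"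
      by (rule markov) (use D Suc in \<open>auto simp: D_def\<close>)
    have 3: "(LINT w|P. indicat_real (space P - U k) w * N (Suc k) w) =
      (LINT w|P. indicat_real D w * N (Suc k) w + indicat_real (space P - U (Suc k)) w * N (Suc k) w)"
      by (rule Bochner_Integration.integral_cong) (auto simp: indicator_def US D_def)
    have 4: "\<dots> = (LINT w|P. indicat_real D w * N (Suc k) w) + (LINT w|P. indicat_real (space P - U (Suc k)) w * N (Suc k) w)"
      by (rule Bochner_Integration.integral_add) (use s D b in \<open>auto intro!: ess_bdd_int\<close>)
    have 5: "(LINT w|P. indicat_real (space P - U k) w * N (Suc k) w) \<le> (LINT w|P. indicat_real (space P - U k) w * N k w)"
      by (rule step) (use Suc U[of k] sets.top[of "F k"] in auto)
    have 6: "x * prob (U k) + (LINT w|P. indicat_real (space P - U k) w * N k w) \<le> expectation (N 0)"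
      using Suc by simp
    show ?case unfolding 1 distrib_left using 2 3 4 5 6 by linarith
  qed
  from this[of n] have "x * prob (U n) + (LINT w|P. indicat_real (space P - U n) w * N n w) \<le> expectation (N 0)" by simp
  moreover have "0 \<le> (LINT w|P. indicat_real (space P - U n) w * N n w)"
    using pos[of n] by (intro integral_nonneg_AE) auto
  ultimately show ?thesis unfolding U_def by linarith
qed

text \<open>By Jensen's inequality the square of \<open>CE k Z\<close> is at most the conditional
  expectation of the square, a nonnegative martingale to which the maximal inequality applies at
  level x^2.\<close>

lemma kolmogorov:
  assumes Z: "ess_bdd P P Z" and x: "0 < x"
  shows "\<P>(w in P. \<exists>k\<le>n. x \<le> \<bar>CE k Z w\<bar>) \<le> (LINT w|P. (Z w)\<^sup>2) / x\<^sup>2"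
proof -
  have Z2: "ess_bdd P P (\<lambda>w. (Z w)\<^sup>2)" using Z by auto
  have m [measurable]: "CE k X \<in> borel_measurable P" for k X by (rule borel_measurable_cond_exp2)
  have "x\<^sup>2 * \<P>(w in P. \<exists>k\<le>n. x\<^sup>2 \<le> CE k (\<lambda>w. (Z w)\<^sup>2) w) \<le> (LINT w|P. CE 0 (\<lambda>w. (Z w)\<^sup>2) w)"
  proof (rule maximal_ineq)
    fix k
    show "ess_bdd P (F k) (CE k (\<lambda>w. (Z w)\<^sup>2))" by (rule ess_bdd_CE[OF Z2])
    show "AE w in P. 0 \<le> CE k (\<lambda>w. (Z w)\<^sup>2) w" by (rule CE_ge[OF Z2]) auto
    fix A assume A: "A \<in> sets (F k)"
    then have A': "A \<in> sets (F (Suc k))" using filt[of k "Suc k"] by auto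
    show "(LINT w|P. indicat_real A w * CE (Suc k) (\<lambda>w. (Z w)\<^sup>2) w) \<le> (LINT w|P. indicat_real A w * CE k (\<lambda>w. (Z w)\<^sup>2) w)"
      using CE_integral_mult[OF ess_bdd_indicator[OF A] Z2] CE_integral_mult[OF ess_bdd_indicator[OF A'] Z2] by simp
  qed (use x in auto)
  also have "\<dots> = (LINT w|P. (Z w)\<^sup>2)" by (rule CE_integral[OF Z2])
  finally have *: "\<P>(w in P. \<exists>k\<le>n. x\<^sup>2 \<le> CE k (\<lambda>w. (Z w)\<^sup>2) w) \<le> (LINT w|P. (Z w)\<^sup>2) / x\<^sup>2"
    using x by (simp add: field_simps)
  have "AE w in P. \<forall>k\<in>{..n}. (CE k Z w)\<^sup>2 \<le> CE k (\<lambda>w. (Z w)\<^sup>2) w"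
    by (rule AE_finite_allI) (auto intro: CE_square Z)
  then have "AE w in P. w \<in> {w \<in> space P. \<exists>k\<le>n. x \<le> \<bar>CE k Z w\<bar>} \<longrightarrow> w \<in> {w \<in> space P. \<exists>k\<le>n. x\<^sup>2 \<le> CE k (\<lambda>w. (Z w)\<^sup>2) w}"
  proof eventually_elim
    case (elim w)
    have "x\<^sup>2 \<le> CE k (\<lambda>w. (Z w)\<^sup>2) w" if "k \<le> n" "x \<le> \<bar>CE k Z w\<bar>" for k
    proof -
      have "x\<^sup>2 \<le> (CE k Z w)\<^sup>2" using that x by (metis abs_le_square_iff abs_of_pos)
      then show ?thesis using elim that by force
    qed
    then show ?case by blast
  qed
  then have "\<P>(w in P. \<exists>k\<le>n. x \<le> \<bar>CE k Z w\<bar>) \<le> \<P>(w in P. \<exists>k\<le>n. x\<^sup>2 \<le> CE k (\<lambda>w. (Z w)\<^sup>2) w)"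
    by (rule finite_measure_mono_AE) measurable
  then show ?thesis using * by linarith
qed

end

subsection \<open>Mixing sequences\<close>

lemma bv_borel: "bv P c u \<Longrightarrow> u \<in> borel_measurable borel" by (simp add: bv_def)

lemma bv_ess_bdd:
  assumes "bv P c u" "Z \<in> borel_measurable N" shows "ess_bdd P N (\<lambda>w. u (Z w))"
proof -
  obtain B where "\<forall>x. \<bar>u x\<bar> \<le> B" using assms(1) unfolding bv_def by blast
  then show ?thesis
    using measurable_compose[OF assms(2) bv_borel[OF assms(1)]] by (intro ess_bddI[where B=B]) auto
qed

lemma square_le_of_linear_bounds:
  fixes z p r :: real
  assumes z: "0 \<le> z" and p: "0 \<le> p" and r: "0 \<le> r"
    and *: "\<And>\<alpha>. \<alpha> \<in> \<rat> \<Longrightarrow> 0 < \<alpha> \<Longrightarrow> z \<le> 4 * \<alpha> * p + r / (4 * \<alpha>)"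
  shows "z\<^sup>2 \<le> 4 * p * r"
proof (rule ccontr)
  assume n: "\<not> z\<^sup>2 \<le> 4 * p * r"
  have zp: "0 < z"
  proof (rule ccontr)
    assume "\<not> 0 < z"
    then have "z = 0" using z by simp
    then show False using n p r by simp
  qed
  have "\<exists>a>0. 4 * a * p + r / (4 * a) < z"
  proof (cases "p = 0")
    case True
    have "r / (4 * ((r + 1) / z)) < z" using zp r by (simp add: field_simps add_pos_nonneg)
    then show ?thesis using True zp r by (intro exI[of _ "(r + 1) / z"]) auto
  next
    case False
    then have pp: "0 < p" using p by simp
    have "4 * (z / (8 * p)) * p + r / (4 * (z / (8 * p))) = z / 2 + 2 * p * r / z"
      using pp zp by (simp add: field_simps)
    also have "\<dots> < z" using n zp by (simp add: field_simps power2_eq_square)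
    finally show ?thesis using pp zp by (intro exI[of _ "z / (8 * p)"]) auto
  qed
  then obtain a where a: "0 < a" "4 * a * p + r / (4 * a) < z" by blast
  have "((\<lambda>x. 4 * x * p + r / (4 * x)) \<longlongrightarrow> 4 * a * p + r / (4 * a)) (at a)"
    using a by (intro tendsto_intros) auto
  then have "\<forall>\<^sub>F x in at a. 4 * x * p + r / (4 * x) < z" by (rule order_tendstoD) (rule a)
  then obtain d where d: "d > 0" "\<And>x. x \<noteq> a \<Longrightarrow> dist x a < d \<Longrightarrow> 4 * x * p + r / (4 * x) < z"
    by (auto simp: eventually_at)
  obtain q where q: "q \<in> \<rat>" "a < q" "q < a + d" using Rats_dense_in_real[of a "a + d"] d by auto
  then have "4 * q * p + r / (4 * q) < z" by (intro d) (auto simp: dist_real_def)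
  moreover have "z \<le> 4 * q * p + r / (4 * q)" using q a by (intro *) auto
  ultimately show False by simp
qed

lemma shifted_sum_le:
  fixes f :: "nat \<Rightarrow> real"
  assumes f: "summable f" "\<And>k. 0 \<le> f k" and I: "finite I" "\<And>i. i \<in> I \<Longrightarrow> k \<le> i"
  shows "(\<Sum>i\<in>I. f (i - k)) \<le> suminf f"
proof -
  have "(\<Sum>i\<in>I. f (i - k)) = sum f ((\<lambda>i. i - k) ` I)"
  proof (rule sum.reindex_cong[symmetric])
    show "inj_on (\<lambda>i. i - k) I" using I(2) by (auto simp: inj_on_def) (metis le_add_diff_inverse)
  qed auto
  also have "\<dots> \<le> suminf f" by (rule sum_le_suminf) (use f I in auto)
  finally show ?thesis .
qed

abbreviation (in prob_space) cind :: "real \<Rightarrow> ('a \<Rightarrow> real) \<Rightarrow> 'a \<Rightarrow> real" where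
  "cind x Z w \<equiv> indicat_real {..x} (Z w) - (LINT w'|M. indicat_real {..x} (Z w'))"

text \<open>For a combination \<open>h\<close> of monotonic functions, \<open>c\<close> is obtained by cutting them at level \<open>\<alpha>\<close>,
  and \<open>q\<close> is the combination of their squares.\<close>

definition tame :: "'a measure \<Rightarrow> real \<Rightarrow> (real \<Rightarrow> real) \<Rightarrow> (real \<Rightarrow> real) \<Rightarrow> bool" where
  "tame P b q h \<longleftrightarrow> 0 \<le> b \<and> (\<forall>x. \<bar>h x\<bar> \<le> b) \<and> bv P (4 * b) h \<and> q \<in> borel_measurable borel \<and>
     (\<exists>B. \<forall>x. 0 \<le> q x \<and> q x \<le> B) \<and>
     (\<forall>\<alpha>>0. \<exists>c. bv P (4 * \<alpha>) c \<and> (\<forall>x. \<bar>h x - c x\<bar> \<le> q x / (4 * \<alpha>)))"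

text \<open>The sup-norm bounds of the coefficients are stated in integrated form, on events
  \<open>A\<close> of the past. In \<open>mix1\<close> the single factor is already centered; in
  \<open>mix2\<close> the product need not be, and subtracting \<open>prob A\<close> stands for the
  outer centering.\<close>

locale mixing = filtered_prob P F for P :: "'a measure" and F +
  fixes Y :: "nat \<Rightarrow> 'a \<Rightarrow> real" and \<phi>1 \<phi>2 :: "nat \<Rightarrow> real"
  assumes Y_F: "Y i \<in> borel_measurable (F i)"
    and Y_distr: "distr P borel (Y i) = distr P borel (Y 0)"
    and mix1: "\<And>A i j x. A \<in> sets (F i) \<Longrightarrow> i \<le> j \<Longrightarrow>
      \<bar>LINT w|P. indicat_real A w * cind x (Y j) w\<bar>
        \<le> \<phi>1 (j - i) * prob A"
    and mix2: "\<And>A i s t x y. A \<in> sets (F i) \<Longrightarrow> i \<le> s \<Longrightarrow> s \<le> t \<Longrightarrow>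
      \<bar>LINT w|P. (indicat_real A w - prob A) *
         (cind x (Y s) w *
          cind y (Y t) w)\<bar>
        \<le> \<phi>2 (s - i) * prob A"
    and phi1_nonneg: "0 \<le> \<phi>1 k" and phi1_le: "\<phi>1 k \<le> \<phi>2 k" and phi2_le: "\<phi>2 k \<le> 2"
    and summable2: "summable (\<lambda>k. sqrt (\<phi>2 k))"
begin

lemma Y_P [measurable]: "Y i \<in> borel_measurable P"
  using Y_F measurable_from_subalg[OF sub] by blast

lemma expect_Y:
  fixes u :: "real \<Rightarrow> real"
  assumes [measurable]: "u \<in> borel_measurable borel"
  shows "(LINT w|P. u (Y i w)) = (LINT w|P. u (Y 0 w))"
  using integral_distr[of "Y i" P borel u] integral_distr[of "Y 0" P borel u] Y_distr[of i] by simp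

lemma integrable_Y:
  fixes u :: "real \<Rightarrow> real"
  assumes "u \<in> borel_measurable borel" "integrable P (\<lambda>w. u (Y 0 w))"
  shows "integrable P (\<lambda>w. u (Y i w))"
proof -
  have "integrable (distr P borel (Y 0)) u" by (subst integrable_distr_eq) (use assms in auto)
  then have "integrable (distr P borel (Y i)) u" by (simp only: Y_distr[of i])
  then show ?thesis by (subst (asm) integrable_distr_eq) (use assms in auto)
qed

text \<open>A covariance may be centered on either side. Moving the centering onto \<zeta> leaves
  u(Z) against a fixed integrable weight, which is the form in which \<open>bv\<close> transfers
  bounds from half-lines.\<close>

lemma cov_bv:
  assumes u: "bv P c u" and Z [measurable]: "Z \<in> borel_measurable P" and \<zeta>: "ess_bdd P P \<zeta>"
    and *: "\<And>x. \<bar>LINT w|P. \<zeta> w * cind x Z w\<bar> \<le> \<kappa>"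
  shows "\<bar>LINT w|P. \<zeta> w * (u (Z w) - (LINT w|P. u (Z w)))\<bar> \<le> c * \<kappa>"
proof -
  define \<xi> where "\<xi> w = \<zeta> w - expectation \<zeta>" for w
  have eq: "(LINT w|P. \<zeta> w * (W w - expectation W)) = (LINT w|P. W w * \<xi> w)"
    if W: "ess_bdd P P W" for W
  proof -
    have I: "integrable P W" "integrable P \<zeta>" "integrable P (\<lambda>w. \<zeta> w * W w)"
      using W \<zeta> by (auto intro!: ess_bdd_int)
    have "(LINT w|P. \<zeta> w * (W w - expectation W)) = (LINT w|P. \<zeta> w * W w) - expectation \<zeta> * (LINT w|P. W w)"
      using I by (simp add: right_diff_distrib)
    also have "\<dots> = (LINT w|P. W w * \<xi> w)"
      using I by (simp add: right_diff_distrib \<xi>_def mult.commute)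
    finally show ?thesis .
  qed
  have xi: "integrable P \<xi>" unfolding \<xi>_def using \<zeta> by (auto intro!: ess_bdd_int)
  have ind: "ess_bdd P P (\<lambda>w. indicat_real {..x} (Z w))" for x
    by (rule ess_bddI[where B=1]) (auto simp: indicator_def)
  have "\<bar>LINT w|P. indicat_real {..x} (Z w) * \<xi> w\<bar> \<le> \<kappa>" for x
    using * unfolding eq[OF ind] .
  then have "\<bar>LINT w|P. u (Z w) * \<xi> w\<bar> \<le> c * \<kappa>"
    using u[unfolded bv_def, THEN conjunct2, THEN conjunct2, rule_format, OF Z xi] by simp
  then show ?thesis unfolding eq[OF bv_ess_bdd[OF u Z]] .
qed

lemma CE_bv1:
  assumes u: "bv P c u" and ij: "i \<le> j"
  shows "AE w in P. \<bar>CE i (\<lambda>w. u (Y j w) - (LINT w|P. u (Y j w))) w\<bar> \<le> c * \<phi>1 (j - i)"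
proof (rule CE_abs_le_of_sets)
  show "ess_bdd P P (\<lambda>w. u (Y j w) - (LINT w|P. u (Y j w)))"
    by (intro ess_bdd_diff ess_bdd_const bv_ess_bdd[OF u] Y_P)
  fix A assume A: "A \<in> sets (F i)"
  have "\<bar>LINT w|P. indicat_real A w * (u (Y j w) - (LINT w|P. u (Y j w)))\<bar> \<le> c * (\<phi>1 (j - i) * prob A)"
    by (rule cov_bv[OF u Y_P ess_bdd_indicator[OF sets_F[OF A]] mix1[OF A ij]])
  then show "\<bar>LINT w|P. indicat_real A w * (u (Y j w) - (LINT w|P. u (Y j w)))\<bar> \<le> c * \<phi>1 (j - i) * prob A"
    by (simp add: mult.assoc)
qed

text \<open>Half-lines are replaced one coordinate at a time: first at \<open>s\<close>, the
  centered half-line at \<open>t\<close> being part of the weight, then at \<open>t\<close> with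
  u(Y_s) in the weight. Each replacement contributes its variation as a factor.\<close>

lemma CE_bv2:
  assumes u: "bv P c u" and v: "bv P c' v" and i: "i \<le> s" "s \<le> t"
  defines "W \<equiv> \<lambda>w. (u (Y s w) - (LINT w|P. u (Y s w))) * (v (Y t w) - (LINT w|P. v (Y t w)))"
  shows "AE w in P. \<bar>CE i (\<lambda>w. W w - expectation W) w\<bar> \<le> c * c' * \<phi>2 (s - i)"
proof (rule CE_abs_le_of_sets)
  have bU: "ess_bdd P P (\<lambda>w. u (Y s w) - (LINT w|P. u (Y s w)))" and bV: "ess_bdd P P (\<lambda>w. v (Y t w) - (LINT w|P. v (Y t w)))"
    by (intro ess_bdd_diff ess_bdd_const bv_ess_bdd[OF u] bv_ess_bdd[OF v] Y_P)+
  then have W: "ess_bdd P P W" unfolding W_def by (intro ess_bdd_mult)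
  then show "ess_bdd P P (\<lambda>w. W w - expectation W)" by (intro ess_bdd_diff ess_bdd_const)
  have ind: "ess_bdd P P (\<lambda>w. cind x (Y k) w)" for x k
    by (rule ess_bdd_diff[OF ess_bddI[where B=1] ess_bdd_const]) (auto simp: indicator_def)
  fix A assume A: "A \<in> sets (F i)"
  define a where "a w = indicat_real A w - prob A" for w
  have ba: "ess_bdd P P a" unfolding a_def by (intro ess_bdd_intros sets_F[OF A])
  have 1: "\<bar>LINT w|P. (a w * cind y (Y t) w) *
      (u (Y s w) - (LINT w|P. u (Y s w)))\<bar> \<le> c * (\<phi>2 (s - i) * prob A)" for y
  proof (rule cov_bv[OF u Y_P])
    fix x
    show "\<bar>LINT w|P. (a w * cind y (Y t) w) *
      cind x (Y s) w\<bar> \<le> \<phi>2 (s - i) * prob A"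
      using mix2[OF A i, of x y] unfolding a_def by (simp only: mult.assoc mult.commute mult.left_commute)
  qed (intro ess_bdd_mult ba ind)
  have 2: "\<bar>LINT w|P. (a w * (u (Y s w) - (LINT w|P. u (Y s w)))) *
      (v (Y t w) - (LINT w|P. v (Y t w)))\<bar> \<le> c' * (c * (\<phi>2 (s - i) * prob A))"
  proof (rule cov_bv[OF v Y_P])
    fix y
    show "\<bar>LINT w|P. (a w * (u (Y s w) - (LINT w|P. u (Y s w)))) *
      cind y (Y t) w\<bar> \<le> c * (\<phi>2 (s - i) * prob A)"
      using 1[of y] by (simp only: mult.assoc mult.commute mult.left_commute)
  qed (intro ess_bdd_mult ba bU)
  have I: "integrable P W" "integrable P (\<lambda>w. indicat_real A w * W w)"
    by (intro ess_bdd_int ess_bdd_mult W ess_bdd_indicator sets_F[OF A])+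
  have "(LINT w|P. indicat_real A w * (W w - expectation W)) = (LINT w|P. indicat_real A w * W w) - prob A * expectation W"
    unfolding right_diff_distrib using I sets_F[OF A] ess_bdd_int[OF ess_bdd_indicator[OF sets_F[OF A]]] by (subst Bochner_Integration.integral_diff) auto
  also have "\<dots> = (LINT w|P. a w * W w)"
    unfolding a_def left_diff_distrib using I by (subst Bochner_Integration.integral_diff) auto
  finally show "\<bar>LINT w|P. indicat_real A w * (W w - expectation W)\<bar> \<le> c * c' * \<phi>2 (s - i) * prob A"
    using 2 by (simp add: W_def mult_ac)
qed

text \<open>\<Phi> governs sup-norm bounds, \<Psi> bounds in L^2, and \<Psi>2 the fluctuation of the
  quadratic variation. Only \<Psi> enters the threshold; the other two merely affect constants of
  convergent series and the choice of the truncation.\<close>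

definition "\<Phi> = (\<Sum>k. \<phi>1 k)"
definition "\<Psi> = (\<Sum>k. sqrt (\<phi>1 k))"
definition "\<Psi>2 = (\<Sum>k. sqrt (\<phi>2 k))"

lemma phi2_nonneg: "0 \<le> \<phi>2 k" using phi1_nonneg phi1_le order_trans by blast

lemma summable_sqrt1: "summable (\<lambda>k. sqrt (\<phi>1 k))"
  by (rule summable_comparison_test'[OF summable2, of 0]) (use phi1_nonneg phi1_le in auto)

lemma summable1: "summable \<phi>1"
proof (rule summable_comparison_test'[OF summable_mult[OF summable_sqrt1, of "sqrt 2"], of 0])
  fix k
  have "\<phi>1 k = sqrt (\<phi>1 k) * sqrt (\<phi>1 k)" using phi1_nonneg by simp
  also have "\<dots> \<le> sqrt 2 * sqrt (\<phi>1 k)"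
    using phi1_nonneg order_trans[OF phi1_le phi2_le] by (intro mult_right_mono) auto
  finally show "norm (\<phi>1 k) \<le> sqrt 2 * sqrt (\<phi>1 k)" using phi1_nonneg by simp
qed

lemma Phi_nonneg: "0 \<le> \<Phi>" unfolding \<Phi>_def by (rule suminf_nonneg[OF summable1 phi1_nonneg])
lemma Psi_nonneg: "0 \<le> \<Psi>" unfolding \<Psi>_def by (rule suminf_nonneg[OF summable_sqrt1]) (use phi1_nonneg in auto)

end

subsection \<open>Martingale approximation of partial sums\<close>

lemma (in filtered_prob) integral_mult_CE_bound:
  assumes V: "ess_bdd P (F k) V" "AE w in P. 0 \<le> V w" and W: "ess_bdd P P W" "AE w in P. \<bar>CE k W w\<bar> \<le> \<kappa>"
  shows "\<bar>LINT w|P. V w * W w\<bar> \<le> \<kappa> * expectation V"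
proof -
  have VP: "ess_bdd P P V" by (rule ess_bdd_F[OF V(1)])
  have "\<bar>LINT w|P. V w * W w\<bar> = \<bar>LINT w|P. V w * CE k W w\<bar>"
    using CE_integral_mult[OF V(1) W(1)] by simp
  also have "\<dots> \<le> (LINT w|P. \<bar>V w * CE k W w\<bar>)" by (rule integral_abs_bound)
  also have "\<dots> \<le> (LINT w|P. \<kappa> * V w)"
  proof (rule integral_mono_AE)
    show "AE w in P. \<bar>V w * CE k W w\<bar> \<le> \<kappa> * V w"
      using V(2) W(2)
    proof eventually_elim
      case (elim w)
      have "\<bar>V w * CE k W w\<bar> = \<bar>CE k W w\<bar> * V w" using elim by (simp add: abs_mult)
      then show ?case using mult_right_mono[OF elim(2,1)] by simp
    qed
    show "integrable P (\<lambda>w. \<bar>V w * CE k W w\<bar>)"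
      by (intro integrable_abs ess_bdd_int ess_bdd_mult VP ess_bdd_CE' W)
    show "integrable P (\<lambda>w. \<kappa> * V w)"
      by (intro ess_bdd_int ess_bdd_mult VP ess_bdd_const)
  qed
  also have "\<dots> = \<kappa> * expectation V" by simp
  finally show ?thesis .
qed

lemma (in filtered_prob) abs_integral_le:
  assumes "ess_bdd P P W" "AE w in P. \<bar>W w\<bar> \<le> c" shows "\<bar>LINT w|P. W w\<bar> \<le> c"
proof -
  have "\<bar>LINT w|P. W w\<bar> \<le> (LINT w|P. \<bar>W w\<bar>)" by (rule integral_abs_bound)
  also have "\<dots> \<le> (LINT w|P. c)"
    by (intro integral_mono_AE integrable_abs ess_bdd_int ess_bdd_const assms)
  finally show ?thesis by (simp add: prob_space)
qed

text \<open>Projecting further back keeps the bound, and the mean obeys the same bound; subtracting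
  it doubles the constant.\<close>

lemma (in filtered_prob) CE_bound_earlier:
  assumes W: "ess_bdd P P W" "AE w in P. \<bar>CE i W w\<bar> \<le> \<kappa>" and k: "k \<le> i"
  shows "AE w in P. \<bar>CE k (\<lambda>w. W w - expectation W) w\<bar> \<le> 2 * \<kappa>"
proof -
  have "AE w in P. \<bar>CE k (CE i W) w\<bar> \<le> \<kappa>" by (rule CE_bound[OF ess_bdd_CE'[OF W(1)] W(2)])
  moreover have "\<bar>LINT w|P. W w\<bar> \<le> \<kappa>"
    using abs_integral_le[OF ess_bdd_CE'[OF W(1)] W(2)] CE_integral[OF W(1)] by simp
  moreover have "AE w in P. CE k (\<lambda>w. W w - expectation W) w = CE k W w - CE k (\<lambda>_. LINT w|P. W w) w"
    by (rule CE_diff) (use W in auto)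
  moreover have "AE w in P. CE k (\<lambda>_. LINT w|P. W w) w = expectation W" by (rule CE_self) auto
  moreover have "AE w in P. CE k (CE i W) w = CE k W w" by (rule CE_tower[OF k W(1)])
  ultimately show ?thesis by (auto elim!: eventually_elim2)
qed

section \<open>Conditional expectations of the centered variables for a bounded function\<close>

locale tame_mixing = mixing P F Y \<phi>1 \<phi>2 for P :: "'a measure" and F Y \<phi>1 \<phi>2 +
  fixes h q :: "real \<Rightarrow> real" and b :: real and n :: nat
  assumes tame: "tame P b q h"
begin

definition X :: "nat \<Rightarrow> 'a \<Rightarrow> real" where "X i w = h (Y i w) - (LINT w|P. h (Y 0 w))"
definition Q :: real where "Q = (LINT w|P. q (Y 0 w))"
definition S :: "nat \<Rightarrow> 'a \<Rightarrow> real" where "S k w = (\<Sum>i=1..k. X i w)"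
text \<open>The martingale is closed by the partial sum at the fixed horizon \<open>n\<close>, so
  all its corrections are finite sums of conditional expectations and no limit of infinite series is
  taken.\<close>

definition M :: "nat \<Rightarrow> 'a \<Rightarrow> real" where "M k = CE k (S n)"
definition d :: "nat \<Rightarrow> 'a \<Rightarrow> real" where "d k w = M k w - M (k - 1) w"

lemma bv_h: "bv P (4 * b) h" and b_nonneg: "0 \<le> b" and h_le: "\<bar>h x\<bar> \<le> b" and q_borel [measurable]: "q \<in> borel_measurable borel"
  and q_nonneg: "0 \<le> q x"
  using tame unfolding tame_def by auto

lemma h_borel [measurable]: "h \<in> borel_measurable borel" using bv_h by (rule bv_borel)

lemma X_eq: "X i = (\<lambda>w. h (Y i w) - (LINT w|P. h (Y i w)))"
  unfolding X_def expect_Y[OF h_borel, of i] by simp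

lemma X_F: "i \<le> k \<Longrightarrow> ess_bdd P (F k) (X i)"
  unfolding X_eq by (intro ess_bdd_diff ess_bdd_const bv_ess_bdd[OF bv_h] measurable_from_subalg[OF subalg_mono Y_F])

lemma X_P: "ess_bdd P P (X i)"
  unfolding X_eq by (intro ess_bdd_diff ess_bdd_const bv_ess_bdd[OF bv_h] Y_P)

lemma X_abs: "\<bar>X i w\<bar> \<le> 2 * b"
proof -
  have "\<bar>LINT w|P. h (Y 0 w)\<bar> \<le> b"
    by (rule abs_integral_le[OF bv_ess_bdd[OF bv_h Y_P]]) (use h_le in auto)
  then show ?thesis unfolding X_def using h_le[of "Y i w"] by linarith
qed

lemma S_F: "i \<le> k \<Longrightarrow> ess_bdd P (F k) (S i)"
  unfolding S_def by (intro ess_bdd_sum X_F) auto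

lemma S_P: "ess_bdd P P (S i)"
  unfolding S_def by (intro ess_bdd_sum X_P)

lemma M_F: "i \<le> k \<Longrightarrow> ess_bdd P (F k) (M i)"
  unfolding M_def by (rule ess_bdd_mono[OF ess_bdd_CE[OF S_P]])

lemma M_P: "ess_bdd P P (M i)" unfolding M_def by (rule ess_bdd_CE'[OF S_P])

lemma d_P: "ess_bdd P P (d i)" unfolding d_def by (intro ess_bdd_diff M_P)

lemma q_P: "ess_bdd P P (\<lambda>w. q (Y i w))"
proof -
  obtain B where "\<forall>x. 0 \<le> q x \<and> q x \<le> B" using tame unfolding tame_def by auto
  then show ?thesis by (intro ess_bddI[where B=B]) auto
qed

lemma Q_nonneg: "0 \<le> Q" unfolding Q_def by (rule integral_nonneg_AE) (use q_nonneg in auto)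

lemma CE_X_abs: "k \<le> i \<Longrightarrow> AE w in P. \<bar>CE k (X i) w\<bar> \<le> 4 * b * \<phi>1 (i - k)"
  unfolding X_eq by (rule CE_bv1[OF bv_h])

text \<open>The positive part only serves to have \<open>R\<close> nonnegative everywhere.\<close>

definition R :: "nat \<Rightarrow> nat \<Rightarrow> 'a \<Rightarrow> real" where "R k i w = max 0 (CE k (\<lambda>w. q (Y i w)) w) + Q"

lemma R_integral: "expectation (R k i) = 2 * Q" and R_P: "ess_bdd P P (R k i)" and R_nonneg: "0 \<le> R k i w"
proof -
  have "AE w in P. 0 \<le> CE k (\<lambda>w. q (Y i w)) w" by (rule CE_ge[OF q_P]) (use q_nonneg in auto)
  then have *: "AE w in P. R k i w = CE k (\<lambda>w. q (Y i w)) w + Q"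
    by eventually_elim (simp add: R_def)
  have m [measurable]: "CE k X \<in> borel_measurable P" for X by (rule borel_measurable_cond_exp2)
  have Rm: "R k i \<in> borel_measurable P" unfolding R_def by measurable
  have b: "ess_bdd P P (\<lambda>w. CE k (\<lambda>w. q (Y i w)) w + Q)" by (intro ess_bdd_add ess_bdd_const ess_bdd_CE' q_P)
  then obtain B where "AE w in P. \<bar>CE k (\<lambda>w. q (Y i w)) w + Q\<bar> \<le> B" by (auto simp: ess_bdd_def)
  with * have "AE w in P. \<bar>R k i w\<bar> \<le> B" by eventually_elim simp
  then show "ess_bdd P P (R k i)" using Rm by (rule ess_bddI[rotated])
  have "expectation (R k i) = (LINT w|P. CE k (\<lambda>w. q (Y i w)) w + Q)"
    by (rule integral_cong_AE[OF Rm _ *]) measurable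
  also have "\<dots> = (LINT w|P. CE k (\<lambda>w. q (Y i w)) w) + Q"
    using ess_bdd_int[OF ess_bdd_CE'[OF q_P]] by (simp add: prob_space)
  also have "\<dots> = 2 * Q" using CE_integral[OF q_P] expect_Y[OF q_borel, of i] by (simp add: Q_def)
  finally show "expectation (R k i) = 2 * Q" .
  show "0 \<le> R k i w" using Q_nonneg by (simp add: R_def)
qed

lemma CE_X_sq:
  assumes k: "k \<le> i" shows "AE w in P. (CE k (X i) w)\<^sup>2 \<le> 4 * \<phi>1 (i - k) * R k i w"
proof -
  have *: "AE w in P. \<bar>CE k (X i) w\<bar> \<le> 4 * \<alpha> * \<phi>1 (i - k) + R k i w / (4 * \<alpha>)" if a: "0 < \<alpha>" for \<alpha>
  proof -
    obtain c where c: "bv P (4 * \<alpha>) c" "\<And>x. \<bar>h x - c x\<bar> \<le> q x / (4 * \<alpha>)"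
      using tame a unfolding tame_def by blast
    have cb [measurable]: "c \<in> borel_measurable borel" using c(1) by (rule bv_borel)
    \<comment> \<open>\<open>U\<close> is the centered cut function, controlled by its variation.
      \<open>W\<close> is what was cut off, dominated by q/(4 \<alpha>); its mean \<open>m\<close>
      is the reason for the summand \<open>Q\<close> in \<open>R\<close>.\<close>
    define U where "U w = c (Y i w) - (LINT w|P. c (Y i w))" for w
    define W where "W w = h (Y i w) - c (Y i w)" for w
    define m where "m = expectation W"
    have bc: "ess_bdd P P (\<lambda>w. c (Y i w))" and bh: "ess_bdd P P (\<lambda>w. h (Y i w))"
      by (intro bv_ess_bdd[OF c(1)] bv_ess_bdd[OF bv_h] Y_P)+
    have U: "ess_bdd P P U" and W: "ess_bdd P P W" unfolding U_def W_def
      by (intro ess_bdd_diff ess_bdd_const bc bh)+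
    have "X i w = U w + (W w - m)" for w
      using ess_bdd_int[OF bc] ess_bdd_int[OF bh] by (simp add: X_eq U_def W_def[abs_def] m_def)
    then have Xi: "X i = (\<lambda>w. U w + (W w - m))" by auto
    have 1: "AE w in P. CE k (X i) w = CE k U w + CE k (\<lambda>w. W w - m) w"
      unfolding Xi by (intro CE_add ess_bdd_diff ess_bdd_const U W)
    have 2: "AE w in P. CE k (\<lambda>w. W w - m) w = CE k W w - CE k (\<lambda>_. m) w"
      by (intro CE_diff ess_bdd_const W)
    have 3: "AE w in P. CE k (\<lambda>_. m) w = m" by (rule CE_self) auto
    have 4: "AE w in P. \<bar>CE k U w\<bar> \<le> 4 * \<alpha> * \<phi>1 (i - k)" unfolding U_def by (rule CE_bv1[OF c(1) k])
    define V where "V w = q (Y i w) * (1 / (4 * \<alpha>))" for w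
    have V: "ess_bdd P P V" unfolding V_def by (intro ess_bdd_mult ess_bdd_const q_P)
    have WV: "\<bar>W w\<bar> \<le> V w" for w using c(2) by (simp add: W_def V_def)
    have 5: "AE w in P. CE k (\<lambda>w. V w - W w) w = CE k V w - CE k W w"
      by (intro CE_diff V W)
    have 6: "AE w in P. CE k (\<lambda>w. V w + W w) w = CE k V w + CE k W w"
      by (intro CE_add V W)
    have 7: "AE w in P. 0 \<le> CE k (\<lambda>w. V w - W w) w"
      by (intro CE_ge ess_bdd_diff V W AE_I2) (use WV abs_le_iff in \<open>simp add: abs_le_iff\<close>)
    have 8: "AE w in P. 0 \<le> CE k (\<lambda>w. V w + W w) w"
    proof (intro CE_ge ess_bdd_add V W AE_I2)
      show "0 \<le> V x + W x" for x using WV[of x] by linarith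
    qed
    have 9: "AE w in P. CE k V w = CE k (\<lambda>w. q (Y i w)) w / (4 * \<alpha>)"
      using CE_mult[OF ess_bdd_const[of P "F k" "1 / (4 * \<alpha>)"] q_P[of i]]
      unfolding V_def by (simp add: mult.commute)
    have "\<bar>m\<bar> \<le> (LINT w|P. \<bar>W w\<bar>)" unfolding m_def by (rule integral_abs_bound)
    also have "\<dots> \<le> expectation V"
      by (intro integral_mono integrable_abs ess_bdd_int V W WV)
    also have "\<dots> = Q / (4 * \<alpha>)" unfolding V_def Q_def using expect_Y[OF q_borel, of i] by simp
    finally have 10: "\<bar>m\<bar> \<le> Q / (4 * \<alpha>)" .
    show ?thesis using 1 2 3 4 5 6 7 8 9
    proof eventually_elim
      case (elim w)
      have "\<bar>CE k (X i) w\<bar> \<le> 4 * \<alpha> * \<phi>1 (i - k) + CE k V w + Q / (4 * \<alpha>)"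
        using elim 10 by linarith
      also have "CE k V w \<le> max 0 (CE k (\<lambda>w. q (Y i w)) w) / (4 * \<alpha>)"
        unfolding elim(9) using a by (intro divide_right_mono) auto
      finally show ?case by (simp add: R_def add_divide_distrib)
    qed
  qed
  \<comment> \<open>The exceptional null set depends on \<alpha>; restriction to rational \<alpha>
    leaves countably many of them.\<close>
  have "AE w in P. \<forall>\<alpha>\<in>{\<alpha>\<in>\<rat>. 0 < \<alpha>}. \<bar>CE k (X i) w\<bar> \<le> 4 * \<alpha> * \<phi>1 (i - k) + R k i w / (4 * \<alpha>)"
    by (rule AE_ball_countable[THEN iffD2]) (use * in \<open>auto intro: countable_subset[OF _ countable_rat]\<close>)
  then show ?thesis
  proof eventually_elim
    case (elim w)
    then have "\<bar>CE k (X i) w\<bar>\<^sup>2 \<le> 4 * \<phi>1 (i - k) * R k i w"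
      using phi1_nonneg R_nonneg by (intro square_le_of_linear_bounds) auto
    then show ?case by simp
  qed
qed

text \<open>One bound decays in i - k through \<phi>2; the other decays in j - i, by conditioning on
  \<open>F i\<close> first. Both carry the constant 16 b^2. Replacing their minimum by the geometric
  mean gives a product of functions of the two lags, so that double sums factorise.\<close>

lemma CE_XX:
  assumes k: "k \<le> i" "i \<le> j"
  shows "AE w in P. \<bar>CE k (\<lambda>w. X i w * X j w - (LINT w|P. X i w * X j w)) w\<bar> \<le> 16 * b\<^sup>2 * (sqrt (\<phi>2 (i - k)) * sqrt (\<phi>2 (j - i)))"
proof -
  have 1: "AE w in P. \<bar>CE k (\<lambda>w. X i w * X j w - (LINT w|P. X i w * X j w)) w\<bar> \<le> 4 * b * (4 * b) * \<phi>2 (i - k)"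
    unfolding X_eq by (rule CE_bv2[OF bv_h bv_h k])
  have "AE w in P. CE i (\<lambda>w. X i w * X j w) w = X i w * CE i (X j) w" by (intro CE_mult X_F X_P) simp
  then have "AE w in P. \<bar>CE i (\<lambda>w. X i w * X j w) w\<bar> \<le> 2 * b * (4 * b * \<phi>1 (j - i))"
    using CE_X_abs[OF k(2)]
  proof eventually_elim
    case (elim w)
    then show ?case unfolding elim(1) abs_mult using X_abs b_nonneg by (intro mult_mono) auto
  qed
  then have 2: "AE w in P. \<bar>CE k (\<lambda>w. X i w * X j w - (LINT w|P. X i w * X j w)) w\<bar> \<le> 2 * (2 * b * (4 * b * \<phi>1 (j - i)))"
    by (intro CE_bound_earlier[OF _ _ k(1)] ess_bdd_mult X_P)
  from 1 2 show ?thesis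
  proof eventually_elim
    case (elim w)
    let ?x = "\<bar>CE k (\<lambda>w. X i w * X j w - (LINT w|P. X i w * X j w)) w\<bar>"
    have "?x \<le> 16 * b\<^sup>2 * \<phi>2 (i - k)" using elim(1) by (simp add: power2_eq_square)
    moreover have "?x \<le> 16 * b\<^sup>2 * \<phi>1 (j - i)" using elim(2) by (simp add: power2_eq_square)
    moreover have "16 * b\<^sup>2 * \<phi>1 (j - i) \<le> 16 * b\<^sup>2 * \<phi>2 (j - i)" by (intro mult_left_mono phi1_le) auto
    ultimately have "?x * ?x \<le> (16 * b\<^sup>2 * \<phi>2 (i - k)) * (16 * b\<^sup>2 * \<phi>2 (j - i))"
      by (intro mult_mono) (auto intro!: mult_nonneg_nonneg phi2_nonneg)
    also have "\<dots> = (16 * b\<^sup>2 * (sqrt (\<phi>2 (i - k)) * sqrt (\<phi>2 (j - i))))\<^sup>2"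
      using phi2_nonneg by (simp add: power2_eq_square algebra_simps flip: real_sqrt_mult)
    finally have "?x\<^sup>2 \<le> (16 * b\<^sup>2 * (sqrt (\<phi>2 (i - k)) * sqrt (\<phi>2 (j - i))))\<^sup>2" by (simp add: power2_eq_square)
    then show ?case by (rule power2_le_imp_le) (auto intro!: mult_nonneg_nonneg phi2_nonneg)
  qed
qed

lemma sum_CE_X_abs:
  assumes I: "finite I" "\<And>i. i \<in> I \<Longrightarrow> k \<le> i"
  shows "AE w in P. \<bar>\<Sum>i\<in>I. CE k (X i) w\<bar> \<le> 4 * b * \<Phi>"
proof -
  have "AE w in P. \<forall>i\<in>I. \<bar>CE k (X i) w\<bar> \<le> 4 * b * \<phi>1 (i - k)"
    by (rule AE_finite_allI[OF I(1)]) (rule CE_X_abs[OF I(2)])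
  then show ?thesis
  proof eventually_elim
    case (elim w)
    have "\<bar>\<Sum>i\<in>I. CE k (X i) w\<bar> \<le> (\<Sum>i\<in>I. \<bar>CE k (X i) w\<bar>)" by (rule sum_abs)
    also have "\<dots> \<le> (\<Sum>i\<in>I. 4 * b * \<phi>1 (i - k))" by (rule sum_mono) (use elim in auto)
    also have "\<dots> = 4 * b * (\<Sum>i\<in>I. \<phi>1 (i - k))" by (simp add: sum_distrib_left)
    also have "\<dots> \<le> 4 * b * \<Phi>" unfolding \<Phi>_def using b_nonneg
      by (intro mult_left_mono shifted_sum_le[OF summable1 phi1_nonneg I]) auto
    finally show ?case .
  qed
qed

text \<open>Cauchy-Schwarz with weights \<sigma>_i, the square root of \<phi>_1(i - k): each term is
  at most 2 \<sigma>_i sqrt R_i, so the square is at most 4 (\<Sum> \<sigma>_i)(\<Sum> \<sigma>_i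
  R_i), and E R_i = 2 Q yields the 8. The bound involves \<open>Q\<close> and not \<open>b\<close>,
  as it must, because \<open>b\<close> grows with \<open>n\<close>.\<close>

lemma sum_CE_X_sq:
  assumes I: "finite I" "\<And>i. i \<in> I \<Longrightarrow> k \<le> i"
  shows "(LINT w|P. (\<Sum>i\<in>I. CE k (X i) w)\<^sup>2) \<le> 8 * \<Psi>\<^sup>2 * Q"
proof -
  define \<sigma> where "\<sigma> i = sqrt (\<phi>1 (i - k))" for i
  have \<sigma>: "0 \<le> \<sigma> i" "\<sigma> i * \<sigma> i = \<phi>1 (i - k)" for i using phi1_nonneg by (auto simp: \<sigma>_def)
  have sw: "(\<Sum>i\<in>I. \<sigma> i) \<le> \<Psi>" unfolding \<Psi>_def \<sigma>_def
    by (rule shifted_sum_le[OF summable_sqrt1 _ I]) (use phi1_nonneg in auto)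
  have "AE w in P. \<forall>i\<in>I. (CE k (X i) w)\<^sup>2 \<le> 4 * \<phi>1 (i - k) * R k i w"
    by (rule AE_finite_allI[OF I(1)]) (rule CE_X_sq[OF I(2)])
  then have "AE w in P. (\<Sum>i\<in>I. CE k (X i) w)\<^sup>2 \<le> 4 * \<Psi> * (\<Sum>i\<in>I. \<sigma> i * R k i w)"
  proof eventually_elim
    case (elim w)
    have e: "\<bar>CE k (X i) w\<bar> \<le> 2 * (sqrt (\<sigma> i) * (sqrt (\<sigma> i) * sqrt (R k i w)))" if "i \<in> I" for i
    proof -
      have "\<bar>CE k (X i) w\<bar> = sqrt ((CE k (X i) w)\<^sup>2)" by simp
      also have "\<dots> \<le> sqrt (4 * (\<sigma> i * \<sigma> i) * R k i w)"
        unfolding \<sigma>(2) using elim that by (intro real_sqrt_le_mono) auto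
      also have "\<dots> = 2 * (sqrt (\<sigma> i) * (sqrt (\<sigma> i) * sqrt (R k i w)))"
        using \<sigma>(1)[of i] by (simp add: real_sqrt_mult)
      finally show ?thesis .
    qed
    have "\<bar>\<Sum>i\<in>I. CE k (X i) w\<bar> \<le> (\<Sum>i\<in>I. \<bar>CE k (X i) w\<bar>)" by (rule sum_abs)
    also have "\<dots> \<le> (\<Sum>i\<in>I. 2 * (sqrt (\<sigma> i) * (sqrt (\<sigma> i) * sqrt (R k i w))))" by (rule sum_mono[OF e])
    also have "\<dots> = 2 * (\<Sum>i\<in>I. sqrt (\<sigma> i) * (sqrt (\<sigma> i) * sqrt (R k i w)))" by (simp add: sum_distrib_left)
    finally have "\<bar>\<Sum>i\<in>I. CE k (X i) w\<bar>\<^sup>2 \<le> (2 * (\<Sum>i\<in>I. sqrt (\<sigma> i) * (sqrt (\<sigma> i) * sqrt (R k i w))))\<^sup>2"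
      by (rule power_mono) auto
    also have "\<dots> = 4 * (\<Sum>i\<in>I. sqrt (\<sigma> i) * (sqrt (\<sigma> i) * sqrt (R k i w)))\<^sup>2" by (simp add: power_mult_distrib)
    also have "\<dots> \<le> 4 * ((\<Sum>i\<in>I. (sqrt (\<sigma> i))\<^sup>2) * (\<Sum>i\<in>I. (sqrt (\<sigma> i) * sqrt (R k i w))\<^sup>2))"
      by (intro mult_left_mono Cauchy_Schwarz_ineq_sum) auto
    also have "\<dots> = 4 * ((\<Sum>i\<in>I. \<sigma> i) * (\<Sum>i\<in>I. \<sigma> i * R k i w))"
      using \<sigma> R_nonneg by (simp add: power_mult_distrib)
    also have "\<dots> \<le> 4 * (\<Psi> * (\<Sum>i\<in>I. \<sigma> i * R k i w))"
      by (intro mult_left_mono mult_right_mono sw sum_nonneg mult_nonneg_nonneg \<sigma> R_nonneg) auto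
    finally show ?case by simp
  qed
  then have "(LINT w|P. (\<Sum>i\<in>I. CE k (X i) w)\<^sup>2) \<le> (LINT w|P. 4 * \<Psi> * (\<Sum>i\<in>I. \<sigma> i * R k i w))"
    by (intro integral_mono_AE ess_bdd_int ess_bdd_intros ess_bdd_CE' X_P R_P)
  also have "\<dots> = 4 * \<Psi> * (\<Sum>i\<in>I. \<sigma> i * (2 * Q))"
    using R_P by (subst Bochner_Integration.integral_mult_right_zero, subst Bochner_Integration.integral_sum)
      (auto intro!: ess_bdd_int simp: R_integral)
  also have "\<dots> = 8 * \<Psi> * Q * (\<Sum>i\<in>I. \<sigma> i)" by (simp add: sum_distrib_left sum_distrib_right algebra_simps)
  also have "\<dots> \<le> 8 * \<Psi> * Q * \<Psi>" by (intro mult_left_mono sw mult_nonneg_nonneg Psi_nonneg Q_nonneg) auto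
  finally show ?thesis by (simp add: power2_eq_square algebra_simps)
qed

end

text \<open>The two sides differ by the sum of squares. Each term is paired with the whole tail from
  its own index on, the shape in which the covariances of \<open>D\<close> telescope.\<close>

lemma sum_square_le:
  fixes x :: "nat \<Rightarrow> real"
  shows "(\<Sum>k=1..n. x k)\<^sup>2 \<le> 2 * (\<Sum>k=1..n. x k * (\<Sum>j=k..n. x j))"
proof (induction n)
  case (Suc n)
  have "(\<Sum>k=1..Suc n. x k * (\<Sum>j=k..Suc n. x j)) = (\<Sum>k=1..n. x k * (\<Sum>j=k..Suc n. x j)) + (x (Suc n))\<^sup>2"
    by (simp add: power2_eq_square)
  also have "(\<Sum>k=1..n. x k * (\<Sum>j=k..Suc n. x j)) = (\<Sum>k=1..n. x k * (\<Sum>j=k..n. x j) + x k * x (Suc n))"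
    by (rule sum.cong) (auto simp: distrib_left)
  also have "\<dots> = (\<Sum>k=1..n. x k * (\<Sum>j=k..n. x j)) + (\<Sum>k=1..n. x k) * x (Suc n)"
    by (simp add: sum.distrib sum_distrib_right)
  finally have "2 * (\<Sum>k=1..Suc n. x k * (\<Sum>j=k..Suc n. x j)) =
    2 * (\<Sum>k=1..n. x k * (\<Sum>j=k..n. x j)) + 2 * (\<Sum>k=1..n. x k) * x (Suc n) + 2 * (x (Suc n))\<^sup>2" by simp
  moreover have "(\<Sum>k=1..Suc n. x k)\<^sup>2 = (\<Sum>k=1..n. x k)\<^sup>2 + 2 * (\<Sum>k=1..n. x k) * x (Suc n) + (x (Suc n))\<^sup>2"
    by (simp add: power2_eq_square algebra_simps)
  ultimately show ?case using Suc zero_le_power2[of "x (Suc n)"] by linarith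
qed simp

text \<open>\<open>u\<close> majorises the terms with i <= j and symmetry supplies the others,
  whence the factor 2. For fixed \<open>i\<close> the inner sum runs over the lag j - i, and the
  outer one over i - l.\<close>

lemma double_sum_le:
  fixes t :: "nat \<Rightarrow> nat \<Rightarrow> real" and \<sigma> :: "nat \<Rightarrow> real"
  assumes \<sigma>: "summable \<sigma>" "\<And>k. 0 \<le> \<sigma> k" and c: "0 \<le> c" and l: "l \<le> k"
    and t: "\<And>i j. k \<le> i \<Longrightarrow> i \<le> j \<Longrightarrow> \<bar>t i j\<bar> \<le> c * (\<sigma> (i - l) * \<sigma> (j - i))" and sym: "\<And>i j. t i j = t j i"
  shows "\<bar>\<Sum>i\<in>{k..n}. \<Sum>j\<in>{k..n}. t i j\<bar> \<le> 2 * c * (suminf \<sigma>)\<^sup>2"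
proof -
  define u where "u i j = (if i \<le> j then c * (\<sigma> (i - l) * \<sigma> (j - i)) else 0)" for i j
  have sn: "0 \<le> suminf \<sigma>" by (rule suminf_nonneg[OF \<sigma>])
  have u0: "0 \<le> u i j" for i j using \<sigma> c by (simp add: u_def)
  have tu: "\<bar>t i j\<bar> \<le> u i j + u j i" if "k \<le> i" "k \<le> j" for i j
  proof (cases "i \<le> j")
    case True
    then have "\<bar>t i j\<bar> \<le> u i j" using t[of i j] that by (simp add: u_def)
    then show ?thesis using u0[of j i] by linarith
  next
    case False
    then have "\<bar>t i j\<bar> \<le> u j i" using t[of j i] that sym[of i j] by (simp add: u_def)
    then show ?thesis using u0[of i j] by linarith
  qed
  have "(\<Sum>j\<in>{k..n}. u i j) \<le> c * (\<sigma> (i - l) * suminf \<sigma>)" for i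
  proof -
    have "(\<Sum>j\<in>{k..n}. u i j) = (\<Sum>j\<in>{j\<in>{k..n}. i \<le> j}. c * (\<sigma> (i - l) * \<sigma> (j - i)))"
      unfolding u_def by (rule sum.inter_filter[symmetric]) simp
    also have "\<dots> = c * (\<sigma> (i - l) * (\<Sum>j\<in>{j\<in>{k..n}. i \<le> j}. \<sigma> (j - i)))" by (simp add: sum_distrib_left)
    also have "\<dots> \<le> c * (\<sigma> (i - l) * suminf \<sigma>)"
      by (intro mult_left_mono shifted_sum_le c \<sigma>) auto
    finally show ?thesis .
  qed
  then have "(\<Sum>i\<in>{k..n}. \<Sum>j\<in>{k..n}. u i j) \<le> (\<Sum>i\<in>{k..n}. c * (\<sigma> (i - l) * suminf \<sigma>))" by (intro sum_mono)
  also have "\<dots> = c * suminf \<sigma> * (\<Sum>i\<in>{k..n}. \<sigma> (i - l))" by (simp add: sum_distrib_left mult_ac)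
  also have "\<dots> \<le> c * suminf \<sigma> * suminf \<sigma>"
    using l by (intro mult_left_mono shifted_sum_le \<sigma> mult_nonneg_nonneg c sn) auto
  finally have U: "(\<Sum>i\<in>{k..n}. \<Sum>j\<in>{k..n}. u i j) \<le> c * (suminf \<sigma>)\<^sup>2" by (simp add: power2_eq_square)
  have "\<bar>\<Sum>i\<in>{k..n}. \<Sum>j\<in>{k..n}. t i j\<bar> \<le> (\<Sum>i\<in>{k..n}. \<Sum>j\<in>{k..n}. \<bar>t i j\<bar>)"
    by (rule order_trans[OF sum_abs sum_mono[OF sum_abs]])
  also have "\<dots> \<le> (\<Sum>i\<in>{k..n}. \<Sum>j\<in>{k..n}. u i j + u j i)" by (intro sum_mono tu) auto
  also have "\<dots> = (\<Sum>i\<in>{k..n}. \<Sum>j\<in>{k..n}. u i j) + (\<Sum>i\<in>{k..n}. \<Sum>j\<in>{k..n}. u j i)" by (simp add: sum.distrib)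
  also have "(\<Sum>i\<in>{k..n}. \<Sum>j\<in>{k..n}. u j i) = (\<Sum>i\<in>{k..n}. \<Sum>j\<in>{k..n}. u i j)" by (rule sum.swap)
  finally show ?thesis using U by linarith
qed

section \<open>Martingale differences and their second moments\<close>

context tame_mixing
begin

text \<open>It suffices that X_1, ..., X_m are known at time \<open>k\<close>. Taking m = k - 1 for
  both M_k and M_{k-1} gives sums over the same range, and the known part cancels in their
  difference.\<close>

lemma M_eq:
  assumes "m \<le> k" "m \<le> n"
  shows "AE w in P. M k w = S m w + (\<Sum>i\<in>{Suc m..n}. CE k (X i) w)"
proof -
  have "{1..n} = {1..m} \<union> {Suc m..n}" using assms by auto
  then have "(\<Sum>i\<in>{1..n}. X i w) = (\<Sum>i\<in>{1..m}. X i w) + (\<Sum>i\<in>{Suc m..n}. X i w)" for w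
    by (simp only:) (rule sum.union_disjoint, auto)
  then have e: "S n = (\<lambda>w. S m w + (\<Sum>i\<in>{Suc m..n}. X i w))" by (simp add: S_def fun_eq_iff)
  have "AE w in P. M k w = CE k (S m) w + CE k (\<lambda>w. \<Sum>i\<in>{Suc m..n}. X i w) w"
    unfolding M_def e by (intro CE_add S_P ess_bdd_sum X_P)
  moreover have "AE w in P. CE k (S m) w = S m w" by (rule CE_self[OF S_F[OF assms(1)]])
  moreover have "AE w in P. CE k (\<lambda>w. \<Sum>i\<in>{Suc m..n}. X i w) w = (\<Sum>i\<in>{Suc m..n}. CE k (X i) w)"
    by (rule CE_sum) (auto intro: X_P)
  ultimately show ?thesis by eventually_elim simp
qed

lemma S_minus_M: "k \<le> n \<Longrightarrow> AE w in P. \<bar>S k w - M k w\<bar> \<le> 4 * b * \<Phi>"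
  using M_eq[of k k] sum_CE_X_abs[of "{Suc k..n}" k] by (auto elim!: eventually_elim2)

lemma d_eq:
  assumes "1 \<le> k" "k \<le> n"
  shows "AE w in P. d k w = (\<Sum>i\<in>{k..n}. CE k (X i) w) - (\<Sum>i\<in>{k..n}. CE (k - 1) (X i) w)"
proof -
  have k: "k - 1 \<le> n" "Suc (k - 1) = k" using assms by auto
  show ?thesis using M_eq[OF diff_le_self k(1)] M_eq[OF order_refl k(1)]
    unfolding k(2) by eventually_elim (simp add: d_def)
qed

lemma d_abs:
  assumes "1 \<le> k" "k \<le> n" shows "AE w in P. \<bar>d k w\<bar> \<le> 8 * b * \<Phi>"
proof -
  have "AE w in P. \<bar>\<Sum>i\<in>{k..n}. CE k (X i) w\<bar> \<le> 4 * b * \<Phi>" by (rule sum_CE_X_abs) auto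
  moreover have "AE w in P. \<bar>\<Sum>i\<in>{k..n}. CE (k - 1) (X i) w\<bar> \<le> 4 * b * \<Phi>" by (rule sum_CE_X_abs) auto
  ultimately show ?thesis using d_eq[OF assms] by eventually_elim linarith
qed

text \<open>By (x - y)^2 <= 2 x^2 + 2 y^2 the constant is 4 times 8. The factor 16 in the definition
  of \<open>C\<close> originates here, as 32 = 16^2/8.\<close>

lemma d_sq:
  assumes "1 \<le> k" "k \<le> n" shows "(LINT w|P. (d k w)\<^sup>2) \<le> 32 * \<Psi>\<^sup>2 * Q"
proof -
  define U where "U j w = (\<Sum>i\<in>{k..n}. CE j (X i) w)" for j w
  have U: "ess_bdd P P (U j)" for j unfolding U_def by (intro ess_bdd_sum ess_bdd_CE' X_P)
  have "(LINT w|P. (d k w)\<^sup>2) \<le> (LINT w|P. 2 * (U k w)\<^sup>2 + 2 * (U (k - 1) w)\<^sup>2)"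
  proof (rule integral_mono_AE)
    show "AE w in P. (d k w)\<^sup>2 \<le> 2 * (U k w)\<^sup>2 + 2 * (U (k - 1) w)\<^sup>2"
      using d_eq[OF assms]
    proof eventually_elim
      case (elim w)
      have "0 \<le> (U k w + U (k - 1) w)\<^sup>2" by simp
      then show ?case unfolding elim U_def by (simp add: power2_eq_square algebra_simps)
    qed
  qed (intro ess_bdd_int ess_bdd_intros U d_P)+
  also have "\<dots> = 2 * (LINT w|P. (U k w)\<^sup>2) + 2 * (LINT w|P. (U (k - 1) w)\<^sup>2)"
    using ess_bdd_int[OF ess_bdd_power2[OF U]] by simp
  also have "\<dots> \<le> 2 * (8 * \<Psi>\<^sup>2 * Q) + 2 * (8 * \<Psi>\<^sup>2 * Q)"
    unfolding U_def by (intro add_mono mult_left_mono sum_CE_X_sq) auto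
  also have "\<dots> = 32 * \<Psi>\<^sup>2 * Q" by simp
  finally show ?thesis .
qed

lemma d_orth:
  assumes V: "ess_bdd P (F j) V" shows "(LINT w|P. V w * d (Suc j) w) = 0"
proof -
  have VP: "ess_bdd P P V" using ess_bdd_F[OF V] .
  have "(LINT w|P. V w * d (Suc j) w) = (LINT w|P. V w * M (Suc j) w) - (LINT w|P. V w * M j w)"
    unfolding d_def right_diff_distrib diff_Suc_1
    by (intro Bochner_Integration.integral_diff ess_bdd_int ess_bdd_mult VP M_P)
  then show ?thesis
    using CE_integral_mult[OF V S_P] CE_integral_mult[OF ess_bdd_mono[OF V] S_P, of "Suc j"] by (simp add: M_def)
qed

text \<open>Orthogonality of martingale increments survives a weight known at the starting time
  \<open>k\<close>: in each cross term, weight and earlier increment together are measurable before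
  the new difference.\<close>

lemma M_increment_sq:
  assumes V: "ess_bdd P (F k) V"
  shows "(LINT w|P. V w * (M (k + m) w - M k w)\<^sup>2) = (\<Sum>j\<in>{Suc k..k + m}. LINT w|P. V w * (d j w)\<^sup>2)"
proof (induction m)
  case (Suc m)
  have VP: "ess_bdd P P V" using ess_bdd_F[OF V] .
  define W where "W w = M (k + m) w - M k w" for w
  have W: "ess_bdd P (F (k + m)) W" unfolding W_def by (intro ess_bdd_diff M_F) auto
  have WP: "ess_bdd P P W" using ess_bdd_F[OF W] .
  let ?d = "d (Suc (k + m))"
  have "V w * (M (k + Suc m) w - M k w)\<^sup>2 = V w * (W w)\<^sup>2 + (2 * (V w * W w * ?d w) + V w * (?d w)\<^sup>2)" for w
    by (simp add: W_def d_def power2_eq_square algebra_simps)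
  then have "(LINT w|P. V w * (M (k + Suc m) w - M k w)\<^sup>2) =
    (LINT w|P. V w * (W w)\<^sup>2 + (2 * (V w * W w * ?d w) + V w * (?d w)\<^sup>2))" by simp
  also have "\<dots> = (LINT w|P. V w * (W w)\<^sup>2) + (LINT w|P. 2 * (V w * W w * ?d w) + V w * (?d w)\<^sup>2)"
    by (intro Bochner_Integration.integral_add ess_bdd_int ess_bdd_intros VP WP d_P)
  also have "(LINT w|P. 2 * (V w * W w * ?d w) + V w * (?d w)\<^sup>2) = (LINT w|P. 2 * (V w * W w * ?d w)) + (LINT w|P. V w * (?d w)\<^sup>2)"
    by (intro Bochner_Integration.integral_add ess_bdd_int ess_bdd_intros VP WP d_P)
  also have "(LINT w|P. 2 * (V w * W w * ?d w)) = 0"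
    using d_orth[of "k + m" "\<lambda>w. V w * W w"] ess_bdd_mult[OF ess_bdd_mono[OF V] W] by simp
  finally show ?case using Suc by (simp add: W_def)
qed simp

lemma M_n: "AE w in P. M n w = S n w" unfolding M_def by (rule CE_self[OF S_F]) simp

text \<open>The increments M_k - M_0 are the conditional expectations of \<open>Z\<close> = S_n -
  M_0, whose second moment is the sum of those of the differences. Subtracting M_0 is necessary,
  since it need not vanish.\<close>

lemma M_maximal:
  assumes x: "0 < x"
  shows "\<P>(w in P. \<exists>k\<le>n. x \<le> \<bar>M k w - M 0 w\<bar>) \<le> n * (32 * \<Psi>\<^sup>2 * Q) / x\<^sup>2"
proof -
  have m [measurable]: "CE k W \<in> borel_measurable P" "M k \<in> borel_measurable P" for k W
    by (rule borel_measurable_cond_exp2, rule ess_bdd_measurable[OF M_P])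
  define Z where "Z w = S n w - M 0 w" for w
  have Z: "ess_bdd P P Z" unfolding Z_def by (intro ess_bdd_diff S_P M_P)
  have "AE w in P. CE k Z w = M k w - M 0 w" for k
  proof -
    have "AE w in P. CE k Z w = CE k (S n) w - CE k (M 0) w" unfolding Z_def by (intro CE_diff S_P M_P)
    moreover have "AE w in P. CE k (M 0) w = M 0 w" by (rule CE_self[OF M_F]) simp
    ultimately show ?thesis by eventually_elim (simp add: M_def)
  qed
  then have "AE w in P. \<forall>k\<in>{..n}. CE k Z w = M k w - M 0 w" by (intro AE_finite_allI) auto
  then have "AE w in P. w \<in> {w \<in> space P. \<exists>k\<le>n. x \<le> \<bar>M k w - M 0 w\<bar>} \<longrightarrow> w \<in> {w \<in> space P. \<exists>k\<le>n. x \<le> \<bar>CE k Z w\<bar>}"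
    by eventually_elim auto
  then have "\<P>(w in P. \<exists>k\<le>n. x \<le> \<bar>M k w - M 0 w\<bar>) \<le> \<P>(w in P. \<exists>k\<le>n. x \<le> \<bar>CE k Z w\<bar>)"
    by (rule finite_measure_mono_AE) measurable
  also have "\<dots> \<le> (LINT w|P. (Z w)\<^sup>2) / x\<^sup>2" by (rule kolmogorov[OF Z x])
  also have "(LINT w|P. (Z w)\<^sup>2) = (LINT w|P. 1 * (M (0 + n) w - M 0 w)\<^sup>2)"
  proof (rule integral_cong_AE)
    show "AE w in P. (Z w)\<^sup>2 = 1 * (M (0 + n) w - M 0 w)\<^sup>2"
      using M_n by eventually_elim (simp add: Z_def)
  qed (use ess_bdd_measurable[OF Z] in measurable)
  also have "\<dots> = (\<Sum>j\<in>{Suc 0..0 + n}. LINT w|P. 1 * (d j w)\<^sup>2)" by (rule M_increment_sq) auto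
  also have "\<dots> \<le> (\<Sum>j\<in>{Suc 0..0 + n}. 32 * \<Psi>\<^sup>2 * Q)" by (rule sum_mono) (use d_sq in auto)
  finally show ?thesis by (simp add: divide_right_mono)
qed

section \<open>Concentration of the predictable quadratic variation\<close>

definition D :: "nat \<Rightarrow> 'a \<Rightarrow> real" where "D k = CE (k - 1) (\<lambda>w. (d k w)\<^sup>2)"

lemma D_F: "k - 1 \<le> j \<Longrightarrow> ess_bdd P (F j) (D k)"
  unfolding D_def by (rule ess_bdd_mono[OF ess_bdd_CE]) (intro ess_bdd_power2 d_P)

lemma D_P: "ess_bdd P P (D k)" by (rule ess_bdd_F[OF D_F[OF order_refl]])

lemma D_nonneg: "AE w in P. 0 \<le> D k w" unfolding D_def by (rule CE_ge) (auto intro: d_P)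

lemma D_integral: "expectation (D k) = (LINT w|P. (d k w)\<^sup>2)"
  unfolding D_def by (rule CE_integral) (intro ess_bdd_power2 d_P)

text \<open>Summing over the whole tail before estimating is what makes mixing of order two
  sufficient: single covariances would involve products of four variables. The result has one factor
  \<open>Q\<close>, from the mean of \<open>D k\<close>, and one factor b^2, instead of b^4.\<close>

lemma D_cov:
  assumes k: "1 \<le> k" "k \<le> n"
  defines "V \<equiv> \<lambda>w. D k w - expectation (D k)"
  shows "(LINT w|P. V w * (\<Sum>j=k..n. D j w - expectation (D j))) \<le>
    32 * \<Psi>\<^sup>2 * Q * (32 * b\<^sup>2 * (\<Psi>2\<^sup>2 + \<Phi>\<^sup>2))"
proof -
  define e where "e = expectation (D k)"
  have e: "0 \<le> e" "e \<le> 32 * \<Psi>\<^sup>2 * Q"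
    unfolding e_def D_integral using d_sq[OF k] by (auto intro: integral_nonneg_AE)
  have VF: "ess_bdd P (F (k - 1)) V" unfolding V_def by (intro ess_bdd_diff D_F ess_bdd_const) simp
  have VP: "ess_bdd P P V" by (rule ess_bdd_F[OF VF])
  have V0: "expectation V = 0" unfolding V_def using ess_bdd_int[OF D_P] by (simp add: prob_space)
  \<comment> \<open>The centering passes from \<open>D k\<close> to \<open>W\<close>, which leaves a
    nonnegative weight of mean \<open>e\<close> known at time k - 1; bounds for the conditional
    expectation of the centered \<open>W\<close> then suffice.\<close>
  have VW: "(LINT w|P. V w * W w) = (LINT w|P. D k w * (W w - expectation W))" if W: "ess_bdd P P W" for W
    using ess_bdd_int[OF W] ess_bdd_int[OF D_P] ess_bdd_int[OF ess_bdd_mult[OF D_P W]]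
    by (simp add: V_def left_diff_distrib right_diff_distrib)
  \<comment> \<open>For j >= k the weight \<open>V\<close> is known at time j - 1, so the
    conditioning in \<open>D j\<close> can be undone; the constant drops out because
    \<open>V\<close> has mean 0.\<close>
  have Vj: "(LINT w|P. V w * (D j w - expectation (D j))) = (LINT w|P. V w * (d j w)\<^sup>2)" if "k \<le> j" for j
  proof -
    have "(LINT w|P. V w * (D j w - expectation (D j))) = (LINT w|P. V w * D j w) - (LINT w|P. V w * expectation (D j))"
      unfolding right_diff_distrib by (intro Bochner_Integration.integral_diff ess_bdd_int ess_bdd_mult VP D_P ess_bdd_const)
    also have "(LINT w|P. V w * expectation (D j)) = 0" using V0 by simp
    also have "(LINT w|P. V w * D j w) = (LINT w|P. V w * (d j w)\<^sup>2)"
      unfolding D_def using that by (intro CE_integral_mult ess_bdd_mono[OF VF] ess_bdd_power2 d_P) simp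
    finally show ?thesis by simp
  qed
  \<comment> \<open>\<open>A\<close> is S_n - S_{k-1} and \<open>H\<close> its conditional
    expectation at time k - 1, so A - H is the martingale increment. As V H is known at that time,
    weighting (A - H)^2 by \<open>V\<close> leaves the integral of V A^2 minus that of V
    H^2.\<close>
  define A where "A w = (\<Sum>i\<in>{k..n}. X i w)" for w
  define H where "H w = (\<Sum>i\<in>{k..n}. CE (k - 1) (X i) w)" for w
  have A: "ess_bdd P P A" unfolding A_def by (intro ess_bdd_sum X_P)
  have HF: "ess_bdd P (F (k - 1)) H" unfolding H_def by (intro ess_bdd_sum ess_bdd_CE X_P)
  have HP: "ess_bdd P P H" by (rule ess_bdd_F[OF HF])
  have CA: "AE w in P. CE (k - 1) A w = H w" unfolding A_def H_def by (rule CE_sum) (auto intro: X_P)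
  have "(\<Sum>i=1..n. X i w) = (\<Sum>i=1..k-1. X i w) + (\<Sum>i=k..n. X i w)" for w
    using sum.ub_add_nat[of 1 "k - 1" "\<lambda>i. X i w" "n - (k - 1)"] k by simp
  then have SA: "S n w = S (k - 1) w + A w" for w by (simp add: S_def A_def)
  have AH: "AE w in P. M (k - 1 + (n - (k - 1))) w - M (k - 1) w = A w - H w"
  proof -
    have k': "k - 1 \<le> n" "Suc (k - 1) = k" using k by auto
    show ?thesis using M_n M_eq[OF order_refl k'(1)] unfolding k'(2)
      by eventually_elim (use k' SA in \<open>simp add: H_def\<close>)
  qed
  have "(LINT w|P. V w * (\<Sum>j=k..n. D j w - expectation (D j))) = (\<Sum>j=k..n. LINT w|P. V w * (D j w - expectation (D j)))"
    unfolding sum_distrib_left by (intro Bochner_Integration.integral_sum ess_bdd_int ess_bdd_intros VP D_P )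
  also have "\<dots> = (\<Sum>j\<in>{Suc (k - 1)..k - 1 + (n - (k - 1))}. LINT w|P. V w * (d j w)\<^sup>2)"
    using k by (intro sum.cong Vj) auto
  also have "\<dots> = (LINT w|P. V w * (M (k - 1 + (n - (k - 1))) w - M (k - 1) w)\<^sup>2)"
    by (rule M_increment_sq[OF VF, symmetric])
  also have "\<dots> = (LINT w|P. V w * (A w)\<^sup>2 - (2 * (V w * H w * A w) - V w * (H w)\<^sup>2))"
  proof (rule integral_cong_AE)
    show "AE w in P. V w * (M (k - 1 + (n - (k - 1))) w - M (k - 1) w)\<^sup>2 =
      V w * (A w)\<^sup>2 - (2 * (V w * H w * A w) - V w * (H w)\<^sup>2)"
      using AH
    proof eventually_elim
      case (elim w)
      show ?case unfolding elim by (simp add: power2_eq_square algebra_simps)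
    qed
  qed (rule ess_bdd_measurable[of P], intro ess_bdd_intros VP M_P A HP)+
  also have "\<dots> = (LINT w|P. V w * (A w)\<^sup>2) - (LINT w|P. 2 * (V w * H w * A w) - V w * (H w)\<^sup>2)"
    by (intro Bochner_Integration.integral_diff ess_bdd_int ess_bdd_intros VP A HP)
  also have "(LINT w|P. 2 * (V w * H w * A w) - V w * (H w)\<^sup>2) = (LINT w|P. 2 * (V w * H w * A w)) - (LINT w|P. V w * (H w)\<^sup>2)"
    by (intro Bochner_Integration.integral_diff ess_bdd_int ess_bdd_intros VP A HP)
  also have "(LINT w|P. 2 * (V w * H w * A w)) = 2 * (LINT w|P. V w * (H w)\<^sup>2)"
  proof -
    have "(LINT w|P. V w * H w * A w) = (LINT w|P. V w * H w * CE (k - 1) A w)"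
      by (intro CE_integral_mult[symmetric] ess_bdd_mult VF HF A)
    also have "\<dots> = (LINT w|P. V w * (H w)\<^sup>2)"
    proof (rule integral_cong_AE)
      show "AE w in P. V w * H w * CE (k - 1) A w = V w * (H w)\<^sup>2"
        using CA by eventually_elim (simp add: power2_eq_square)
    qed (rule ess_bdd_measurable[of P], intro ess_bdd_mult ess_bdd_power2 VP A HP ess_bdd_CE')+
    finally show ?thesis by simp
  qed
  finally have main: "(LINT w|P. V w * (\<Sum>j=k..n. D j w - expectation (D j))) =
    (LINT w|P. V w * (A w)\<^sup>2) - (LINT w|P. V w * (H w)\<^sup>2)" by simp
  have 1: "\<bar>LINT w|P. V w * (A w)\<^sup>2\<bar> \<le> 2 * (16 * b\<^sup>2 * e) * \<Psi>2\<^sup>2"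
  proof -
    have "(LINT w|P. V w * (A w)\<^sup>2) = (LINT w|P. (\<Sum>i\<in>{k..n}. \<Sum>j\<in>{k..n}. V w * (X i w * X j w)))"
      by (simp only: A_def power2_eq_square sum_product) (simp only: sum_distrib_left)
    also have "\<dots> = (\<Sum>i\<in>{k..n}. LINT w|P. (\<Sum>j\<in>{k..n}. V w * (X i w * X j w)))"
      by (intro Bochner_Integration.integral_sum ess_bdd_int ess_bdd_sum ess_bdd_mult VP X_P)
    also have "\<dots> = (\<Sum>i\<in>{k..n}. \<Sum>j\<in>{k..n}. LINT w|P. V w * (X i w * X j w))"
      by (intro sum.cong refl Bochner_Integration.integral_sum ess_bdd_int ess_bdd_sum ess_bdd_mult VP X_P)
    also have "\<bar>\<dots>\<bar> \<le> 2 * (16 * b\<^sup>2 * e) * (\<Sum>k. sqrt (\<phi>2 k))\<^sup>2"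
    \<comment> \<open>The shift k - 1 is the time of conditioning, one step before the first index
      of the double sum.\<close>
    proof (rule double_sum_le[OF summable2, where l="k - 1"])
      fix i j assume ij: "k \<le> i" "i \<le> j"
      have "\<bar>LINT w|P. V w * (X i w * X j w)\<bar> = \<bar>LINT w|P. D k w * (X i w * X j w - (LINT w|P. X i w * X j w))\<bar>"
        by (subst VW) (intro ess_bdd_mult X_P, simp)
      also have "\<dots> \<le> 16 * b\<^sup>2 * (sqrt (\<phi>2 (i - (k - 1))) * sqrt (\<phi>2 (j - i))) * expectation (D k)"
        using ij by (intro integral_mult_CE_bound[of "k - 1"] CE_XX D_F D_nonneg ess_bdd_intros X_P ) auto
      finally show "\<bar>LINT w|P. V w * (X i w * X j w)\<bar> \<le> 16 * b\<^sup>2 * e * (sqrt (\<phi>2 (i - (k - 1))) * sqrt (\<phi>2 (j - i)))"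
        by (simp add: e_def mult_ac)
    qed (use e phi2_nonneg in \<open>auto simp: mult.commute\<close>)
    finally show ?thesis by (simp add: \<Psi>2_def)
  qed
  have 2: "\<bar>LINT w|P. V w * (H w)\<^sup>2\<bar> \<le> 2 * (4 * b * \<Phi>)\<^sup>2 * e"
  proof -
    have "AE w in P. \<bar>H w\<bar> \<le> 4 * b * \<Phi>" unfolding H_def by (rule sum_CE_X_abs) auto
    then have "AE w in P. \<bar>(H w)\<^sup>2\<bar> \<le> (4 * b * \<Phi>)\<^sup>2"
      by eventually_elim (metis abs_ge_zero abs_power2 power2_abs power_mono)
    moreover have "AE w in P. CE (k - 1) (\<lambda>w. (H w)\<^sup>2) w = (H w)\<^sup>2" by (intro CE_self ess_bdd_power2 HF)
    ultimately have "AE w in P. \<bar>CE (k - 1) (\<lambda>w. (H w)\<^sup>2) w\<bar> \<le> (4 * b * \<Phi>)\<^sup>2" by eventually_elim simp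
    then have "AE w in P. \<bar>CE (k - 1) (\<lambda>w. (H w)\<^sup>2 - (LINT w|P. (H w)\<^sup>2)) w\<bar> \<le> 2 * (4 * b * \<Phi>)\<^sup>2"
      by (intro CE_bound_earlier[where i="k - 1"] ess_bdd_power2 HP) auto
    then have "\<bar>LINT w|P. D k w * ((H w)\<^sup>2 - (LINT w|P. (H w)\<^sup>2))\<bar> \<le> 2 * (4 * b * \<Phi>)\<^sup>2 * expectation (D k)"
      by (intro integral_mult_CE_bound[of "k - 1"] D_F D_nonneg ess_bdd_intros HP ) auto
    then show ?thesis by (subst VW) (auto intro!: HP simp: e_def)
  qed
  have "(LINT w|P. V w * (A w)\<^sup>2) - (LINT w|P. V w * (H w)\<^sup>2) \<le> e * (32 * b\<^sup>2 * (\<Psi>2\<^sup>2 + \<Phi>\<^sup>2))"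
    using 1 2 by (simp add: power_mult_distrib algebra_simps abs_le_iff)
  also have "\<dots> \<le> 32 * \<Psi>\<^sup>2 * Q * (32 * b\<^sup>2 * (\<Psi>2\<^sup>2 + \<Phi>\<^sup>2))" by (intro mult_right_mono e) auto
  finally show ?thesis unfolding main .
qed

lemma D_variance:
  "(LINT w|P. (\<Sum>k=1..n. D k w - expectation (D k))\<^sup>2) \<le> 2 * real n * (32 * \<Psi>\<^sup>2 * Q * (32 * b\<^sup>2 * (\<Psi>2\<^sup>2 + \<Phi>\<^sup>2)))"
proof -
  define V where "V k w = D k w - expectation (D k)" for k w
  have V: "ess_bdd P P (V k)" for k unfolding V_def by (intro ess_bdd_diff D_P ess_bdd_const)
  have "(LINT w|P. (\<Sum>k=1..n. V k w)\<^sup>2) \<le> (LINT w|P. 2 * (\<Sum>k=1..n. V k w * (\<Sum>j=k..n. V j w)))"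
    by (intro integral_mono sum_square_le ess_bdd_int ess_bdd_intros V)
  also have "\<dots> = 2 * (\<Sum>k=1..n. LINT w|P. V k w * (\<Sum>j=k..n. V j w))"
    by (subst Bochner_Integration.integral_mult_right_zero, subst Bochner_Integration.integral_sum)
      (intro ess_bdd_int ess_bdd_sum ess_bdd_mult V, simp)
  also have "\<dots> \<le> 2 * (\<Sum>k=1..n. 32 * \<Psi>\<^sup>2 * Q * (32 * b\<^sup>2 * (\<Psi>2\<^sup>2 + \<Phi>\<^sup>2)))"
    unfolding V_def by (intro mult_left_mono sum_mono D_cov) auto
  finally show ?thesis by (simp add: V_def)
qed

end

text \<open>For x = -y negative, exp x <= 1/(1 + y) <= 1 - y + y^2, because (1 - y + y^2)(1 + y) = 1
  + y^3.\<close>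

lemma exp_le_quadratic:
  fixes x :: real
  assumes "\<bar>x\<bar> \<le> 1" shows "exp x \<le> 1 + x + x\<^sup>2"
proof (cases "0 \<le> x")
  case True then show ?thesis using assms by (intro exp_bound) auto
next
  case False
  define y where "y = - x"
  have y: "0 \<le> y" "y \<le> 1" using False assms by (auto simp: y_def)
  have "exp x = 1 / exp y" by (simp add: y_def exp_minus inverse_eq_divide)
  also have "\<dots> \<le> 1 / (1 + y)" using y exp_ge_add_one_self[of y] by (intro divide_left_mono) auto
  also have "\<dots> \<le> 1 - y + y\<^sup>2"
  proof -
    have "1 \<le> 1 + y ^ 3" using y by simp
    also have "\<dots> = (1 - y + y\<^sup>2) * (1 + y)" by (simp add: power2_eq_square power3_eq_cube algebra_simps)
    finally show ?thesis using y by (simp add: divide_le_eq)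
  qed
  finally show ?thesis by (simp add: y_def)
qed

section \<open>Exponential inequality for the martingale\<close>

context tame_mixing
begin

text \<open>\<open>N\<close> is the exponential supermartingale compensated by \<rho>^2 times the
  sum of the \<open>D j\<close>. As long as this sum stays below \<open>v\<close>, a passage of
  \<rho>(M_k - M_0) above \<open>y\<close> forces \<open>N\<close> above exp(y - \<rho>^2 v). Both
  signs of \<rho> are allowed in order to treat both tails.\<close>

lemma exponential_maximal:
  assumes l: "\<bar>\<rho>\<bar> * (8 * b * \<Phi>) \<le> 1"
  shows "\<P>(w in P. \<exists>k\<le>n. y \<le> \<rho> * (M k w - M 0 w)) \<le>
    \<P>(w in P. v < (\<Sum>j=1..n. D j w)) + exp (\<rho>\<^sup>2 * v - y)"
proof -
  define N where "N k w = exp (\<rho> * (M k w - M 0 w) - \<rho>\<^sup>2 * (\<Sum>j=1..k. D j w))" for k w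
  have NF: "ess_bdd P (F k) (N k)" for k unfolding N_def
    by (intro ess_bdd_intros M_F D_F) auto
  have [measurable]: "M k \<in> borel_measurable P" "D k \<in> borel_measurable P" for k
    by (rule ess_bdd_measurable[OF M_P], rule ess_bdd_measurable[OF D_P])
  have [measurable]: "N k \<in> borel_measurable P" for k unfolding N_def by measurable
  have "exp (y - \<rho>\<^sup>2 * v) * \<P>(w in P. \<exists>k\<le>n. exp (y - \<rho>\<^sup>2 * v) \<le> N k w) \<le> expectation (N 0)"
  proof (rule maximal_ineq[OF NF])
    show "AE w in P. 0 \<le> N k w" for k by (simp add: N_def)
    fix k A assume k: "k < n" and A: "A \<in> sets (F k)"
    \<comment> \<open>Everything in the next value of \<open>N\<close> that is already known at time
      \<open>k\<close>, including the compensator because \<open>D (Suc k)\<close> is predictable;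
      only the factor exp(\<rho> d) remains. Its linear term integrates to 0 and its quadratic term
      to \<open>D (Suc k)\<close>.\<close>
    define V where "V w = indicat_real A w * N k w * exp (- (\<rho>\<^sup>2 * D (Suc k) w))" for w
    let ?d = "d (Suc k)"
    have VF: "ess_bdd P (F k) V" unfolding V_def
      by (intro ess_bdd_intros A NF D_F) simp
    have VP: "ess_bdd P P V" by (rule ess_bdd_F[OF VF])
    have V0: "0 \<le> V w" for w by (simp add: V_def N_def)
    have "(LINT w|P. indicat_real A w * N (Suc k) w) = (LINT w|P. V w * exp (\<rho> * ?d w))"
      by (intro Bochner_Integration.integral_cong refl)
        (simp add: V_def N_def d_def algebra_simps flip: exp_add)
    also have "\<dots> \<le> (LINT w|P. V w + (\<rho> * (V w * ?d w) + \<rho>\<^sup>2 * (V w * (?d w)\<^sup>2)))"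
    proof (rule integral_mono_AE)
      have "AE w in P. \<bar>?d w\<bar> \<le> 8 * b * \<Phi>" by (rule d_abs) (use k in auto)
      then show "AE w in P. V w * exp (\<rho> * ?d w) \<le> V w + (\<rho> * (V w * ?d w) + \<rho>\<^sup>2 * (V w * (?d w)\<^sup>2))"
      proof eventually_elim
        case (elim w)
        have "\<bar>\<rho> * ?d w\<bar> \<le> \<bar>\<rho>\<bar> * (8 * b * \<Phi>)" unfolding abs_mult by (intro mult_left_mono elim) simp
        then have "exp (\<rho> * ?d w) \<le> 1 + \<rho> * ?d w + (\<rho> * ?d w)\<^sup>2" using l by (intro exp_le_quadratic) simp
        then have "V w * exp (\<rho> * ?d w) \<le> V w * (1 + \<rho> * ?d w + (\<rho> * ?d w)\<^sup>2)" by (rule mult_left_mono[OF _ V0])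
        also have "\<dots> = V w + (\<rho> * (V w * ?d w) + \<rho>\<^sup>2 * (V w * (?d w)\<^sup>2))" by (simp add: power2_eq_square algebra_simps)
        finally show ?case .
      qed
    qed (intro ess_bdd_int ess_bdd_intros VP d_P)+
    also have "\<dots> = expectation V + (\<rho> * (LINT w|P. V w * ?d w) + \<rho>\<^sup>2 * (LINT w|P. V w * (?d w)\<^sup>2))"
      using ess_bdd_int[OF VP] ess_bdd_int[OF ess_bdd_mult[OF VP d_P]]
        ess_bdd_int[OF ess_bdd_mult[OF VP ess_bdd_power2[OF d_P]]] by simp
    also have "(LINT w|P. V w * ?d w) = 0" by (rule d_orth[OF VF])
    also have "(LINT w|P. V w * (?d w)\<^sup>2) = (LINT w|P. V w * D (Suc k) w)"
      unfolding D_def diff_Suc_1 by (intro CE_integral_mult[symmetric] VF ess_bdd_power2 d_P)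
    also have "expectation V + (\<rho> * 0 + \<rho>\<^sup>2 * (LINT w|P. V w * D (Suc k) w)) =
      (LINT w|P. V w + \<rho>\<^sup>2 * (V w * D (Suc k) w))"
      using ess_bdd_int[OF VP] ess_bdd_int[OF ess_bdd_mult[OF VP D_P]] by simp
    also have "\<dots> \<le> (LINT w|P. V w * exp (\<rho>\<^sup>2 * D (Suc k) w))"
    proof (rule integral_mono)
      fix w
      have "V w * (1 + \<rho>\<^sup>2 * D (Suc k) w) \<le> V w * exp (\<rho>\<^sup>2 * D (Suc k) w)"
        by (intro mult_left_mono exp_ge_add_one_self V0)
      then show "V w + \<rho>\<^sup>2 * (V w * D (Suc k) w) \<le> V w * exp (\<rho>\<^sup>2 * D (Suc k) w)" by (simp add: algebra_simps)
    qed (intro ess_bdd_int ess_bdd_intros VP D_P)+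
    also have "\<dots> = (LINT w|P. indicat_real A w * N k w)"
      by (intro Bochner_Integration.integral_cong refl) (simp add: V_def mult.assoc flip: exp_add)
    finally show "(LINT w|P. indicat_real A w * N (Suc k) w) \<le> (LINT w|P. indicat_real A w * N k w)" .
  qed auto
  also have "expectation (N 0) = 1" by (simp add: N_def[abs_def] prob_space)
  finally have "\<P>(w in P. \<exists>k\<le>n. exp (y - \<rho>\<^sup>2 * v) \<le> N k w) \<le> 1 / exp (y - \<rho>\<^sup>2 * v)"
    by (simp add: field_simps)
  also have "\<dots> = exp (\<rho>\<^sup>2 * v - y)" using exp_minus[of "y - \<rho>\<^sup>2 * v"] by (simp add: inverse_eq_divide)
  finally have 1: "\<P>(w in P. \<exists>k\<le>n. exp (y - \<rho>\<^sup>2 * v) \<le> N k w) \<le> exp (\<rho>\<^sup>2 * v - y)" .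
  have "AE w in P. \<forall>j\<in>{1..n}. 0 \<le> D j w" by (rule AE_finite_allI) (auto intro: D_nonneg)
  then have "AE w in P. w \<in> {w \<in> space P. \<exists>k\<le>n. y \<le> \<rho> * (M k w - M 0 w)} \<longrightarrow>
     w \<in> {w \<in> space P. v < (\<Sum>j=1..n. D j w)} \<union> {w \<in> space P. \<exists>k\<le>n. exp (y - \<rho>\<^sup>2 * v) \<le> N k w}"
  proof eventually_elim
    case (elim w)
    have "exp (y - \<rho>\<^sup>2 * v) \<le> N k w" if k: "k \<le> n" "y \<le> \<rho> * (M k w - M 0 w)" and v: "(\<Sum>j=1..n. D j w) \<le> v" for k
    proof -
      have "(\<Sum>j=1..k. D j w) \<le> (\<Sum>j=1..n. D j w)" by (rule sum_mono2) (use k elim in auto)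
      then have "\<rho>\<^sup>2 * (\<Sum>j=1..k. D j w) \<le> \<rho>\<^sup>2 * v" using v by (intro mult_left_mono) auto
      then show ?thesis unfolding N_def using k by simp
    qed
    then show ?case by (auto simp: not_less)
  qed
  then have "\<P>(w in P. \<exists>k\<le>n. y \<le> \<rho> * (M k w - M 0 w)) \<le>
     prob ({w \<in> space P. v < (\<Sum>j=1..n. D j w)} \<union> {w \<in> space P. \<exists>k\<le>n. exp (y - \<rho>\<^sup>2 * v) \<le> N k w})"
    by (rule finite_measure_mono_AE) measurable
  also have "\<dots> \<le> \<P>(w in P. v < (\<Sum>j=1..n. D j w)) + \<P>(w in P. \<exists>k\<le>n. exp (y - \<rho>\<^sup>2 * v) \<le> N k w)"
    by (rule measure_Un_le) measurable
  finally show ?thesis using 1 by linarith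
qed

text \<open>\<open>v\<close> is at least twice the bound on the mean, so exceeding it means a
  deviation of at least v/2 and Chebyshev's inequality applies; 8 is 2 from
  \<open>D_variance\<close> times 4 from (v/2)^2.\<close>

lemma D_deviation:
  assumes v: "0 < v" "2 * real n * (32 * \<Psi>\<^sup>2 * Q) \<le> v"
  shows "\<P>(w in P. v < (\<Sum>j=1..n. D j w)) \<le>
    8 * real n * (32 * \<Psi>\<^sup>2 * Q * (32 * b\<^sup>2 * (\<Psi>2\<^sup>2 + \<Phi>\<^sup>2))) / v\<^sup>2"
proof -
  define W where "W w = (\<Sum>k=1..n. D k w - expectation (D k))" for w
  have [measurable]: "D k \<in> borel_measurable P" for k by (rule ess_bdd_measurable[OF D_P])
  have W: "ess_bdd P P W" unfolding W_def by (intro ess_bdd_intros D_P )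
  have [measurable]: "W \<in> borel_measurable P" by (rule ess_bdd_measurable[OF W])
  have "(\<Sum>k=1..n. (expectation (D k))) \<le> (\<Sum>k=1..n. 32 * \<Psi>\<^sup>2 * Q)"
    unfolding D_integral by (rule sum_mono) (use d_sq in auto)
  then have e: "(\<Sum>k=1..n. (expectation (D k))) \<le> v / 2" using v by simp
  have "\<P>(w in P. v < (\<Sum>j=1..n. D j w)) \<le> \<P>(w in P. (v / 2)\<^sup>2 \<le> (W w)\<^sup>2)"
  proof (rule finite_measure_mono)
    show "{w \<in> space P. v < (\<Sum>j=1..n. D j w)} \<subseteq> {w \<in> space P. (v / 2)\<^sup>2 \<le> (W w)\<^sup>2}"
    proof safe
      fix w assume "v < (\<Sum>j=1..n. D j w)"
      then have "v / 2 \<le> W w" using e by (simp add: W_def sum_subtractf)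
      then show "(v / 2)\<^sup>2 \<le> (W w)\<^sup>2" using v by (intro power_mono) auto
    qed
  qed measurable
  also have "\<dots> \<le> (LINT w|P. (W w)\<^sup>2) / (v / 2)\<^sup>2"
    by (rule integral_Markov_inequality_measure[where A="{}"])
      (use v in \<open>auto intro!: ess_bdd_int W\<close>)
  also have "\<dots> \<le> 2 * real n * (32 * \<Psi>\<^sup>2 * Q * (32 * b\<^sup>2 * (\<Psi>2\<^sup>2 + \<Phi>\<^sup>2))) / (v / 2)\<^sup>2"
    unfolding W_def by (intro divide_right_mono D_variance) simp
  also have "\<dots> = 8 * real n * (32 * \<Psi>\<^sup>2 * Q * (32 * b\<^sup>2 * (\<Psi>2\<^sup>2 + \<Phi>\<^sup>2))) / v\<^sup>2" by (simp add: power_divide)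
  finally show ?thesis .
qed

text \<open>Applied with \<rho> and -\<rho>, one sign for each tail. The probability of a large
  quadratic variation, which Freedman's inequality keeps as an event, is estimated by its
  variance.\<close>

lemma freedman:
  assumes v: "0 < v" "2 * real n * (32 * \<Psi>\<^sup>2 * Q) \<le> v" and l: "0 < \<rho>" "\<rho> * (8 * b * \<Phi>) \<le> 1"
  shows "\<P>(w in P. \<exists>k\<le>n. x \<le> \<bar>M k w - M 0 w\<bar>) \<le>
    2 * (8 * real n * (32 * \<Psi>\<^sup>2 * Q * (32 * b\<^sup>2 * (\<Psi>2\<^sup>2 + \<Phi>\<^sup>2))) / v\<^sup>2 + exp (\<rho>\<^sup>2 * v - \<rho> * x))"
proof -
  have [measurable]: "M k \<in> borel_measurable P" for k by (rule ess_bdd_measurable[OF M_P])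
  have "\<P>(w in P. \<exists>k\<le>n. x \<le> \<bar>M k w - M 0 w\<bar>) \<le>
    prob ({w \<in> space P. \<exists>k\<le>n. \<rho> * x \<le> \<rho> * (M k w - M 0 w)} \<union> {w \<in> space P. \<exists>k\<le>n. \<rho> * x \<le> (- \<rho>) * (M k w - M 0 w)})"
  proof (rule finite_measure_mono)
    have "\<rho> * x \<le> \<rho> * z \<or> \<rho> * x \<le> (- \<rho>) * z" if "x \<le> \<bar>z\<bar>" for z
    proof (cases "0 \<le> z")
      case True then show ?thesis using that l by (simp add: mult_left_mono)
    next
      case False
      then have "\<rho> * x \<le> \<rho> * (- z)" using that l by (intro mult_left_mono) auto
      then show ?thesis by simp
    qed
    then show "{w \<in> space P. \<exists>k\<le>n. x \<le> \<bar>M k w - M 0 w\<bar>} \<subseteq>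
      {w \<in> space P. \<exists>k\<le>n. \<rho> * x \<le> \<rho> * (M k w - M 0 w)} \<union> {w \<in> space P. \<exists>k\<le>n. \<rho> * x \<le> (- \<rho>) * (M k w - M 0 w)}"
      by fast
  qed measurable
  also have "\<dots> \<le> \<P>(w in P. \<exists>k\<le>n. \<rho> * x \<le> \<rho> * (M k w - M 0 w)) + \<P>(w in P. \<exists>k\<le>n. \<rho> * x \<le> (- \<rho>) * (M k w - M 0 w))"
    by (rule measure_Un_le) measurable
  also have "\<dots> \<le> (\<P>(w in P. v < (\<Sum>j=1..n. D j w)) + exp (\<rho>\<^sup>2 * v - \<rho> * x)) +
     (\<P>(w in P. v < (\<Sum>j=1..n. D j w)) + exp ((- \<rho>)\<^sup>2 * v - \<rho> * x))"
    using l by (intro add_mono exponential_maximal) auto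
  finally show ?thesis using D_deviation[OF v] by simp
qed

end

subsection \<open>Combinations of monotonic functions\<close>

text \<open>The bands are open below and closed above, so adjacent ones add up without overlap;
  excluding the value 0 when s = 0 changes nothing.\<close>

definition trunc :: "real \<Rightarrow> real \<Rightarrow> real \<Rightarrow> real" where
  "trunc s t x = (if s < \<bar>x\<bar> \<and> \<bar>x\<bar> \<le> t then x else 0)"

lemma trunc_borel [measurable]: "trunc s t \<in> borel_measurable borel"
  unfolding trunc_def by measurable

lemma imono_trunc_comp: "0 \<le> s \<Longrightarrow> imono g \<Longrightarrow> imono (\<lambda>x. trunc s t (g x))"
  unfolding trunc_def by (rule imono_comp[OF imono_trunc]) auto

lemma trunc_abs_le: "0 \<le> t \<Longrightarrow> \<bar>trunc s t x\<bar> \<le> t" by (simp add: trunc_def)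

lemma trunc_sq_le: "(trunc s t x)\<^sup>2 \<le> x\<^sup>2" by (simp add: trunc_def)

lemma weighted_sum_le:
  fixes a z :: "'b \<Rightarrow> real"
  assumes "(\<Sum>l\<in>L. \<bar>a l\<bar>) \<le> 1" "\<And>l. l \<in> L \<Longrightarrow> z l \<le> D" "0 \<le> D"
  shows "(\<Sum>l\<in>L. \<bar>a l\<bar> * z l) \<le> D"
proof -
  have "(\<Sum>l\<in>L. \<bar>a l\<bar> * z l) \<le> (\<Sum>l\<in>L. \<bar>a l\<bar>) * D"
    unfolding sum_distrib_right by (intro sum_mono mult_left_mono assms) auto
  also have "\<dots> \<le> 1 * D" by (intro mult_right_mono assms)
  finally show ?thesis by simp
qed

lemma tame_comb:
  fixes a :: "nat \<Rightarrow> real"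
  assumes L: "finite L" "(\<Sum>l\<in>L. \<bar>a l\<bar>) \<le> 1" "\<And>l. l \<in> L \<Longrightarrow> imono (g l)" and s: "0 \<le> s" "0 \<le> t"
  shows "tame P t (\<lambda>x. \<Sum>l\<in>L. \<bar>a l\<bar> * (trunc s t (g l x))\<^sup>2) (\<lambda>x. \<Sum>l\<in>L. a l * trunc s t (g l x))"
proof -
  have [measurable]: "g l \<in> borel_measurable borel" if "l \<in> L" for l by (rule imono_borel[OF L(3)[OF that]])
  note comb = weighted_sum_le[OF L(2)]
  have le: "\<bar>\<Sum>l\<in>L. a l * z l\<bar> \<le> (\<Sum>l\<in>L. \<bar>a l\<bar> * \<bar>z l\<bar>)" for z :: "nat \<Rightarrow> real"
    by (rule order_trans[OF sum_abs]) (simp add: abs_mult)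
  show ?thesis unfolding tame_def
  proof (intro conjI allI impI)
    show "\<bar>\<Sum>l\<in>L. a l * trunc s t (g l x)\<bar> \<le> t" for x
      using le[of "\<lambda>l. trunc s t (g l x)"] comb[of "\<lambda>l. \<bar>trunc s t (g l x)\<bar>" t] trunc_abs_le s by force
    show "bv P (4 * t) (\<lambda>x. \<Sum>l\<in>L. a l * trunc s t (g l x))"
      by (intro bv_sum bv_imono imono_trunc_comp trunc_abs_le L) (use s in auto)
    show "(\<lambda>x. \<Sum>l\<in>L. \<bar>a l\<bar> * (trunc s t (g l x))\<^sup>2) \<in> borel_measurable borel" by measurable
    have "(trunc s t y)\<^sup>2 \<le> t\<^sup>2" for y using trunc_abs_le[OF s(2), of s y] s by (simp add: abs_le_square_iff[symmetric])
    then show "\<exists>B. \<forall>x. 0 \<le> (\<Sum>l\<in>L. \<bar>a l\<bar> * (trunc s t (g l x))\<^sup>2) \<and> (\<Sum>l\<in>L. \<bar>a l\<bar> * (trunc s t (g l x))\<^sup>2) \<le> B"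
      by (intro exI[of _ "t\<^sup>2"] allI conjI sum_nonneg comb) auto
    fix \<alpha> :: real assume \<alpha>: "0 < \<alpha>"
    define cl where "cl z = max (- \<alpha>) (min \<alpha> z)" for z :: real
    have cl: "\<bar>z - cl z\<bar> \<le> z\<^sup>2 / (4 * \<alpha>)" for z
    proof -
      \<comment> \<open>The left side is the amount removed by clamping when |z| > \<alpha>. The
        inequality is (|z| - 2 \<alpha>)^2 >= 0 divided by 4 \<alpha>, which explains the
        denominator in \<open>tame\<close>.\<close>
      have "\<bar>z\<bar> - \<alpha> \<le> z\<^sup>2 / (4 * \<alpha>)"
        using zero_le_power2[of "\<bar>z\<bar> - 2 * \<alpha>"] \<alpha> by (simp add: le_divide_eq power2_eq_square algebra_simps)
      moreover have "0 \<le> z\<^sup>2 / (4 * \<alpha>)" using \<alpha> by simp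
      ultimately show ?thesis using \<alpha> unfolding cl_def by (auto simp: max_def min_def abs_if split: if_splits)
    qed
    have "imono cl" by (rule imono_mono) (auto simp: cl_def mono_def max_def min_def)
    then have "imono (\<lambda>x. cl (trunc s t (g l x)))" if "l \<in> L" for l
      using imono_comp[of cl, OF _ _ imono_trunc_comp[OF s(1) L(3)[OF that]]] \<alpha> by (simp add: cl_def)
    then have "bv P (4 * \<alpha>) (\<lambda>x. \<Sum>l\<in>L. a l * cl (trunc s t (g l x)))"
      by (intro bv_sum bv_imono L) (use \<alpha> in \<open>auto simp: cl_def\<close>)
    moreover have "\<bar>(\<Sum>l\<in>L. a l * trunc s t (g l x)) - (\<Sum>l\<in>L. a l * cl (trunc s t (g l x)))\<bar>
      \<le> (\<Sum>l\<in>L. \<bar>a l\<bar> * (trunc s t (g l x))\<^sup>2) / (4 * \<alpha>)" for x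
    proof -
      have "\<bar>(\<Sum>l\<in>L. a l * trunc s t (g l x)) - (\<Sum>l\<in>L. a l * cl (trunc s t (g l x)))\<bar> =
        \<bar>\<Sum>l\<in>L. a l * (trunc s t (g l x) - cl (trunc s t (g l x)))\<bar>"
        by (simp add: right_diff_distrib sum_subtractf)
      also have "\<dots> \<le> (\<Sum>l\<in>L. \<bar>a l\<bar> * \<bar>trunc s t (g l x) - cl (trunc s t (g l x))\<bar>)" by (rule le)
      also have "\<dots> \<le> (\<Sum>l\<in>L. \<bar>a l\<bar> * ((trunc s t (g l x))\<^sup>2 / (4 * \<alpha>)))"
        by (intro sum_mono mult_left_mono cl) auto
      finally show ?thesis by (simp add: sum_divide_distrib)
    qed
    ultimately show "\<exists>c. bv P (4 * \<alpha>) c \<and> (\<forall>x. \<bar>(\<Sum>l\<in>L. a l * trunc s t (g l x)) - c x\<bar>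
      \<le> (\<Sum>l\<in>L. \<bar>a l\<bar> * (trunc s t (g l x))\<^sup>2) / (4 * \<alpha>))" by blast
  qed (rule s)
qed

abbreviation (in mixing) deviates :: "(real \<Rightarrow> real) \<Rightarrow> nat \<Rightarrow> real \<Rightarrow> 'a set" where
  "deviates f n x \<equiv> {w \<in> space P. \<exists>k\<in>{1..n}. x < \<bar>\<Sum>i=1..k. f (Y i w) - (LINT w|P. f (Y 0 w))\<bar>}"

text \<open>The three terms of the bound belong to the lower, middle and upper part. The last two
  are linear in the weights, so that they can later be summed over \<open>n\<close> for one
  monotonic function at a time.\<close>

lemma (in mixing) comb_deviation:
  fixes a :: "nat \<Rightarrow> real" and g :: "nat \<Rightarrow> real \<Rightarrow> real" and n :: nat and B c T b r :: real
  assumes L: "finite L" "(\<Sum>l\<in>L. \<bar>a l\<bar>) \<le> 1" "\<And>l. l \<in> L \<Longrightarrow> imono (g l)"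
    and g2: "\<And>l. l \<in> L \<Longrightarrow> integrable P (\<lambda>w. (g l (Y 0 w))\<^sup>2)" "\<And>l. l \<in> L \<Longrightarrow> (LINT w|P. (g l (Y 0 w))\<^sup>2) \<le> B\<^sup>2"
    and B: "0 < B" "0 < \<Psi>" and c: "c = 16 * \<Psi> * B"
    and n: "3 \<le> n" and T: "T = sqrt (real n) / ln (real n)" and r: "r = sqrt (real n * LL n)"
    and Tb: "T \<le> b" "64 * b * \<Phi> \<le> c * r" "16 * \<Phi> * sqrt (LL n) \<le> c * ln (real n)"
  defines "h \<equiv> \<lambda>x. \<Sum>l\<in>L. a l * g l x"
  shows "prob (deviates h n (11/4 * c * r)) \<le>
    (256 * (\<Psi>2\<^sup>2 + \<Phi>\<^sup>2) / c\<^sup>2 + 2) / (ln (real n))\<^sup>2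
    + (\<Sum>l\<in>L. \<bar>a l\<bar> * (LINT w|P. (trunc T b (g l (Y 0 w)))\<^sup>2)) * 2 / (B\<^sup>2 * LL n)
    + (\<Sum>l\<in>L. \<bar>a l\<bar> * (LINT w|P. (if b < \<bar>g l (Y 0 w)\<bar> then \<bar>g l (Y 0 w)\<bar> else 0))) * (8 * real n) / (c * r)"
proof -
  have gm [measurable]: "g l \<in> borel_measurable borel" if "l \<in> L" for l by (rule imono_borel[OF L(3)[OF that]])
  have ln1: "1 < ln (real n)" by (rule ln_gt_1[OF n])
  have LLn: "0 < LL n" by (rule LL_pos[OF n])
  have n0: "0 < real n" using n by simp
  have T0: "0 \<le> T" using ln1 unfolding T by simp
  have b0: "0 \<le> b" using T0 Tb by simp
  have r0: "0 < r" unfolding r using n0 LLn by (intro real_sqrt_gt_zero mult_pos_pos)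
  have rsq: "r\<^sup>2 = real n * LL n" unfolding r using n0 LLn by (intro real_sqrt_pow2 mult_nonneg_nonneg less_imp_le)
  have c0: "0 < c" unfolding c using B by simp
  define h1 h2 where "h1 = (\<lambda>x. \<Sum>l\<in>L. a l * trunc 0 T (g l x))" and "h2 = (\<lambda>x. \<Sum>l\<in>L. a l * trunc T b (g l x))"
  define q1 q2 where "q1 = (\<lambda>x. \<Sum>l\<in>L. \<bar>a l\<bar> * (trunc 0 T (g l x))\<^sup>2)" and "q2 = (\<lambda>x. \<Sum>l\<in>L. \<bar>a l\<bar> * (trunc T b (g l x))\<^sup>2)"
  define tl where "tl z = (if b < \<bar>z\<bar> then z else 0)" for z :: real
  have tlm [measurable]: "tl \<in> borel_measurable borel" unfolding tl_def by measurable
  define h3 where "h3 = (\<lambda>x. \<Sum>l\<in>L. a l * tl (g l x))"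
  have t1: "tame P T q1 h1" unfolding q1_def h1_def by (rule tame_comb[OF L order_refl T0])
  have t2: "tame P b q2 h2" unfolding q2_def h2_def by (rule tame_comb[OF L T0 b0])
  interpret T1: tame_mixing P F Y \<phi>1 \<phi>2 h1 q1 T n by unfold_locales (rule t1)
  interpret T2: tame_mixing P F Y \<phi>1 \<phi>2 h2 q2 b n by unfold_locales (rule t2)
  have dec: "z = trunc 0 T z + trunc T b z + tl z" for z
    using T0 Tb by (auto simp: trunc_def tl_def)
  have hdec: "h x = h1 x + h2 x + h3 x" for x
  proof -
    have "a l * g l x = a l * trunc 0 T (g l x) + a l * trunc T b (g l x) + a l * tl (g l x)" for l
      unfolding distrib_left[symmetric] by (rule arg_cong[OF dec])
    then show ?thesis unfolding h_def h1_def h2_def h3_def sum.distrib[symmetric] by (intro sum.cong refl)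
  qed
  have gI: "integrable P (\<lambda>w. g l (Y i w))" if l: "l \<in> L" for l i
  proof -
    have "integrable P (\<lambda>w. g l (Y 0 w))"
      by (rule square_integrable_imp_integrable) (use g2(1)[OF l] gm[OF l] in auto)
    then show ?thesis by (rule integrable_Y[OF gm[OF l]])
  qed
  have tlI: "integrable P (\<lambda>w. tl (g l (Y i w)))" if l: "l \<in> L" for l i
    by (rule Bochner_Integration.integrable_bound[OF gI[OF l, of i]])
      (use gm[OF l] in \<open>auto simp: tl_def\<close>)
  have h3m [measurable]: "h3 \<in> borel_measurable borel" unfolding h3_def by measurable
  have h3I: "integrable P (\<lambda>w. h3 (Y i w))" for i unfolding h3_def using tlI by auto
  define e3 where "e3 = (LINT w|P. \<bar>h3 (Y 0 w)\<bar>)"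
  have e3: "e3 \<le> (\<Sum>l\<in>L. \<bar>a l\<bar> * (LINT w|P. (if b < \<bar>g l (Y 0 w)\<bar> then \<bar>g l (Y 0 w)\<bar> else 0)))"
  proof -
    have "e3 \<le> (LINT w|P. (\<Sum>l\<in>L. \<bar>a l\<bar> * \<bar>tl (g l (Y 0 w))\<bar>))"
      unfolding e3_def
    proof (rule integral_mono)
      show "\<bar>h3 (Y 0 w)\<bar> \<le> (\<Sum>l\<in>L. \<bar>a l\<bar> * \<bar>tl (g l (Y 0 w))\<bar>)" for w
        unfolding h3_def by (rule order_trans[OF sum_abs]) (simp add: abs_mult)
    qed (use h3I tlI in auto)
    also have "\<dots> = (\<Sum>l\<in>L. \<bar>a l\<bar> * (LINT w|P. \<bar>tl (g l (Y 0 w))\<bar>))"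
      using tlI by simp
    also have "\<dots> = (\<Sum>l\<in>L. \<bar>a l\<bar> * (LINT w|P. (if b < \<bar>g l (Y 0 w)\<bar> then \<bar>g l (Y 0 w)\<bar> else 0)))"
      unfolding tl_def by (intro sum.cong refl arg_cong2[where f="(*)"] Bochner_Integration.integral_cong) auto
    finally show ?thesis .
  qed
  \<comment> \<open>\<open>W\<close> dominates all centered partial sums of the upper part at once,
    so Markov's inequality for \<open>W\<close> replaces a maximal inequality.\<close>
  define W where "W w = (\<Sum>i=1..n. \<bar>h3 (Y i w)\<bar> + e3)" for w
  have WI: "integrable P W" unfolding W_def using h3I by auto
  have W0: "0 \<le> W w" for w unfolding W_def e3_def by (intro sum_nonneg add_nonneg_nonneg integral_nonneg_AE) auto
  have EW: "expectation W = 2 * real n * e3"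
  proof -
    have "(LINT w|P. \<bar>h3 (Y i w)\<bar>) = e3" for i unfolding e3_def by (rule expect_Y) measurable
    then show ?thesis unfolding W_def using h3I by (simp add: prob_space)
  qed
  have [measurable]: "T1.M k \<in> borel_measurable P" "T2.M k \<in> borel_measurable P" for k
    by (rule ess_bdd_measurable[OF T1.M_P], rule ess_bdd_measurable[OF T2.M_P])
  have [measurable]: "W \<in> borel_measurable P" using WI by auto
  \<comment> \<open>The shares 2, 1/4 and 1/4 of c r. The gaps between sums and martingales, counted
    at times k and 0, add 8 T \<Phi> + 8 b \<Phi> <= 16 b \<Phi>, at most c r/4 by
    \<open>Tb\<close>; the total is 11/4.\<close>
  define A1 A2 A3 where "A1 = {w \<in> space P. \<exists>k\<le>n. 2 * c * r \<le> \<bar>T1.M k w - T1.M 0 w\<bar>}"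
    and "A2 = {w \<in> space P. \<exists>k\<le>n. c * r / 4 \<le> \<bar>T2.M k w - T2.M 0 w\<bar>}"
    and "A3 = {w \<in> space P. c * r / 4 \<le> W w}"
  have [measurable]: "A1 \<in> sets P" "A2 \<in> sets P" "A3 \<in> sets P" unfolding A1_def A2_def A3_def by measurable
  have "AE w in P. \<forall>k\<in>{..n}. \<bar>T1.S k w - T1.M k w\<bar> \<le> 4 * T * \<Phi>" by (rule AE_finite_allI) (auto intro: T1.S_minus_M)
  moreover have "AE w in P. \<forall>k\<in>{..n}. \<bar>T2.S k w - T2.M k w\<bar> \<le> 4 * b * \<Phi>" by (rule AE_finite_allI) (auto intro: T2.S_minus_M)
  ultimately have "AE w in P. w \<in> deviates h n (11/4 * c * r) \<longrightarrow> w \<in> (A1 \<union> A2) \<union> A3"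
  proof eventually_elim
    case (elim w)
    have bound: "\<bar>\<Sum>i=1..k. h (Y i w) - (LINT w|P. h (Y 0 w))\<bar> \<le> 11/4 * c * r"
      if k: "k \<in> {1..n}" and nA: "w \<in> space P" "w \<notin> A1" "w \<notin> A2" "w \<notin> A3" for k
    proof -
      have Eh: "(LINT w|P. h (Y 0 w)) = (LINT w|P. h1 (Y 0 w)) + (LINT w|P. h2 (Y 0 w)) + (LINT w|P. h3 (Y 0 w))"
        unfolding hdec using h3I ess_bdd_int[OF bv_ess_bdd[OF T1.bv_h Y_P]] ess_bdd_int[OF bv_ess_bdd[OF T2.bv_h Y_P]]
        by simp
      have "(\<Sum>i=1..k. h (Y i w) - (LINT w|P. h (Y 0 w))) =
        T1.S k w + T2.S k w + (\<Sum>i=1..k. h3 (Y i w) - (LINT w|P. h3 (Y 0 w)))"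
        unfolding T1.S_def T2.S_def T1.X_def T2.X_def Eh unfolding hdec sum.distrib[symmetric]
        by (intro sum.cong refl) simp
      moreover have "\<bar>T1.S k w\<bar> \<le> 2 * c * r + 8 * T * \<Phi>"
      proof -
        have "\<bar>T1.S k w - T1.M k w\<bar> \<le> 4 * T * \<Phi>" "\<bar>T1.S 0 w - T1.M 0 w\<bar> \<le> 4 * T * \<Phi>" using elim k by auto
        moreover have "\<bar>T1.M k w - T1.M 0 w\<bar> < 2 * c * r" using nA k by (force simp: A1_def)
        moreover have "T1.S 0 w = 0" by (simp add: T1.S_def)
        ultimately show ?thesis by linarith
      qed
      moreover have "\<bar>T2.S k w\<bar> \<le> c * r / 4 + 8 * b * \<Phi>"
      proof -
        have "\<bar>T2.S k w - T2.M k w\<bar> \<le> 4 * b * \<Phi>" "\<bar>T2.S 0 w - T2.M 0 w\<bar> \<le> 4 * b * \<Phi>" using elim k by auto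
        moreover have "\<bar>T2.M k w - T2.M 0 w\<bar> < c * r / 4" using nA k by (force simp: A2_def)
        moreover have "T2.S 0 w = 0" by (simp add: T2.S_def)
        ultimately show ?thesis by linarith
      qed
      moreover have "\<bar>\<Sum>i=1..k. h3 (Y i w) - (LINT w|P. h3 (Y 0 w))\<bar> \<le> c * r / 4"
      proof -
        have m: "\<bar>LINT w|P. h3 (Y 0 w)\<bar> \<le> e3" unfolding e3_def by (rule integral_abs_bound)
        have "\<bar>\<Sum>i=1..k. h3 (Y i w) - (LINT w|P. h3 (Y 0 w))\<bar> \<le> (\<Sum>i=1..k. \<bar>h3 (Y i w) - (LINT w|P. h3 (Y 0 w))\<bar>)" by (rule sum_abs)
        also have "\<dots> \<le> (\<Sum>i=1..k. \<bar>h3 (Y i w)\<bar> + e3)" by (rule sum_mono) (use m in linarith)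
        also have "\<dots> \<le> W w" unfolding W_def
          by (rule sum_mono2) (use k in \<open>auto simp: e3_def intro!: add_nonneg_nonneg integral_nonneg_AE\<close>)
        also have "\<dots> \<le> c * r / 4" using nA by (simp add: A3_def)
        finally show ?thesis .
      qed
      moreover have "8 * T * \<Phi> \<le> 8 * b * \<Phi>" using Tb Phi_nonneg by (intro mult_right_mono) auto
      ultimately show ?thesis using Tb(2) by linarith
    qed
    show ?case
    proof (rule impI, rule ccontr)
      assume "w \<in> deviates h n (11/4 * c * r)"
      then obtain k where k: "k \<in> {1..n}" "w \<in> space P"
        "11/4 * c * r < \<bar>\<Sum>i=1..k. h (Y i w) - (LINT w|P. h (Y 0 w))\<bar>" by blast
      assume "w \<notin> (A1 \<union> A2) \<union> A3"
      then show False using bound[OF k(1,2)] k(3) by simp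
    qed
  qed
  then have "prob (deviates h n (11/4 * c * r)) \<le> prob ((A1 \<union> A2) \<union> A3)"
    by (rule finite_measure_mono_AE) measurable
  also have "\<dots> \<le> prob (A1 \<union> A2) + prob A3" by (rule measure_Un_le) measurable
  also have "prob (A1 \<union> A2) \<le> prob A1 + prob A2" by (rule measure_Un_le) measurable
  finally have main: "prob (deviates h n (11/4 * c * r)) \<le> prob A1 + prob A2 + prob A3"
    by simp
  have cB: "32 * \<Psi>\<^sup>2 * B\<^sup>2 = c\<^sup>2 / 8" by (simp add: c power_mult_distrib)
  have Q1: "T1.Q \<le> B\<^sup>2"
  proof -
    have I: "integrable P (\<lambda>w. (trunc 0 T (g l (Y 0 w)))\<^sup>2)" if "l \<in> L" for l
      by (rule Bochner_Integration.integrable_bound[OF g2(1)[OF that]]) (use gm[OF that] trunc_sq_le in auto)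
    have "T1.Q = (\<Sum>l\<in>L. \<bar>a l\<bar> * (LINT w|P. (trunc 0 T (g l (Y 0 w)))\<^sup>2))"
      unfolding T1.Q_def unfolding q1_def using I by simp
    also have "\<dots> \<le> B\<^sup>2"
    proof (rule weighted_sum_le[OF L(2)])
      fix l assume l: "l \<in> L"
      have "(LINT w|P. (trunc 0 T (g l (Y 0 w)))\<^sup>2) \<le> (LINT w|P. (g l (Y 0 w))\<^sup>2)"
        by (intro integral_mono I g2 l trunc_sq_le)
      then show "(LINT w|P. (trunc 0 T (g l (Y 0 w)))\<^sup>2) \<le> B\<^sup>2" using g2(2)[OF l] by simp
    qed simp
    finally show ?thesis .
  qed
  have Q2: "T2.Q = (\<Sum>l\<in>L. \<bar>a l\<bar> * (LINT w|P. (trunc T b (g l (Y 0 w)))\<^sup>2))"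
  proof -
    have I: "integrable P (\<lambda>w. (trunc T b (g l (Y 0 w)))\<^sup>2)" if "l \<in> L" for l
      by (rule Bochner_Integration.integrable_bound[OF g2(1)[OF that]]) (use gm[OF that] trunc_sq_le in auto)
    then show ?thesis unfolding T2.Q_def unfolding q2_def by simp
  qed
  have cQ: "32 * \<Psi>\<^sup>2 * T1.Q \<le> c\<^sup>2 / 8" using Q1 unfolding cB[symmetric] by (intro mult_left_mono) auto
  \<comment> \<open>Four times the bound n c^2/8 on the mean quadratic variation, which leaves room
    for the factor 2 asked by \<open>D_deviation\<close> and still makes the exponent (c r)^2/v
    equal to 2 LL n.\<close>
  define v where "v = real n * c\<^sup>2 / 2"
  have v0: "0 < v" using n0 c0 by (simp add: v_def)
  have p1: "prob A1 \<le> (256 * (\<Psi>2\<^sup>2 + \<Phi>\<^sup>2) / c\<^sup>2 + 2) / (ln (real n))\<^sup>2"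
  proof -
    \<comment> \<open>The minimiser of \<rho>^2 v - 2 c r \<rho>; the minimum -2 LL n turns the
      exponential into 1/(ln n)^2. The level T = sqrt n / ln n keeps \<rho> admissible for large
      \<open>n\<close> and gives the variance term the same order.\<close>
    define \<rho> where "\<rho> = 2 * r / (real n * c)"
    have rT: "r * T = real n * sqrt (LL n) / ln (real n)"
      unfolding r T using n0 LLn by (simp add: real_sqrt_mult)
    have "\<rho> * (8 * T * \<Phi>) = 16 * \<Phi> * (r * T) / (real n * c)" by (simp add: \<rho>_def)
    also have "\<dots> = 16 * \<Phi> * sqrt (LL n) / (c * ln (real n))" unfolding rT using n0 c0 ln1 by (simp add: field_simps)
    also have "\<dots> \<le> 1" using Tb(3) c0 ln1 by (subst divide_le_eq_1_pos) auto
    finally have \<rho>1: "\<rho> * (8 * T * \<Phi>) \<le> 1" .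
    have "2 * real n * (32 * \<Psi>\<^sup>2 * T1.Q) \<le> 2 * real n * (c\<^sup>2 / 8)" using n0 cQ by (intro mult_left_mono) auto
    also have "\<dots> \<le> v" using n0 by (simp add: v_def)
    finally have v1: "2 * real n * (32 * \<Psi>\<^sup>2 * T1.Q) \<le> v" .
    have "prob A1 \<le> 2 * (8 * real n * (32 * \<Psi>\<^sup>2 * T1.Q * (32 * T\<^sup>2 * (\<Psi>2\<^sup>2 + \<Phi>\<^sup>2))) / v\<^sup>2 + exp (\<rho>\<^sup>2 * v - \<rho> * (2 * c * r)))"
      unfolding A1_def by (rule T1.freedman[OF v0 v1 _ \<rho>1]) (use r0 n0 c0 in \<open>simp add: \<rho>_def\<close>)
    also have "exp (\<rho>\<^sup>2 * v - \<rho> * (2 * c * r)) = 1 / (ln (real n))\<^sup>2"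
    proof -
      have "\<rho>\<^sup>2 * v - \<rho> * (2 * c * r) = - 2 * r\<^sup>2 / real n"
        using n0 c0 by (simp add: \<rho>_def v_def power2_eq_square field_simps)
      also have "\<dots> = - (2 * LL n)" unfolding rsq using n0 by simp
      finally have "exp (\<rho>\<^sup>2 * v - \<rho> * (2 * c * r)) = inverse (exp (2 * LL n))" by (simp add: exp_minus)
      also have "exp (2 * LL n) = (ln (real n))\<^sup>2" using ln1 by (simp add: exp_double)
      finally show ?thesis by (simp add: inverse_eq_divide)
    qed
    also have "8 * real n * (32 * \<Psi>\<^sup>2 * T1.Q * (32 * T\<^sup>2 * (\<Psi>2\<^sup>2 + \<Phi>\<^sup>2))) / v\<^sup>2 \<le>
      8 * real n * (c\<^sup>2 / 8 * (32 * T\<^sup>2 * (\<Psi>2\<^sup>2 + \<Phi>\<^sup>2))) / v\<^sup>2"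
      using cQ n0 by (intro divide_right_mono mult_left_mono mult_right_mono) auto
    also have "\<dots> = 128 * (\<Psi>2\<^sup>2 + \<Phi>\<^sup>2) / c\<^sup>2 / (ln (real n))\<^sup>2"
    proof -
      have T2: "T\<^sup>2 = real n / (ln (real n))\<^sup>2" unfolding T using n0 by (simp add: power_divide)
      have gen: "8 * N * (C / 8 * (32 * (N / l) * G)) / (N * C / 2)\<^sup>2 = 128 * G / C / l"
        if "0 < N" "0 < C" "0 < l" for N C l G :: real
        using that by (simp add: power2_eq_square field_simps)
      show ?thesis unfolding T2 v_def by (rule gen) (use n0 c0 ln1 in auto)
    qed
    finally show ?thesis by (simp add: add_divide_distrib)
  qed
  have p2: "prob A2 \<le> T2.Q * 2 / (B\<^sup>2 * LL n)"
  proof -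
    have "prob A2 \<le> real n * (32 * \<Psi>\<^sup>2 * T2.Q) / (c * r / 4)\<^sup>2"
      unfolding A2_def by (rule T2.M_maximal) (use c0 r0 in simp)
    also have "\<dots> = real n * (32 * \<Psi>\<^sup>2 * B\<^sup>2) * T2.Q * 16 / (B\<^sup>2 * c\<^sup>2 * r\<^sup>2)"
      using B c0 r0 by (simp add: power_mult_distrib power_divide)
    also have "\<dots> = T2.Q * 2 / (B\<^sup>2 * LL n)"
      unfolding cB rsq using B c0 n0 by simp
    finally show ?thesis .
  qed
  have p3: "prob A3 \<le> e3 * (8 * real n) / (c * r)"
  proof -
    have "prob A3 \<le> expectation W / (c * r / 4)"
      unfolding A3_def by (rule integral_Markov_inequality_measure[where A="{}"]) (use WI W0 c0 r0 in auto)
    then show ?thesis unfolding EW by (simp add: mult_ac)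
  qed
  also have "\<dots> \<le> (\<Sum>l\<in>L. \<bar>a l\<bar> * (LINT w|P. (if b < \<bar>g l (Y 0 w)\<bar> then \<bar>g l (Y 0 w)\<bar> else 0))) * (8 * real n) / (c * r)"
    using e3 c0 r0 by (intro divide_right_mono mult_right_mono) auto
  finally show ?thesis using main p1 p2 unfolding Q2 by linarith
qed

section \<open>Summation over n and passage to the closure\<close>

context mixing
begin

text \<open>Exchanging the sum over \<open>n\<close> with the expectation reduces the middle and
  upper parts to the pointwise sums at y = |g_l(Y_0)|; both become multiples of E g_l(Y_0)^2 <= B^2,
  and the weights |a_l| add up to at most 1.\<close>

lemma comb_sum_bound:
  assumes B: "0 < B" "0 < \<Psi>" and c: "c = 16 * \<Psi> * B"
  obtains K where "\<And>L a g N. finite L \<Longrightarrow> (\<Sum>l\<in>L. \<bar>a l :: real\<bar>) \<le> 1 \<Longrightarrow> (\<And>l :: nat. l \<in> L \<Longrightarrow> imono (g l)) \<Longrightarrow>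
    (\<And>l. l \<in> L \<Longrightarrow> integrable P (\<lambda>w. (g l (Y 0 w))\<^sup>2)) \<Longrightarrow> (\<And>l. l \<in> L \<Longrightarrow> (LINT w|P. (g l (Y 0 w))\<^sup>2) \<le> B\<^sup>2) \<Longrightarrow>
    (\<Sum>n=3..N. 1 / real n * prob (deviates (\<lambda>x. \<Sum>l\<in>L. a l * g l x) n (11/4 * c * sqrt (real n * LL n)))) \<le> K"
proof -
  have c0: "0 < c" unfolding c using B by simp
  \<comment> \<open>The upper level is \<eta> sqrt(n LL n), with \<eta> small enough that 64 \<eta>
    \<Phi> <= c, the condition on the martingale gap. Adding 1 avoids a case distinction on
    \<Phi>.\<close>
  define \<eta> where "\<eta> = c / (64 * (\<Phi> + 1))"
  have \<eta>: "0 < \<eta>" using c0 Phi_nonneg by (simp add: \<eta>_def)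
  have \<eta>1: "64 * \<eta> * \<Phi> \<le> c"
  proof -
    have "64 * \<eta> * \<Phi> = c * (\<Phi> / (\<Phi> + 1))" using Phi_nonneg by (simp add: \<eta>_def field_simps)
    also have "\<dots> \<le> c * 1" using Phi_nonneg c0 by (intro mult_left_mono) auto
    finally show ?thesis by simp
  qed
  define r where "r n = sqrt (real n * LL n)" for n
  define T where "T n = sqrt (real n) / ln (real n)" for n
  \<comment> \<open>Beyond \<open>n1\<close>, which depends on the mixing constants and on
    \<open>c\<close> only, the truncation levels are ordered and \<rho> is admissible. The finitely
    many earlier terms are at most 1 each.\<close>
  obtain n1 where n1: "\<And>n. n1 \<le> n \<Longrightarrow> 3 \<le> n \<and> 16 * \<Phi> / c * sqrt (LL n) \<le> ln (real n) \<and> T n \<le> \<eta> * r n"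
    using truncation_eventually[OF \<eta>, of "16 * \<Phi> / c"] unfolding eventually_sequentially T_def r_def by blast
  obtain K2 where K2: "0 \<le> K2" "\<And>N y. (\<Sum>n=3..N. if T n < y \<and> y \<le> \<eta> * r n then 1 / (real n * LL n) else 0) \<le> K2"
    using sum_inverse_middle_le[OF \<eta>] unfolding T_def r_def by blast
  obtain K3 where K3: "0 \<le> K3" "\<And>N y. 0 \<le> y \<Longrightarrow> (\<Sum>n=3..N. if \<eta> * r n < y then 1 / r n else 0) \<le> K3 * y"
    using sum_inverse_tail_le[OF \<eta>] unfolding r_def by blast
  define C0 where "C0 = 256 * (\<Psi>2\<^sup>2 + \<Phi>\<^sup>2) / c\<^sup>2 + 2"
  have C0: "0 \<le> C0" using c0 by (simp add: C0_def)
  have r0: "0 < r n" if "3 \<le> n" for n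
    unfolding r_def using that LL_pos[OF that] by (intro real_sqrt_gt_zero mult_pos_pos) auto
  show ?thesis
  proof (rule that)
    fix L and a :: "nat \<Rightarrow> real" and g :: "nat \<Rightarrow> real \<Rightarrow> real" and N
    assume L: "finite L" "(\<Sum>l\<in>L. \<bar>a l\<bar>) \<le> 1" "\<And>l. l \<in> L \<Longrightarrow> imono (g l)"
      and g2: "\<And>l. l \<in> L \<Longrightarrow> integrable P (\<lambda>w. (g l (Y 0 w))\<^sup>2)" "\<And>l. l \<in> L \<Longrightarrow> (LINT w|P. (g l (Y 0 w))\<^sup>2) \<le> B\<^sup>2"
    have gm [measurable]: "g l \<in> borel_measurable borel" if "l \<in> L" for l by (rule imono_borel[OF L(3)[OF that]])
    define p where "p n = prob (deviates (\<lambda>x. \<Sum>l\<in>L. a l * g l x) n (11/4 * c * sqrt (real n * LL n)))" for n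
    define u where "u n z = (trunc (T n) (\<eta> * r n) z)\<^sup>2" for n and z :: real
    define \<tau> where "\<tau> n z = (if \<eta> * r n < \<bar>z\<bar> then \<bar>z\<bar> else 0)" for n and z :: real
    have uw [measurable]: "u n \<in> borel_measurable borel" "\<tau> n \<in> borel_measurable borel" for n
      unfolding u_def \<tau>_def by measurable
    define \<beta> where "\<beta> n = (\<Sum>l\<in>L. \<bar>a l\<bar> * (LINT w|P. u n (g l (Y 0 w))))" for n
    define \<gamma> where "\<gamma> n = (\<Sum>l\<in>L. \<bar>a l\<bar> * (LINT w|P. \<tau> n (g l (Y 0 w))))" for n
    have \<beta>0: "0 \<le> \<beta> n" for n unfolding \<beta>_def u_def by (intro sum_nonneg mult_nonneg_nonneg integral_nonneg_AE) auto
    have \<gamma>0: "0 \<le> \<gamma> n" for n unfolding \<gamma>_def \<tau>_def by (intro sum_nonneg mult_nonneg_nonneg integral_nonneg_AE) auto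
    note comb = weighted_sum_le[OF L(2)]
    have step: "1 / real n * p n \<le> (if n < n1 then 1 else 0) + C0 * (1 / (real n * (ln (real n))\<^sup>2)) +
       2 / B\<^sup>2 * (\<beta> n / (real n * LL n)) + 8 / c * (\<gamma> n / r n)" if n: "n \<in> {3..N}" for n
    proof (cases "n < n1")
      case True
      have "1 / real n * p n \<le> 1 * 1" using n unfolding p_def by (intro mult_mono) auto
      moreover have "0 \<le> C0 * (1 / (real n * (ln (real n))\<^sup>2))" using C0 by simp
      moreover have "0 \<le> 2 / B\<^sup>2 * (\<beta> n / (real n * LL n))"
        using \<beta>0 LL_pos[of n] n by (intro mult_nonneg_nonneg divide_nonneg_nonneg) auto
      moreover have "0 \<le> 8 / c * (\<gamma> n / r n)"
        using \<gamma>0 r0[of n] c0 n by (intro mult_nonneg_nonneg divide_nonneg_nonneg) auto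
      ultimately show ?thesis using True by simp
    next
      case False
      then have nn: "3 \<le> n" "16 * \<Phi> / c * sqrt (LL n) \<le> ln (real n)" "T n \<le> \<eta> * r n" using n1[of n] by auto
      have LLn: "0 < LL n" by (rule LL_pos[OF nn(1)])
      have "p n \<le> (256 * (\<Psi>2\<^sup>2 + \<Phi>\<^sup>2) / c\<^sup>2 + 2) / (ln (real n))\<^sup>2
        + (\<Sum>l\<in>L. \<bar>a l\<bar> * (LINT w|P. (trunc (T n) (\<eta> * r n) (g l (Y 0 w)))\<^sup>2)) * 2 / (B\<^sup>2 * LL n)
        + (\<Sum>l\<in>L. \<bar>a l\<bar> * (LINT w|P. (if \<eta> * r n < \<bar>g l (Y 0 w)\<bar> then \<bar>g l (Y 0 w)\<bar> else 0))) * (8 * real n) / (c * r n)"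
        unfolding p_def r_def[symmetric]
      proof (rule comb_deviation[OF L g2 B c nn(1) T_def r_def nn(3)])
        show "64 * (\<eta> * r n) * \<Phi> \<le> c * r n"
          using mult_right_mono[OF \<eta>1, of "r n"] r0[OF nn(1)] by (simp add: mult_ac)
        show "16 * \<Phi> * sqrt (LL n) \<le> c * ln (real n)" using nn(2) c0 by (simp add: field_simps)
      qed
      then have "p n \<le> C0 / (ln (real n))\<^sup>2 + \<beta> n * 2 / (B\<^sup>2 * LL n) + \<gamma> n * (8 * real n) / (c * r n)"
        by (simp add: C0_def \<beta>_def \<gamma>_def u_def \<tau>_def)
      then have "1 / real n * p n \<le> 1 / real n * (C0 / (ln (real n))\<^sup>2 + \<beta> n * 2 / (B\<^sup>2 * LL n) + \<gamma> n * (8 * real n) / (c * r n))"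
        by (intro mult_left_mono) auto
      also have "\<dots> = C0 * (1 / (real n * (ln (real n))\<^sup>2)) + 2 / B\<^sup>2 * (\<beta> n / (real n * LL n)) + 8 / c * (\<gamma> n / r n)"
      proof -
        have "1 / m * (C / s + b * 2 / (B' * t) + e * (8 * m) / (c * q)) = C * (1 / (m * s)) + 2 / B' * (b / (m * t)) + 8 / c * (e / q)"
          if "m \<noteq> 0" for m C s b B' t e q :: real using that by (simp add: distrib_left mult_ac)
        then show ?thesis using nn(1) by simp
      qed
      finally show ?thesis using False by simp
    qed
    have "(\<Sum>n=3..N. 1 / real n * p n) \<le> (\<Sum>n=3..N. (if n < n1 then 1 else 0) + C0 * (1 / (real n * (ln (real n))\<^sup>2)) +
       2 / B\<^sup>2 * (\<beta> n / (real n * LL n)) + 8 / c * (\<gamma> n / r n))" by (rule sum_mono[OF step])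
    also have "\<dots> = (\<Sum>n=3..N. if n < n1 then 1 else 0) + C0 * (\<Sum>n=3..N. 1 / (real n * (ln (real n))\<^sup>2)) +
       2 / B\<^sup>2 * (\<Sum>n=3..N. \<beta> n / (real n * LL n)) + 8 / c * (\<Sum>n=3..N. \<gamma> n / r n)"
      by (simp only: sum.distrib sum_distrib_left)
    also have "\<dots> \<le> real n1 + C0 * (1 / ln 2) + 2 / B\<^sup>2 * (K2 * B\<^sup>2) + 8 / c * (K3 * B\<^sup>2)"
    proof (intro add_mono mult_left_mono)
      have "(\<Sum>n=3..N. if n < n1 then 1 else 0 :: real) = (\<Sum>n\<in>{n\<in>{3..N}. n < n1}. 1)"
        by (rule sum.inter_filter[symmetric]) simp
      also have "\<dots> \<le> (\<Sum>n\<in>{..<n1}. 1)" by (rule sum_mono2) auto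
      finally show "(\<Sum>n=3..N. if n < n1 then 1 else 0 :: real) \<le> real n1" by simp
      show "(\<Sum>n=3..N. 1 / (real n * (ln (real n))\<^sup>2)) \<le> 1 / ln 2"
      proof (cases "2 \<le> N")
        case True
        then have "0 \<le> 1 / ln (real N)" by simp
        then show ?thesis using sum_inverse_ln_sq_le[OF True] by linarith
      qed simp
      have uI: "integrable P (\<lambda>w. u n (g l (Y 0 w)))" if "l \<in> L" for n l
        by (rule Bochner_Integration.integrable_bound[OF g2(1)[OF that]])
          (use gm[OF that] trunc_sq_le in \<open>auto simp: u_def\<close>)
      have "(\<Sum>n=3..N. \<beta> n / (real n * LL n)) = (\<Sum>n=3..N. \<Sum>l\<in>L. \<bar>a l\<bar> * ((LINT w|P. u n (g l (Y 0 w))) / (real n * LL n)))"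
        by (simp add: \<beta>_def sum_divide_distrib)
      also have "\<dots> = (\<Sum>l\<in>L. \<Sum>n=3..N. \<bar>a l\<bar> * ((LINT w|P. u n (g l (Y 0 w))) / (real n * LL n)))" by (rule sum.swap)
      also have "\<dots> = (\<Sum>l\<in>L. \<bar>a l\<bar> * (LINT w|P. (\<Sum>n=3..N. u n (g l (Y 0 w)) / (real n * LL n))))"
        using uI by (intro sum.cong refl) (simp add: sum_distrib_left)
      also have "\<dots> \<le> K2 * B\<^sup>2"
      proof (rule comb)
        fix l assume l: "l \<in> L"
        have "(LINT w|P. (\<Sum>n=3..N. u n (g l (Y 0 w)) / (real n * LL n))) \<le> (LINT w|P. K2 * (g l (Y 0 w))\<^sup>2)"
        proof (rule integral_mono)
          fix w
          let ?z = "g l (Y 0 w)"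
          \<comment> \<open>A truncated square is the full square times the indicator of the band;
            what remains is the sum of 1/(n LL n) over the indices whose band contains |z|.\<close>
          have "(\<Sum>n=3..N. u n ?z / (real n * LL n)) = ?z\<^sup>2 * (\<Sum>n=3..N. if T n < \<bar>?z\<bar> \<and> \<bar>?z\<bar> \<le> \<eta> * r n then 1 / (real n * LL n) else 0)"
            unfolding sum_distrib_left by (intro sum.cong refl) (simp add: u_def trunc_def)
          also have "\<dots> \<le> ?z\<^sup>2 * K2" by (intro mult_left_mono K2) simp
          finally show "(\<Sum>n=3..N. u n ?z / (real n * LL n)) \<le> K2 * ?z\<^sup>2" by (simp add: mult.commute)
        qed (use uI[OF l] g2(1)[OF l] in auto)
        also have "\<dots> \<le> K2 * B\<^sup>2" using mult_left_mono[OF g2(2)[OF l] K2(1)] by simp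
        finally show "(LINT w|P. (\<Sum>n=3..N. u n (g l (Y 0 w)) / (real n * LL n))) \<le> K2 * B\<^sup>2" .
      qed (use K2 in simp)
      finally show "(\<Sum>n=3..N. \<beta> n / (real n * LL n)) \<le> K2 * B\<^sup>2" .
      have gI: "integrable P (\<lambda>w. g l (Y 0 w))" if "l \<in> L" for l
        by (rule square_integrable_imp_integrable) (use g2(1)[OF that] gm[OF that] in auto)
      have wI: "integrable P (\<lambda>w. \<tau> n (g l (Y 0 w)))" if "l \<in> L" for n l
        by (rule Bochner_Integration.integrable_bound[OF gI[OF that]])
          (use gm[OF that] in \<open>auto simp: \<tau>_def\<close>)
      have "(\<Sum>n=3..N. \<gamma> n / r n) = (\<Sum>n=3..N. \<Sum>l\<in>L. \<bar>a l\<bar> * ((LINT w|P. \<tau> n (g l (Y 0 w))) / r n))"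
        by (simp add: \<gamma>_def sum_divide_distrib)
      also have "\<dots> = (\<Sum>l\<in>L. \<Sum>n=3..N. \<bar>a l\<bar> * ((LINT w|P. \<tau> n (g l (Y 0 w))) / r n))" by (rule sum.swap)
      also have "\<dots> = (\<Sum>l\<in>L. \<bar>a l\<bar> * (LINT w|P. (\<Sum>n=3..N. \<tau> n (g l (Y 0 w)) / r n)))"
        using wI by (intro sum.cong refl) (simp add: sum_distrib_left)
      also have "\<dots> \<le> K3 * B\<^sup>2"
      proof (rule comb)
        fix l assume l: "l \<in> L"
        have "(LINT w|P. (\<Sum>n=3..N. \<tau> n (g l (Y 0 w)) / r n)) \<le> (LINT w|P. K3 * (g l (Y 0 w))\<^sup>2)"
        proof (rule integral_mono)
          fix w
          let ?z = "g l (Y 0 w)"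
          have "(\<Sum>n=3..N. \<tau> n ?z / r n) = \<bar>?z\<bar> * (\<Sum>n=3..N. if \<eta> * r n < \<bar>?z\<bar> then 1 / r n else 0)"
            unfolding sum_distrib_left by (intro sum.cong refl) (simp add: \<tau>_def)
          also have "\<dots> \<le> \<bar>?z\<bar> * (K3 * \<bar>?z\<bar>)" by (intro mult_left_mono K3) auto
          also have "\<dots> = K3 * ?z\<^sup>2" by (simp add: power2_eq_square abs_mult_self_eq mult.left_commute)
          finally show "(\<Sum>n=3..N. \<tau> n ?z / r n) \<le> K3 * ?z\<^sup>2" .
        qed (use wI[OF l] g2(1)[OF l] in auto)
        also have "\<dots> \<le> K3 * B\<^sup>2" using mult_left_mono[OF g2(2)[OF l] K3(1)] by simp
        finally show "(LINT w|P. (\<Sum>n=3..N. \<tau> n (g l (Y 0 w)) / r n)) \<le> K3 * B\<^sup>2" .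
      qed (use K3 in simp)
      finally show "(\<Sum>n=3..N. \<gamma> n / r n) \<le> K3 * B\<^sup>2" .
    qed (use C0 c0 in auto)
    finally show "(\<Sum>n=3..N. 1 / real n * prob (deviates (\<lambda>x. \<Sum>l\<in>L. a l * g l x) n (11/4 * c * sqrt (real n * LL n))))
      \<le> real n1 + C0 * (1 / ln 2) + 2 / B\<^sup>2 * (K2 * B\<^sup>2) + 8 / c * (K3 * B\<^sup>2)" unfolding p_def .
  qed
qed

text \<open>Replacing \<open>f\<close> by \<open>h\<close> changes every centered partial sum up to
  \<open>n\<close> by at most \<open>W\<close>, whose mean is 2n times the L^1 distance; Markov's
  inequality does the rest.\<close>

lemma deviation_perturbation:
  assumes f: "f \<in> borel_measurable borel" "integrable P (\<lambda>w. f (Y 0 w))"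
    and h: "h \<in> borel_measurable borel" "integrable P (\<lambda>w. h (Y 0 w))" and y: "0 < y"
  shows "prob (deviates f n (x + y)) \<le>
    prob (deviates h n x)
    + 2 * real n * (LINT w|P. \<bar>f (Y 0 w) - h (Y 0 w)\<bar>) / y"
proof -
  note [measurable] = f(1) h(1)
  define e where "e = (LINT w|P. \<bar>f (Y 0 w) - h (Y 0 w)\<bar>)"
  note fI = integrable_Y[OF f] and hI = integrable_Y[OF h]
  define W where "W w = (\<Sum>i=1..n. \<bar>f (Y i w) - h (Y i w)\<bar> + e)" for w
  have WI: "integrable P W" unfolding W_def using fI hI by auto
  then have [measurable]: "W \<in> borel_measurable P" by auto
  have e0: "0 \<le> e" unfolding e_def by (rule integral_nonneg_AE) auto
  have W0: "0 \<le> W w" for w unfolding W_def by (intro sum_nonneg add_nonneg_nonneg e0) auto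
  have EW: "expectation W = 2 * real n * e"
  proof -
    have "(LINT w|P. \<bar>f (Y i w) - h (Y i w)\<bar>) = e" for i
      unfolding e_def by (rule expect_Y[of "\<lambda>y. \<bar>f y - h y\<bar>"]) measurable
    then show ?thesis unfolding W_def using fI hI by (simp add: prob_space)
  qed
  have m: "\<bar>(LINT w|P. f (Y 0 w)) - (LINT w|P. h (Y 0 w))\<bar> \<le> e"
    using integral_abs_bound[of P "\<lambda>w. f (Y 0 w) - h (Y 0 w)"] fI hI by (simp add: e_def)
  have "deviates f n (x + y) \<subseteq>
    deviates h n x \<union> {w \<in> space P. y \<le> W w}"
  proof (intro subsetI, rule ccontr)
    fix w
    assume "w \<in> deviates f n (x + y)"
    then obtain k where k: "w \<in> space P" "k \<in> {1..n}" "x + y < \<bar>\<Sum>i=1..k. f (Y i w) - (LINT w|P. f (Y 0 w))\<bar>" by blast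
    assume n: "w \<notin> deviates h n x \<union> {w \<in> space P. y \<le> W w}"
    then have "\<not> x < \<bar>\<Sum>i=1..k. h (Y i w) - (LINT w|P. h (Y 0 w))\<bar>" "W w < y" using k by auto
    moreover have "\<bar>(\<Sum>i=1..k. f (Y i w) - (LINT w|P. f (Y 0 w))) - (\<Sum>i=1..k. h (Y i w) - (LINT w|P. h (Y 0 w)))\<bar> \<le> W w"
    proof -
      have "\<bar>(\<Sum>i=1..k. f (Y i w) - (LINT w|P. f (Y 0 w))) - (\<Sum>i=1..k. h (Y i w) - (LINT w|P. h (Y 0 w)))\<bar> \<le>
        (\<Sum>i=1..k. \<bar>(f (Y i w) - (LINT w|P. f (Y 0 w))) - (h (Y i w) - (LINT w|P. h (Y 0 w)))\<bar>)"
        unfolding sum_subtractf[symmetric] by (rule sum_abs)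
      also have "\<dots> \<le> (\<Sum>i=1..k. \<bar>f (Y i w) - h (Y i w)\<bar> + e)" by (rule sum_mono) (use m in linarith)
      also have "\<dots> \<le> W w" unfolding W_def by (rule sum_mono2) (use k e0 in auto)
      finally show ?thesis .
    qed
    ultimately show False using k(3) by linarith
  qed
  then have "prob (deviates f n (x + y)) \<le>
    prob (deviates h n x \<union> {w \<in> space P. y \<le> W w})"
    by (rule finite_measure_mono) measurable
  also have "\<dots> \<le> prob (deviates h n x) + \<P>(w in P. y \<le> W w)"
    by (rule measure_Un_le) measurable
  also have "\<P>(w in P. y \<le> W w) \<le> expectation W / y"
    by (rule integral_Markov_inequality_measure[where A="{}"]) (use WI W0 y in auto)
  finally show ?thesis unfolding EW e_def by simp
qed

text \<open>The degenerate case of threshold 0. If \<Psi> vanishes then so does \<phi>_1(0), and as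
  Y_0 is known at time 0, the bounded increasing function arctan(Y_0) equals its mean almost surely.
  Stationarity extends this to every \<open>i\<close>.\<close>

lemma Y_constant:
  assumes "\<Psi> = 0" obtains y where "\<And>i. AE w in P. Y i w = y"
proof -
  have "(\<lambda>k. sqrt (\<phi>1 k)) = (\<lambda>k. 0)"
    using suminf_eq_zero_iff[OF summable_sqrt1] assms phi1_nonneg by (auto simp: \<Psi>_def)
  from fun_cong[OF this, of 0] have z: "\<phi>1 0 = 0" by simp
  have "\<bar>arctan x\<bar> \<le> 2" for x using arctan_lbound[of x] arctan_ubound[of x] pi_less_4 by linarith
  then have bv: "bv P (4 * 2) arctan" by (intro bv_imono imono_mono) (auto simp: mono_def arctan_le_iff)
  define m where "m = (LINT w|P. arctan (Y 0 w))"
  have "AE w in P. \<bar>CE 0 (\<lambda>w. arctan (Y 0 w) - m) w\<bar> \<le> 0"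
    using CE_bv1[OF bv, of 0 0] z by (simp add: m_def)
  moreover have "AE w in P. CE 0 (\<lambda>w. arctan (Y 0 w) - m) w = arctan (Y 0 w) - m"
    by (intro CE_self ess_bdd_diff ess_bdd_const bv_ess_bdd[OF bv] Y_F)
  ultimately have Y0: "AE w in P. Y 0 w = tan m"
  proof eventually_elim
    case (elim w)
    then have "arctan (Y 0 w) = m" by simp
    then show ?case using tan_arctan[of "Y 0 w"] by simp
  qed
  have "AE w in P. Y i w = tan m" for i
  proof -
    have "AE z in distr P borel (Y 0). z = tan m" by (subst AE_distr_iff) (use Y0 in auto)
    then have "AE z in distr P borel (Y i). z = tan m" by (simp only: Y_distr[of i])
    then show ?thesis by (subst (asm) AE_distr_iff) auto
  qed
  then show ?thesis by (rule that)
qed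

text \<open>For each \<open>N\<close> the approximant is chosen afterwards, close enough that all
  perturbations up to \<open>N\<close> together cost at most 1. Since \<open>K\<close> does not see
  the approximant, the partial sums stay below K + 1.\<close>

lemma deviation_summable:
  assumes f: "f \<in> Mon2c B (distr P borel (Y 0))" and B: "0 < B"
  shows "(\<lambda>n. 1 / real n * prob (deviates f n (3 * (16 * \<Psi>) * B * sqrt (real n * LL n)))) summable_on {3..}"
proof -
  define c where "c = 16 * \<Psi> * B"
  define p where "p n = prob (deviates f n (11/4 * c * sqrt (real n * LL n) + c * sqrt (real n * LL n) / 4))" for n
  let ?\<mu> = "distr P borel (Y 0)"
  have fI: "integrable ?\<mu> f" using f by (simp add: Mon2c_def)
  have fm [measurable]: "f \<in> borel_measurable borel" using borel_measurable_integrable[OF fI] by simp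
  have fP: "integrable P (\<lambda>w. f (Y 0 w))" using fI by (subst (asm) integrable_distr_eq) auto
  have pe: "3 * (16 * \<Psi>) * B * sqrt (real n * LL n) = 11/4 * c * sqrt (real n * LL n) + c * sqrt (real n * LL n) / 4" for n
    by (simp add: c_def)
  have "\<exists>K. \<forall>N. (\<Sum>n=3..N. 1 / real n * p n) \<le> K"
  proof (cases "\<Psi> = 0")
    case True
    then obtain y where y: "\<And>i. AE w in P. Y i w = y" using Y_constant by blast
    have m: "(LINT w|P. f (Y 0 w)) = f y"
    proof -
      have "(LINT w|P. f (Y 0 w)) = (LINT w|P. f y)"
        by (rule integral_cong_AE) (use y[of 0] in auto)
      then show ?thesis by (simp add: prob_space)
    qed
    \<comment> \<open>Here c = 0 and the centered sums vanish almost surely, so the strict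
      inequality against the threshold 0 fails.\<close>
    have "p n = 0" for n
    proof -
      have "AE w in P. \<forall>i\<in>{1..n}. Y i w = y" by (rule AE_finite_allI) (use y in auto)
      then have "AE w in P. \<not> (\<exists>k\<in>{1..n}. 11/4 * c * sqrt (real n * LL n) + c * sqrt (real n * LL n) / 4 <
        \<bar>\<Sum>i=1..k. f (Y i w) - (LINT w|P. f (Y 0 w))\<bar>)"
        by eventually_elim (auto simp: m c_def True)
      then show ?thesis unfolding p_def by (intro prob_eq_0_AE) auto
    qed
    then show ?thesis by auto
  next
    case False
    then have Psi: "0 < \<Psi>" using Psi_nonneg by simp
    have c0: "0 < c" using Psi B by (simp add: c_def)
    obtain K where K: "\<And>L a g N. finite L \<Longrightarrow> (\<Sum>l\<in>L. \<bar>a l :: real\<bar>) \<le> 1 \<Longrightarrow> (\<And>l :: nat. l \<in> L \<Longrightarrow> imono (g l)) \<Longrightarrow>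
      (\<And>l. l \<in> L \<Longrightarrow> integrable P (\<lambda>w. (g l (Y 0 w))\<^sup>2)) \<Longrightarrow> (\<And>l. l \<in> L \<Longrightarrow> (LINT w|P. (g l (Y 0 w))\<^sup>2) \<le> B\<^sup>2) \<Longrightarrow>
      (\<Sum>n=3..N. 1 / real n * prob (deviates (\<lambda>x. \<Sum>l\<in>L. a l * g l x) n (11/4 * c * sqrt (real n * LL n)))) \<le> K"
      using comb_sum_bound[OF B Psi c_def] by blast
    have "(\<Sum>n=3..N. 1 / real n * p n) \<le> K + 1" for N
    proof -
      define y where "y n = c * sqrt (real n * LL n) / 4" for n
      have y0: "0 < y n" if "3 \<le> n" for n
        unfolding y_def using c0 that LL_pos[OF that] by (intro divide_pos_pos mult_pos_pos real_sqrt_gt_zero) auto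
      \<comment> \<open>Perturbing at index \<open>n\<close> costs e 2/y_n after division by
        \<open>n\<close>, so an L^1 error below 1/(s + 1) gives e s <= 1; the added 1 covers s =
        0.\<close>
      define s where "s = (\<Sum>n=3..N. 2 / y n)"
      have s0: "0 \<le> s" unfolding s_def using y0 by (intro sum_nonneg divide_nonneg_nonneg) (auto intro: less_imp_le)
      obtain h where h: "h \<in> Mon2_comb B ?\<mu>" "(\<integral>\<^sup>+x. ennreal \<bar>f x - h x\<bar> \<partial>?\<mu>) < ennreal (1 / (s + 1))"
        using f s0 unfolding Mon2c_def by (auto dest!: spec[of _ "1 / (s + 1)"])
      from h(1)[unfolded Mon2_comb_def mem_Collect_eq] obtain Ln :: nat and a g
        where L: "(\<Sum>l=1..Ln. \<bar>a l\<bar>) \<le> 1" "\<forall>l\<in>{1..Ln}. g l \<in> Mon2 B ?\<mu>"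
        and he: "h = (\<lambda>x. \<Sum>l=1..Ln. a l * g l x)" by blast
      have im: "imono (g l)" if l: "l \<in> {1..Ln}" for l
        using bspec[OF L(2) l] imono_of_mono_on unfolding Mon2_def by blast
      have gm [measurable]: "g l \<in> borel_measurable borel" if "l \<in> {1..Ln}" for l by (rule imono_borel[OF im[OF that]])
      have g2: "integrable P (\<lambda>w. (g l (Y 0 w))\<^sup>2) \<and> (LINT w|P. (g l (Y 0 w))\<^sup>2) \<le> B\<^sup>2" if l: "l \<in> {1..Ln}" for l
      proof -
        have "(\<integral>\<^sup>+x. ennreal (\<bar>g l x\<bar>\<^sup>2) \<partial>?\<mu>) \<le> ennreal (B\<^sup>2)" using bspec[OF L(2) l] by (simp add: Mon2_def)
        then have n: "(\<integral>\<^sup>+w. ennreal ((g l (Y 0 w))\<^sup>2) \<partial>P) \<le> ennreal (B\<^sup>2)"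
          using gm[OF l] by (subst (asm) nn_integral_distr) auto
        have I: "integrable P (\<lambda>w. (g l (Y 0 w))\<^sup>2)"
        proof (rule integrableI_nonneg)
          show "(\<integral>\<^sup>+w. ennreal ((g l (Y 0 w))\<^sup>2) \<partial>P) < \<infinity>" using n by (rule le_less_trans) simp
        qed (use gm[OF l] in auto)
        then have "ennreal (LINT w|P. (g l (Y 0 w))\<^sup>2) \<le> ennreal (B\<^sup>2)"
          using n nn_integral_eq_integral[OF I] by simp
        then show ?thesis using I by simp
      qed
      have gI: "integrable P (\<lambda>w. g l (Y 0 w))" if "l \<in> {1..Ln}" for l
        by (rule square_integrable_imp_integrable) (use g2[OF that] gm[OF that] in auto)
      have hm [measurable]: "h \<in> borel_measurable borel" unfolding he by measurable
      have hP: "integrable P (\<lambda>w. h (Y 0 w))" unfolding he using gI by auto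
      define e where "e = (LINT w|P. \<bar>f (Y 0 w) - h (Y 0 w)\<bar>)"
      have e0: "0 \<le> e" unfolding e_def by (rule integral_nonneg_AE) auto
      have es: "e * s \<le> 1"
      proof -
        have "(\<integral>\<^sup>+x. ennreal \<bar>f x - h x\<bar> \<partial>?\<mu>) = (\<integral>\<^sup>+w. ennreal \<bar>f (Y 0 w) - h (Y 0 w)\<bar> \<partial>P)"
          by (rule nn_integral_distr) measurable
        also have "\<dots> = ennreal e" unfolding e_def using fP hP by (intro nn_integral_eq_integral) auto
        finally have "ennreal e < ennreal (1 / (s + 1))" using h(2) by simp
        then have "e < 1 / (s + 1)" using e0 by (simp add: ennreal_less_iff)
        then have "e * (s + 1) < 1" using s0 by (simp add: pos_less_divide_eq)
        then show ?thesis using e0 by (simp add: distrib_left)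
      qed
      define ph where "ph n = prob (deviates h n (11/4 * c * sqrt (real n * LL n)))" for n
      have "1 / real n * p n \<le> 1 / real n * ph n + e * (2 / y n)" if n: "n \<in> {3..N}" for n
      proof -
        have "p n \<le> ph n + 2 * real n * e / y n"
          unfolding p_def ph_def e_def y_def[symmetric]
          by (rule deviation_perturbation[OF fm fP hm hP]) (use y0 n in auto)
        then have "1 / real n * p n \<le> 1 / real n * (ph n + 2 * real n * e / y n)" by (intro mult_left_mono) auto
        also have "\<dots> = 1 / real n * ph n + e * (2 / y n)" using n by (simp add: distrib_left)
        finally show ?thesis .
      qed
      then have "(\<Sum>n=3..N. 1 / real n * p n) \<le> (\<Sum>n=3..N. 1 / real n * ph n + e * (2 / y n))" by (rule sum_mono)
      also have "\<dots> = (\<Sum>n=3..N. 1 / real n * ph n) + e * s" by (simp only: sum.distrib sum_distrib_left s_def)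
      also have "(\<Sum>n=3..N. 1 / real n * ph n) \<le> K"
        unfolding ph_def he by (rule K) (use L im g2 in auto)
      finally show ?thesis using es by linarith
    qed
    then show ?thesis by blast
  qed
  then obtain K where K: "\<And>N. (\<Sum>n=3..N. 1 / real n * p n) \<le> K" by blast
  have "(\<lambda>n. 1 / real n * p n) summable_on {3..}"
  proof (rule nonneg_bounded_partial_sums_imp_summable_on)
    show "\<And>n. n \<in> {3..} \<Longrightarrow> 0 \<le> 1 / real n * p n" by (simp add: p_def)
    show "\<forall>\<^sub>F F in finite_subsets_at_top {3..}. (\<Sum>n\<in>F. 1 / real n * p n) \<le> K"
    proof (rule eventually_finite_subsets_at_top_weakI)
      fix A :: "nat set" assume A: "finite A" "A \<subseteq> {3..}"
      have "(\<Sum>n\<in>A. 1 / real n * p n) \<le> (\<Sum>n=3..Max (insert 0 A). 1 / real n * p n)"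
        by (rule sum_mono2) (use A in \<open>auto simp: p_def\<close>)
      then show "(\<Sum>n\<in>A. 1 / real n * p n) \<le> K" using K order_trans by blast
    qed
  qed
  then show ?thesis unfolding p_def pe .
qed

end

subsection \<open>The mixing coefficients\<close>

lemma phi_seq_nonneg: "0 \<le> phi_seq P F Y k n" by (simp add: phi_seq_def)

lemma phi_seq_ennreal_eq:
  assumes "prob_space P" "subalgebra P F" "1 \<le> k" "\<And>i. Y i \<in> borel_measurable P"
  shows "phi_seq_ennreal P F Y k n = ennreal (phi_seq P F Y k n)"
proof -
  have "phi_seq_ennreal P F Y k n \<le> 2" by (rule phi_seq_ennreal_le_2[where Y=Y, OF assms])
  then have "phi_seq_ennreal P F Y k n < top" by (rule le_less_trans) simp
  then show ?thesis by (simp add: phi_seq_def)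
qed

lemma phi_seq_le_2:
  assumes "prob_space P" "subalgebra P F" "1 \<le> k" "\<And>i. Y i \<in> borel_measurable P"
  shows "phi_seq P F Y k n \<le> 2"
proof -
  have "ennreal (phi_seq P F Y k n) \<le> ennreal 2"
    using phi_seq_ennreal_le_2[where Y=Y and n=n, OF assms] phi_seq_ennreal_eq[where Y=Y and n=n, OF assms] by simp
  then show ?thesis by (simp del: ennreal_numeral)
qed

lemma phi_seq_mono:
  assumes "prob_space P" "subalgebra P F" "1 \<le> k" "k \<le> k'" "\<And>i. Y i \<in> borel_measurable P"
  shows "phi_seq P F Y k n \<le> phi_seq P F Y k' n"
proof -
  have "phi_seq_ennreal P F Y k n \<le> phi_seq_ennreal P F Y k' n"
    unfolding phi_seq_ennreal_def using assms by (intro Max_mono image_mono) auto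
  then show ?thesis
    using phi_seq_ennreal_eq[where Y=Y and n=n, OF assms(1,2,3,5)] phi_seq_ennreal_eq[where Y=Y and n=n and k=k', OF assms(1,2) _ assms(5)] assms(3,4)
      by (simp add: ennreal_le_iff[OF phi_seq_nonneg])
qed

text \<open>On an event of \<open>F\<close> the product may be replaced by its conditional
  expectation, which differs from its mean by at most the coefficient almost everywhere; integrating
  over \<open>A\<close> produces the factor \<open>measure P A\<close>.\<close>

lemma phi_seq_cov:
  fixes Y :: "int \<Rightarrow> 'a \<Rightarrow> real" and x :: "nat \<Rightarrow> real"
  assumes P: "prob_space P" and F: "subalgebra P F" and k: "1 \<le> k" and Y: "\<And>i. Y i \<in> borel_measurable P"
    and js: "length js = l" "1 \<le> l" "l \<le> k" "sorted js" "\<And>i. i \<in> set js \<Longrightarrow> int n \<le> i"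
    and A: "A \<in> sets F"
  defines "W \<equiv> \<lambda>w. \<Prod>j<l. centered P (\<lambda>w'. indicat_real {..x j} (Y (js ! j) w')) w"
  shows "\<bar>LINT w|P. indicat_real A w * (W w - (LINT w|P. W w))\<bar> \<le> phi_seq P F Y k n * measure P A"
proof -
  interpret prob_space P by fact
  interpret finite_measure_subalgebra P F by unfold_locales (rule F)
  have AP: "A \<in> sets P" using A F by (auto simp: subalgebra_def)
  have bc: "ess_bdd P P (centered P (\<lambda>w'. indicat_real {..z} (Y i w')))" for z i
    unfolding centered_def using Y[of i]
    by (intro ess_bdd_diff ess_bdd_const ess_bddI[where B=1]) (auto simp: indicator_def)
  have "ess_bdd P P (\<lambda>w. \<Prod>j<m. centered P (\<lambda>w'. indicat_real {..x j} (Y (js ! j) w')) w)" for m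
    by (induction m) (auto simp: bc)
  then have W: "ess_bdd P P W" unfolding W_def .
  have I: "integrable P V" if V: "ess_bdd P P V" for V
    using V unfolding ess_bdd_def by (force intro: integrable_const_bound)
  define Z where "Z = real_cond_exp P F W"
  have IZ: "integrable P Z" unfolding Z_def by (rule real_cond_exp_int(1)[OF I[OF W]])
  have EZ: "(LINT w|P. Z w) = (LINT w|P. W w)" unfolding Z_def by (rule real_cond_exp_int(2)[OF I[OF W]])
  have "phi_mix P F l (\<lambda>j. Y (js ! j)) \<le> phi_seq_ennreal P F Y k n"
  proof -
    have "phi_mix P F l (\<lambda>j. Y (js ! j)) \<le> (SUP js\<in>{js :: int list. length js = l \<and> sorted js \<and> (\<forall>i\<in>set js. int n \<le> i)}.
        phi_mix P F l (\<lambda>j. Y (js ! j)))"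
      by (rule SUP_upper) (use js in auto)
    also have "\<dots> \<le> phi_seq_ennreal P F Y k n"
      unfolding phi_seq_ennreal_def by (rule Max_ge) (use js in auto)
    finally show ?thesis .
  qed
  moreover have "Linf_norm P (centered P Z) \<le> phi_mix P F l (\<lambda>j. Y (js ! j))"
    unfolding phi_mix_def Z_def W_def by (rule SUP_upper) simp
  moreover have "AE w in P. ennreal \<bar>centered P Z w\<bar> \<le> Linf_norm P (centered P Z)"
    unfolding Linf_norm_def by (rule esssup_AE)
  ultimately have "AE w in P. ennreal \<bar>centered P Z w\<bar> \<le> ennreal (phi_seq P F Y k n)"
    using phi_seq_ennreal_eq[where Y=Y and n=n, OF P F k Y] by (auto elim!: eventually_mono)
  then have Zb: "AE w in P. \<bar>Z w - (LINT w|P. W w)\<bar> \<le> phi_seq P F Y k n"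
    using EZ by (simp add: centered_def ennreal_le_iff[OF phi_seq_nonneg])
  have IA: "integrable P (\<lambda>w. indicat_real A w * V w)" if "integrable P V" for V
    using integrable_mult_indicator[OF AP that] by simp
  have "(LINT w|P. indicat_real A w * W w) = (LINT w|P. indicat_real A w * Z w)"
    using real_cond_exp_intA[OF I[OF W] A] by (simp add: set_lebesgue_integral_def Z_def)
  then have "(LINT w|P. indicat_real A w * (W w - (LINT w|P. W w))) = (LINT w|P. indicat_real A w * (Z w - (LINT w|P. W w)))"
    unfolding right_diff_distrib using IA[OF IZ] IA[OF I[OF W]] IA[of "\<lambda>_. LINT w|P. W w"] by simp
  also have "\<bar>\<dots>\<bar> \<le> (LINT w|P. \<bar>indicat_real A w * (Z w - (LINT w|P. W w))\<bar>)" by (rule integral_abs_bound)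
  also have "\<dots> \<le> (LINT w|P. phi_seq P F Y k n * indicat_real A w)"
  proof (rule integral_mono_AE)
    show "AE w in P. \<bar>indicat_real A w * (Z w - (LINT w|P. W w))\<bar> \<le> phi_seq P F Y k n * indicat_real A w"
      using Zb by eventually_elim (auto simp: indicator_def phi_seq_nonneg)
    show "integrable P (\<lambda>w. \<bar>indicat_real A w * (Z w - (LINT w|P. W w))\<bar>)"
      using IZ by (intro integrable_abs IA) auto
  qed (use I[OF ess_bdd_indicator[OF AP]] in auto)
  finally show ?thesis using AP I[OF ess_bdd_indicator[OF AP]] by simp
qed

text \<open>The filtration is \<open>F_i = \<theta>^{-i} F_0\<close>; by invariance of \<open>P\<close>, the mixing bounds for
  \<open>F_i\<close> reduce to those for \<open>F_0\<close>.\<close>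

lemma mixing_of_mpt:
  fixes P F0 :: "'a measure" and Y0 :: "'a \<Rightarrow> real" and Y :: "int \<Rightarrow> 'a \<Rightarrow> real"
  assumes P: "prob_space P" and \<theta>: "\<theta> \<in> measurable P P" "distr P P \<theta> = P" and F0: "subalgebra P F0"
    and inv: "sets F0 \<subseteq> (\<lambda>A. \<theta> -` A \<inter> space P) ` sets F0"
    and Y0: "Y0 \<in> borel_measurable F0" and Ym: "\<And>i. Y i \<in> borel_measurable P"
    and Y: "\<And>i w. Y (int i) w = Y0 ((\<theta> ^^ i) w)"
    and sm: "summable (\<lambda>k. sqrt (phi_seq P F0 Y 2 k))"
  shows "mixing P (\<lambda>i. vimage_algebra (space P) (\<theta> ^^ i) F0) (\<lambda>i. Y (int i)) (phi_seq P F0 Y 1) (phi_seq P F0 Y 2)"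
proof -
  interpret prob_space P by fact
  let ?F = "\<lambda>i. vimage_algebra (space P) (\<theta> ^^ i) F0"
  have sF0: "space F0 = space P" and F0P: "\<And>A. A \<in> sets F0 \<Longrightarrow> A \<in> sets P" using F0 by (auto simp: subalgebra_def)
  have \<theta>i [measurable]: "\<theta> ^^ i \<in> measurable P P" for i
  proof (induction i)
    case (Suc i) then show ?case using measurable_comp[OF Suc \<theta>(1)] by (simp add: comp_def)
  qed (simp add: id_def)
  have \<theta>sp: "(\<theta> ^^ i) w \<in> space P" if "w \<in> space P" for i w using measurable_space[OF \<theta>i that] .
  have di: "distr P P (\<theta> ^^ i) = P" for i
  proof (induction i)
    case 0 then show ?case by (simp add: id_def distr_id)
  next
    case (Suc i)
    have "distr P P (\<theta> ^^ Suc i) = distr (distr P P (\<theta> ^^ i)) P \<theta>"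
      using distr_distr[OF \<theta>(1) \<theta>i[of i]] by (simp only: funpow.simps)
    then show ?case unfolding Suc \<theta>(2) .
  qed
  have int: "(LINT w|P. G ((\<theta> ^^ i) w)) = (LINT w|P. G w)" if "G \<in> borel_measurable P" for G :: "'a \<Rightarrow> real" and i
    using integral_distr[OF \<theta>i[of i], of G] that di by simp
  have sF: "sets (?F i) = {(\<theta> ^^ i) -` A \<inter> space P | A. A \<in> sets F0}" for i
    by (rule sets_vimage_algebra2) (use \<theta>sp sF0 in auto)
  have Yshift: "Y (int j) w = Y (int (j - i)) ((\<theta> ^^ i) w)" if "i \<le> j" for i j w
    unfolding Y using fun_cong[OF funpow_add[of "j - i" i \<theta>], of w] that by simp
  have ind: "(\<lambda>w. indicat_real {..x} (Y m w)) \<in> borel_measurable P" for x m using Ym[of m] by measurable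
  have Eshift: "(LINT w|P. indicat_real {..x} (Y (int j) w)) = (LINT w|P. indicat_real {..x} (Y (int (j - i)) w))" if "i \<le> j" for i j x
    unfolding Yshift[OF that] by (rule int[OF ind])
  have ind_int: "integrable P (\<lambda>w. indicat_real {..x} (Y m w))" for x m
    by (rule integrable_const_bound[where B=1]) (use ind in \<open>auto simp: indicator_def\<close>)
  show ?thesis
  proof unfold_locales
    show "subalgebra P (?F i)" for i
      unfolding subalgebra_def sF using F0P \<theta>i by (auto intro: measurable_sets)
    show "sets (?F i) \<subseteq> sets (?F j)" if "i \<le> j" for i j
      using that
    proof (induction j rule: dec_induct)
      case (step j)
      have "sets (?F j) \<subseteq> sets (?F (Suc j))"
      proof
        fix B assume "B \<in> sets (?F j)"
        then obtain A where A: "A \<in> sets F0" "B = (\<theta> ^^ j) -` A \<inter> space P" unfolding sF by blast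
        \<comment> \<open>Each event of F_0 is a preimage under \<theta> of another event of F_0,
          which supplies the additional iterate.\<close>
        then obtain A' where A': "A' \<in> sets F0" "A = \<theta> -` A' \<inter> space P" using inv by blast
        then have "B = (\<theta> ^^ Suc j) -` A' \<inter> space P" using A(2) \<theta>sp by auto
        then show "B \<in> sets (?F (Suc j))" unfolding sF using A' by blast
      qed
      then show ?case using step by blast
    qed simp
    show "Y (int i) \<in> borel_measurable (?F i)" for i
    proof -
      have "\<theta> ^^ i \<in> measurable (?F i) F0" by (rule measurable_vimage_algebra1) (use \<theta>sp sF0 in auto)
      from measurable_compose[OF this Y0] show ?thesis by (simp add: Y[abs_def])
    qed
    show "distr P borel (Y (int i)) = distr P borel (Y (int 0))" for i
    proof -
      have Y0P: "Y0 \<in> borel_measurable P" using Ym[of 0] Y[of 0] by (simp cong: measurable_cong)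
      have "distr P borel (Y (int i)) = distr (distr P P (\<theta> ^^ i)) borel Y0"
        by (subst distr_distr[OF Y0P \<theta>i]) (simp add: Y[abs_def] comp_def)
      also have "\<dots> = distr P borel Y0" by (simp only: di)
      finally have "distr P borel (Y (int i)) = distr P borel Y0" by (simp add: Y[abs_def])
      moreover have "Y (int 0) = Y0" using Y[of 0] by auto
      ultimately show ?thesis by simp
    qed
    show "0 \<le> phi_seq P F0 Y 1 k" for k by (rule phi_seq_nonneg)
    show "phi_seq P F0 Y 1 k \<le> phi_seq P F0 Y 2 k" for k by (rule phi_seq_mono[where Y=Y, OF P F0 _ _ Ym]) auto
    show "phi_seq P F0 Y 2 k \<le> 2" for k by (rule phi_seq_le_2[where Y=Y, OF P F0 _ Ym]) auto
    show "summable (\<lambda>k. sqrt (phi_seq P F0 Y 2 k))" by (rule sm)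
  next
    fix A i j x assume "A \<in> sets (?F i)" and ij: "i \<le> j"
    then obtain B where B: "B \<in> sets F0" "A = (\<theta> ^^ i) -` B \<inter> space P" unfolding sF by blast
    have BP [measurable]: "B \<in> sets P" by (rule F0P[OF B(1)])
    have pA: "prob A = prob B" using measure_distr[OF \<theta>i BP, of i] di[of i] B(2) by simp
    define E where "E = (LINT w|P. indicat_real {..x} (Y (int (j - i)) w))"
    note [measurable] = ind[of x "int (j - i)"]
    have "(LINT w|P. indicat_real A w * cind x (Y (int j)) w) =
      (LINT w|P. indicat_real B ((\<theta> ^^ i) w) * (indicat_real {..x} (Y (int (j - i)) ((\<theta> ^^ i) w)) - E))"
      unfolding Eshift[OF ij] E_def[symmetric]
      by (intro Bochner_Integration.integral_cong refl) (simp add: B(2) Yshift[OF ij] indicator_def)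
    also have "\<dots> = (LINT w|P. indicat_real B w * (indicat_real {..x} (Y (int (j - i)) w) - E))"
      by (rule int[of "\<lambda>w. indicat_real B w * (indicat_real {..x} (Y (int (j - i)) w) - E)"]) measurable
    also have "\<bar>\<dots>\<bar> \<le> phi_seq P F0 Y 1 (j - i) * prob B"
    proof -
      \<comment> \<open>A single centered factor has mean 0, so the outer centering of the
        coefficient disappears.\<close>
      have "(LINT w|P. indicat_real {..x} (Y (int (j - i)) w) - E) = 0"
        using ind_int[of x "int (j - i)"] by (simp add: E_def prob_space)
      then show ?thesis
        using phi_seq_cov[where Y=Y and js="[int (j - i)]" and l=1 and n="j - i" and A=B and x="\<lambda>_. x", OF P F0 order_refl Ym] B(1)
        by (simp add: centered_def E_def)
    qed
    finally show "\<bar>LINT w|P. indicat_real A w * cind x (Y (int j)) w\<bar>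
      \<le> phi_seq P F0 Y 1 (j - i) * prob A" unfolding pA .
  next
    fix A i s t x y assume "A \<in> sets (?F i)" and st: "i \<le> s" "s \<le> t"
    then obtain B where B: "B \<in> sets F0" "A = (\<theta> ^^ i) -` B \<inter> space P" unfolding sF by blast
    have BP [measurable]: "B \<in> sets P" by (rule F0P[OF B(1)])
    have pA: "prob A = prob B" using measure_distr[OF \<theta>i BP, of i] di[of i] B(2) by simp
    have it: "i \<le> t" using st by simp
    define D where "D = (LINT w|P. indicat_real {..x} (Y (int (s - i)) w))"
    define E where "E = (LINT w|P. indicat_real {..y} (Y (int (t - i)) w))"
    define W where "W w = (indicat_real {..x} (Y (int (s - i)) w) - D) * (indicat_real {..y} (Y (int (t - i)) w) - E)" for w
    note [measurable] = ind[of x "int (s - i)"] ind[of y "int (t - i)"]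
    have Wm [measurable]: "W \<in> borel_measurable P" unfolding W_def by measurable
    have DE: "0 \<le> D" "D \<le> 1" "0 \<le> E" "E \<le> 1" unfolding D_def E_def
      by (auto intro!: integral_nonneg_AE integral_le_const[OF ind_int])
    have WI: "integrable P W"
    proof (rule integrable_const_bound[where B="1 * 1"])
      show "AE w in P. norm (W w) \<le> 1 * 1"
        unfolding W_def real_norm_def abs_mult
        by (intro AE_I2 mult_mono) (use DE in \<open>auto simp: indicator_def\<close>)
    qed measurable
    have "(LINT w|P. (indicat_real A w - prob A) *
         (cind x (Y (int s)) w *
          cind y (Y (int t)) w)) =
      (LINT w|P. (indicat_real B ((\<theta> ^^ i) w) - prob B) * W ((\<theta> ^^ i) w))"
      unfolding Eshift[OF st(1)] Eshift[OF it] D_def[symmetric] E_def[symmetric] pA W_def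
      by (intro Bochner_Integration.integral_cong refl) (simp add: B(2) Yshift[OF st(1)] Yshift[OF it] indicator_def)
    also have "\<dots> = (LINT w|P. (indicat_real B w - prob B) * W w)"
      by (rule int[of "\<lambda>w. (indicat_real B w - prob B) * W w"]) measurable
    \<comment> \<open>The centering moves from the event to the product, whose mean need not be 0,
      and this is the covariance that the coefficient controls.\<close>
    also have "\<dots> = (LINT w|P. indicat_real B w * (W w - (LINT w|P. W w)))"
    proof -
      have "integrable P (\<lambda>w. indicat_real B w * W w)" using integrable_mult_indicator[OF BP WI] by simp
      moreover have "integrable P (indicat_real B)" by (rule integrable_const_bound[where B=1]) auto
      ultimately show ?thesis using WI BP by (simp add: left_diff_distrib right_diff_distrib mult.commute)
    qed
    also have "\<bar>\<dots>\<bar> \<le> phi_seq P F0 Y 2 (s - i) * prob B"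
    proof -
      have WW: "(\<Prod>j<2. centered P (\<lambda>w'. indicat_real {..(\<lambda>j. if j = 0 then x else y) j} (Y ([int (s - i), int (t - i)] ! j) w')) w) = W w" for w
        by (simp add: numeral_2_eq_2 centered_def W_def D_def E_def)
      have le: "int (s - i) \<le> m" if "m \<in> set [int (s - i), int (t - i)]" for m using that st by auto
      show ?thesis
        using phi_seq_cov[where Y=Y and k=2 and js="[int (s - i), int (t - i)]" and l=2 and n="s - i" and A=B and x="\<lambda>j. if j = 0 then x else y", OF P F0 _ Ym _ _ _ _ le] B(1) st
        unfolding WW by simp
    qed
    finally show "\<bar>LINT w|P. (indicat_real A w - prob A) *
         (cind x (Y (int s)) w *
          cind y (Y (int t)) w)\<bar>
        \<le> phi_seq P F0 Y 2 (s - i) * prob A" unfolding pA .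
  qed
qed

theorem proposition5p3:
  fixes P F0 :: "'a measure" and \<theta> :: "'a \<Rightarrow> 'a" and Y0 :: "'a \<Rightarrow> real"
    and Y :: "int \<Rightarrow> 'a \<Rightarrow> real" and f :: "real \<Rightarrow> real" and M C :: real
    and X :: "int \<Rightarrow> 'a \<Rightarrow> real" and S :: "nat \<Rightarrow> 'a \<Rightarrow> real"
  assumes "prob_space P"
    and "bimeasurable_mpt P \<theta>"
    and "subalgebra P F0"
    and "sets F0 \<subseteq> (\<lambda>A. \<theta> -` A \<inter> space P) ` sets F0"
    and "Y0 \<in> borel_measurable F0"
    and Y: "Y = (\<lambda>i \<omega>. Y0 (int_iterate (space P) \<theta> i \<omega>))"
    and "(\<lambda>k::nat. real k powr (1 / sqrt 3 - 1 / 2) * sqrt (phi_seq P F0 Y 2 k)) summable_on {1..}"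
    and "M > 0"
    and "f \<in> Mon2c M (distr P borel Y0)"
    and X: "X = (\<lambda>i \<omega>. f (Y i \<omega>) - (LINT \<omega>'|P. f (Y i \<omega>')))"
    and S: "S = (\<lambda>n \<omega>. \<Sum>k=1..n. X (int k) \<omega>)"
    and C: "C = 16 * (\<Sum>k. sqrt (phi_seq P F0 Y 1 k))"
  shows "(\<lambda>n::nat. 1 / real n * measure P {\<omega> \<in> space P.
            (MAX k\<in>{1..n}. \<bar>S k \<omega>\<bar>) > 3 * C * M * sqrt (real n * ln (ln (real n)))})
          summable_on {3..}"
proof -
  interpret prob_space P by fact
  define \<tau> where "\<tau> = the_inv_into (space P) \<theta>"
  have \<theta>: "\<theta> \<in> measurable P P" "distr P P \<theta> = P" and \<tau>: "\<tau> \<in> measurable P P"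
    using \<open>bimeasurable_mpt P \<theta>\<close> by (auto simp: bimeasurable_mpt_def \<tau>_def)
  have it: "T ^^ i \<in> measurable P P" if "T \<in> measurable P P" for T i
  proof (induction i)
    case (Suc i) then show ?case using measurable_comp[OF Suc that] by (simp add: comp_def)
  qed (simp add: id_def)
  have Y0P: "Y0 \<in> borel_measurable P"
    by (rule measurable_from_subalg[OF \<open>subalgebra P F0\<close> \<open>Y0 \<in> borel_measurable F0\<close>])
  have Ym: "Y i \<in> borel_measurable P" for i
  proof -
    have "int_iterate (space P) \<theta> i \<in> measurable P P"
      unfolding int_iterate_def \<tau>_def[symmetric] using it[OF \<theta>(1)] it[OF \<tau>] by simp
    from measurable_compose[OF this Y0P] show ?thesis by (simp add: Y)
  qed
  have Yi: "Y (int i) w = Y0 ((\<theta> ^^ i) w)" for i w by (simp add: Y int_iterate_def)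
  \<comment> \<open>This makes the exponent of the weights nonnegative; they are then at least 1 for
    k >= 1, and comparison yields summability of the square roots.\<close>
  have "sqrt 3 \<le> (2::real)" by (rule real_le_lsqrt) auto
  then have e: "0 \<le> 1 / sqrt 3 - (1 / 2 :: real)" using frac_le[of 1 1 "sqrt 3" 2] by simp
  have "(\<lambda>k. sqrt (phi_seq P F0 Y 2 k)) summable_on {1..}"
  proof (rule summable_on_comparison_test)
    show "(\<lambda>k. real k powr (1 / sqrt 3 - 1 / 2) * sqrt (phi_seq P F0 Y 2 k)) summable_on {1..}" by fact
    fix k :: nat assume "k \<in> {1..}"
    then have "1 * sqrt (phi_seq P F0 Y 2 k) \<le> real k powr (1 / sqrt 3 - 1 / 2) * sqrt (phi_seq P F0 Y 2 k)"
      by (intro mult_right_mono ge_one_powr_ge_zero e) (auto simp: phi_seq_nonneg)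
    then show "sqrt (phi_seq P F0 Y 2 k) \<le> real k powr (1 / sqrt 3 - 1 / 2) * sqrt (phi_seq P F0 Y 2 k)" by simp
  qed (simp add: phi_seq_nonneg)
  \<comment> \<open>The hypothesis starts at index 1, while the series in \<open>mixing\<close>
    includes the coefficient at 0.\<close>
  then have "(\<lambda>k. sqrt (phi_seq P F0 Y 2 k)) summable_on ({1..} \<union> {0})"
    by (subst summable_on_Un_disjoint) auto
  then have "(\<lambda>k. sqrt (phi_seq P F0 Y 2 k)) summable_on UNIV"
    by (rule summable_on_subset_banach) (auto simp: Suc_le_eq)
  then have sm: "summable (\<lambda>k. sqrt (phi_seq P F0 Y 2 k))" by (rule summable_on_imp_summable)
  interpret mixing P "\<lambda>i. vimage_algebra (space P) (\<theta> ^^ i) F0" "\<lambda>i. Y (int i)" "phi_seq P F0 Y 1" "phi_seq P F0 Y 2"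
    by (rule mixing_of_mpt[OF \<open>prob_space P\<close> \<theta> assms(3,4,5) Ym Yi sm])
  have "Y (int 0) = Y0" using Yi[of 0] by auto
  then have "f \<in> Mon2c M (distr P borel (Y (int 0)))" using assms(9) by simp
  then have fm: "f \<in> borel_measurable borel" by (auto simp: Mon2c_def dest: borel_measurable_integrable)
  have CM: "3 * C * M = 3 * (16 * \<Psi>) * M" unfolding C \<Psi>_def by (rule refl)
  have Sk: "S k w = (\<Sum>i=1..k. f (Y (int i) w) - (LINT w|P. f (Y (int 0) w)))" for k w
    unfolding S X using expect_Y[OF fm] by (intro sum.cong refl) (rule arg_cong)
  have "(\<lambda>n. 1 / real n * prob {w \<in> space P. \<exists>k\<in>{1..n}. 3 * C * M * sqrt (real n * LL n) < \<bar>S k w\<bar>}) summable_on {3..}"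
    unfolding CM Sk by (rule deviation_summable) fact+
  moreover have eq: "(MAX k\<in>{1..n}. \<bar>S k w\<bar>) > 3 * C * M * sqrt (real n * LL n) \<longleftrightarrow>
      (\<exists>k\<in>{1..n}. 3 * C * M * sqrt (real n * LL n) < \<bar>S k w\<bar>)" if "n \<in> {3..}" for n w
    using that by (subst Max_gr_iff) auto
  ultimately show ?thesis
    by (elim summable_on_cong[THEN iffD1, rotated]) (simp only: eq)
qed

end
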